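(* Consider the canonical dynamical system $$\dot x=(u+y^2+z^2)\,x,\quad \dot y=(u+y^2-2z^2)\,y,\quad \dot z=(u-2y^2+z^2)\,z,\quad \dot u=u^2-y^4+y^2z^2-z^4 \qquad(\mathrm{S})$$ (defining the $\vartheta,\eta$-constants) and Jacobi's system, written with the same independent variable $\tau$, $$\dot A=2A^2B,\qquad \dot B=bA^3,\qquad \dot a=-16\,bA^2,\qquad \dot b=abA^2. \qquad(\mathrm{J})$$ 1. The systems (S) and (J) are equivalent. They are related through the point transformation $$A=\frac{1-i}{2\boldsymbol{I}}\,y,\qquad B=\frac{1+i}{2}\,\frac{\boldsymbol{I}}{y}\,(u+y^2-2z^2),$$ $$a=\frac{12}{\pi i}\,\frac{y^2-z^2}{x^2}\,\frac{y^2-2z^2}{y^2},\qquad b=-\frac{18}{\pi^2}\,\frac{z^2}{x^4y^4}\,(y^2-z^2)^3,$$ where $\boldsymbol{I}$ is given by $\pi\boldsymbol{I}^2=(y^2-z^2)/x^2$. 2. The system (S) has the following general solution: $$x=\varepsilon\,\frac{\vartheta_2^2(T)}{\gamma\tau+\delta},\quad y=\sqrt{\frac{\pi i}{6}}\,\frac{\vartheta_3^2(T)}{\gamma\tau+\delta},\quad z=\sqrt{\frac{\pi i}{6}}\,\frac{\vartheta_4^2(T)}{\gamma\tau+\delta},\quad u=\frac{2i}{\pi}\,\frac{\eta(T)}{(\gamma\tau+\delta)^2}-\frac{\gamma}{\gamma\tau+\delta},$$ where $T=\dfrac{\alpha\tau+\beta}{\gamma\tau+\delta}$, $\alpha\delta-\beta\gamma=1$,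 and $\varepsilon\neq0$ is the fourth free constant. 3. With $\varepsilon=0$, the solution decouples into the two-parametric elementary one: $$x=0,\qquad y=\frac{\pm1}{\gamma\tau+\delta},\qquad z=\frac{1}{\gamma\tau+\delta},\qquad u=-\frac{\gamma^2\tau+\gamma\delta-1}{(\gamma\tau+\delta)^2}.$$
   Context: The dot denotes $d/d\tau$; all quantities are complex, and $\alpha,\beta,\gamma,\delta,\varepsilon$ are constants. The quantity $\boldsymbol{I}$ is a constant of motion of (S). The functions are defined for $\operatorname{Im}T>0$ by $$\vartheta_2(T)=e^{\frac14\pi iT}\sum_{k\in\mathbb{Z}}e^{(k^2+k)\pi iT},\quad \vartheta_3(T)=\sum_{k\in\mathbb{Z}}e^{k^2\pi iT},\quad \vartheta_4(T)=\sum_{k\in\mathbb{Z}}(-1)^ke^{k^2\pi iT},$$ $$\eta(T)=2\pi^2\Big\{\frac1{24}-\sum_{k\ge1}\frac{e^{2k\pi iT}}{(1-e^{2k\pi iT})^2}\Big\}.$$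
   Formalization: In part 3, setting ε=0 in part 2 gives x=0 with y,z,u still theta/eta functions, which solves (S) and is not elementary; the formal version instead shows that the displayed functions are exactly the solutions with x=0, y²=z², z≠0. *)

theory Defs
  imports "HOL-Complex_Analysis.Complex_Analysis"
begin

definition theta2 :: "complex \<Rightarrow> complex" where
  "theta2 T = exp (of_real pi * \<i> * T / 4) * (\<Sum>\<^sub>\<infinity>k::int. exp (of_int (k\<^sup>2 + k) * of_real pi * \<i> * T))"

definition theta3 :: "complex \<Rightarrow> complex" where
  "theta3 T = (\<Sum>\<^sub>\<infinity>k::int. exp (of_int (k\<^sup>2) * of_real pi * \<i> * T))"

definition theta4 :: "complex \<Rightarrow> complex" where
  "theta4 T = (\<Sum>\<^sub>\<infinity>k::int. (-1) powi k * exp (of_int (k\<^sup>2) * of_real pi * \<i> * T))"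

text \<open>This is the Weierstrass eta-constant, i.e. the Eisenstein series of weight 2 up to a factor;
  it is not Dedekind's function.\<close>

definition eta :: "complex \<Rightarrow> complex" where
  "eta T = 2 * (of_real pi)\<^sup>2 *
     (1 / 24 - (\<Sum>\<^sub>\<infinity>k\<in>{1::nat..}. exp (2 * of_nat k * of_real pi * \<i> * T) / (1 - exp (2 * of_nat k * of_real pi * \<i> * T))\<^sup>2))"

text \<open>Below, \<open>D\<close> is always an open set of values of the independent variable, so the
  derivatives are ordinary complex derivatives and solutions are holomorphic on \<open>D\<close>.\<close>

definition solves_S ::
  "complex set \<Rightarrow> (complex \<Rightarrow> complex) \<Rightarrow> (complex \<Rightarrow> complex) \<Rightarrow> (complex \<Rightarrow> complex) \<Rightarrow> (complex \<Rightarrow> complex) \<Rightarrow> bool"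
where
  "solves_S D x y z u \<longleftrightarrow> (\<forall>\<tau>\<in>D.
     (x has_field_derivative (u \<tau> + (y \<tau>)\<^sup>2 + (z \<tau>)\<^sup>2) * x \<tau>) (at \<tau>) \<and>
     (y has_field_derivative (u \<tau> + (y \<tau>)\<^sup>2 - 2 * (z \<tau>)\<^sup>2) * y \<tau>) (at \<tau>) \<and>
     (z has_field_derivative (u \<tau> - 2 * (y \<tau>)\<^sup>2 + (z \<tau>)\<^sup>2) * z \<tau>) (at \<tau>) \<and>
     (u has_field_derivative (u \<tau>)\<^sup>2 - y \<tau> ^ 4 + (y \<tau>)\<^sup>2 * (z \<tau>)\<^sup>2 - z \<tau> ^ 4) (at \<tau>))"

definition solves_J ::
  "complex set \<Rightarrow> (complex \<Rightarrow> complex) \<Rightarrow> (complex \<Rightarrow> complex) \<Rightarrow> (complex \<Rightarrow> complex) \<Rightarrow> (complex \<Rightarrow> complex) \<Rightarrow> bool"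
where
  "solves_J D A B a b \<longleftrightarrow> (\<forall>\<tau>\<in>D.
     (A has_field_derivative 2 * (A \<tau>)\<^sup>2 * B \<tau>) (at \<tau>) \<and>
     (B has_field_derivative b \<tau> * A \<tau> ^ 3) (at \<tau>) \<and>
     (a has_field_derivative - 16 * b \<tau> * (A \<tau>)\<^sup>2) (at \<tau>) \<and>
     (b has_field_derivative a \<tau> * b \<tau> * (A \<tau>)\<^sup>2) (at \<tau>))"

text \<open>The point transformation divides by \<open>x\<close>, \<open>y\<close> and \<open>I\<close>, hence lives where these do not vanish.
  \<open>I\<close> is a continuous choice of the square root; its constancy is not built in.\<close>

definition point_transf ::
  "complex set \<Rightarrow> (complex \<Rightarrow> complex) \<Rightarrow> (complex \<Rightarrow> complex) \<Rightarrow> (complex \<Rightarrow> complex) \<Rightarrow> (complex \<Rightarrow> complex) \<Rightarrow>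
   (complex \<Rightarrow> complex) \<Rightarrow> (complex \<Rightarrow> complex) \<Rightarrow> (complex \<Rightarrow> complex) \<Rightarrow> (complex \<Rightarrow> complex) \<Rightarrow> (complex \<Rightarrow> complex) \<Rightarrow> bool"
where
  "point_transf D x y z u I A B a b \<longleftrightarrow>
     continuous_on D I \<and>
     (\<forall>\<tau>\<in>D. x \<tau> \<noteq> 0 \<and> y \<tau> \<noteq> 0 \<and> I \<tau> \<noteq> 0 \<and>
        of_real pi * (I \<tau>)\<^sup>2 = ((y \<tau>)\<^sup>2 - (z \<tau>)\<^sup>2) / (x \<tau>)\<^sup>2 \<and>
        A \<tau> = (1 - \<i>) / (2 * I \<tau>) * y \<tau> \<and>
        B \<tau> = (1 + \<i>) / 2 * (I \<tau> / y \<tau>) * (u \<tau> + (y \<tau>)\<^sup>2 - 2 * (z \<tau>)\<^sup>2) \<and>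
        a \<tau> = 12 / (of_real pi * \<i>) * (((y \<tau>)\<^sup>2 - (z \<tau>)\<^sup>2) / (x \<tau>)\<^sup>2) * (((y \<tau>)\<^sup>2 - 2 * (z \<tau>)\<^sup>2) / (y \<tau>)\<^sup>2) \<and>
        b \<tau> = - (18 / (of_real pi)\<^sup>2) * ((z \<tau>)\<^sup>2 / (x \<tau> ^ 4 * y \<tau> ^ 4)) * ((y \<tau>)\<^sup>2 - (z \<tau>)\<^sup>2) ^ 3)"

definition frac_lin :: "complex \<Rightarrow> complex \<Rightarrow> complex \<Rightarrow> complex \<Rightarrow> complex \<Rightarrow> complex" where
  "frac_lin \<alpha> \<beta> \<gamma> \<delta> \<tau> = (\<alpha> * \<tau> + \<beta>) / (\<gamma> * \<tau> + \<delta>)"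

definition gen_dom :: "complex \<Rightarrow> complex \<Rightarrow> complex \<Rightarrow> complex \<Rightarrow> complex set" where
  "gen_dom \<alpha> \<beta> \<gamma> \<delta> = {\<tau>. \<gamma> * \<tau> + \<delta> \<noteq> 0 \<and> Im (frac_lin \<alpha> \<beta> \<gamma> \<delta> \<tau>) > 0}"

definition gen_x :: "complex \<Rightarrow> complex \<Rightarrow> complex \<Rightarrow> complex \<Rightarrow> complex \<Rightarrow> complex \<Rightarrow> complex" where
  "gen_x \<alpha> \<beta> \<gamma> \<delta> \<epsilon> \<tau> = \<epsilon> * ((theta2 (frac_lin \<alpha> \<beta> \<gamma> \<delta> \<tau>))\<^sup>2 / (\<gamma> * \<tau> + \<delta>))"

definition gen_y :: "complex \<Rightarrow> complex \<Rightarrow> complex \<Rightarrow> complex \<Rightarrow> complex \<Rightarrow> complex" where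
  "gen_y \<alpha> \<beta> \<gamma> \<delta> \<tau> = csqrt (of_real pi * \<i> / 6) * ((theta3 (frac_lin \<alpha> \<beta> \<gamma> \<delta> \<tau>))\<^sup>2 / (\<gamma> * \<tau> + \<delta>))"

definition gen_z :: "complex \<Rightarrow> complex \<Rightarrow> complex \<Rightarrow> complex \<Rightarrow> complex \<Rightarrow> complex" where
  "gen_z \<alpha> \<beta> \<gamma> \<delta> \<tau> = csqrt (of_real pi * \<i> / 6) * ((theta4 (frac_lin \<alpha> \<beta> \<gamma> \<delta> \<tau>))\<^sup>2 / (\<gamma> * \<tau> + \<delta>))"

definition gen_u :: "complex \<Rightarrow> complex \<Rightarrow> complex \<Rightarrow> complex \<Rightarrow> complex \<Rightarrow> complex" where
  "gen_u \<alpha> \<beta> \<gamma> \<delta> \<tau> =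
     2 * \<i> / of_real pi * (eta (frac_lin \<alpha> \<beta> \<gamma> \<delta> \<tau>) / (\<gamma> * \<tau> + \<delta>)\<^sup>2) - \<gamma> / (\<gamma> * \<tau> + \<delta>)"

end

theory Submission
  imports Defs "HOL-Probability.Distributions"
begin

text \<open>
  In the nome \<open>p = exp (\<pi> \<i> T)\<close> the theta constants are \<open>\<phi> p\<close>, \<open>\<phi> (- p)\<close> and \<open>p\<close> to the power
  \<open>1/4\<close> times \<open>\<psi> p\<close>, where \<open>\<phi>\<close> and \<open>\<psi>\<close> are the sums of \<open>p ^ (k\<^sup>2)\<close> and \<open>p ^ (k\<^sup>2 + k)\<close> over all
  integers \<open>k\<close>. Turning the square lattice by 45 degrees expresses products of these functions at \<open>p\<close>
  through their values at \<open>p\<^sup>2\<close> (\<open>nome_phi_square\<close>, \<open>nome_phi_mult_minus\<close>, \<open>nome_psi_square\<close>). Since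
  repeated squaring drives \<open>p\<close> to \<open>0\<close>, a continuous function that is unchanged under \<open>p \<mapsto> p\<^sup>2\<close> is
  constant, and a holomorphic one with \<open>f p = 4 * f (p\<^sup>2)\<close> and \<open>f 0 = 0\<close> vanishes. This one remark yields in turn: the theta constants
  have no zeros, the logarithmic derivatives of their quotients are multiples of fourth powers of theta constants
  (\<open>dlog3_minus_dlog4\<close>, \<open>dlog2_minus_dlog3\<close>), and the logarithmic derivative of the product of the
  three satisfies Ramanujan's differential equation (\<open>ramanujan_dlog_sum\<close>). That the last
  function is the Lambert series \<open>\<eta>\<close> follows from a finite form of Jacobi's triple product at
  \<open>z = - 1\<close> (\<open>dlog4_lambert\<close>). These identities say that the theta constants and \<open>\<eta>\<close> solve (S), and the
  behaviour of (S) under Moebius transformations of \<open>\<tau>\<close> gives the family of solutions.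

  That there are no other solutions with \<open>x y z (y\<^sup>2 - z\<^sup>2) \<noteq> 0\<close> uses modularity. The inversion \<open>T \<mapsto> - 1 / T\<close>
  is obtained without Poisson summation: on the imaginary axis, the modulus at \<open>t\<close> and the comodulus at
  \<open>1 / t\<close> follow the same Landen recursion under \<open>t \<mapsto> 2 t\<close> and have the same exponential rate of decay,
  which forces them to be equal (\<open>landen_orbit_le\<close>); the Gaussian integral enters as the value of that
  rate. Inversion and the shift \<open>T \<mapsto> T + 1\<close> move every point of the half-plane into a
  fixed half-strip away from the real axis, whence, by
  the maximum principle, the comodulus takes all values except \<open>0\<close>, \<open>1\<close> and \<open>- 1\<close>
  (\<open>ell_comodulus_surj\<close>). So the parameters can be fitted to any such initial values, and solutions of (S) are
  unique. Nor can they continue beyond the preimage of the half-plane, because the invariant \<open>theta_height\<close> is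
  bounded below: it bounds a function whose zeros form the boundary of the domain from below by a
  continuous positive function of the solution (\<open>dom_form_lower_bound\<close>).

  The equivalence with (J) is elementary. Along (S) the functions \<open>y\<^sup>2 - z\<^sup>2\<close> and \<open>x\<^sup>2\<close> have the same
  logarithmic derivative, so \<open>I\<close> is constant; along (J) the quantity \<open>a\<^sup>2 + 32 b\<close>, which equals \<open>- 144 I ^ 4\<close>, is
  constant. Given a solution of (J), the squares of \<open>x\<close> and \<open>z\<close> are determined, and holomorphic square
  roots exist because a function \<open>b\<close> with \<open>b' = (a A\<^sup>2) b\<close> vanishes everywhere or nowhere. On the locus
  \<open>y\<^sup>2 = z\<^sup>2\<close>, finally, \<open>1 / z\<close> is an affine function of \<open>\<tau>\<close>.
\<close>

section \<open>Theta series in the nome\<close>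

(* Both notions of absolutely summable families claim this infix. *)
no_notation Infinite_Set_Sum.abs_summable_on (infix "abs'_summable'_on" 50)

text \<open>The exponents are natural numbers so that \<open>p = 0\<close>, the cusp \<open>T = \<i> \<infinity>\<close>, is an ordinary point of the
  disc; all limits at the cusp become evaluations at \<open>0\<close>.\<close>

definition nome_phi :: "complex \<Rightarrow> complex" where
  "nome_phi p = (\<Sum>\<^sub>\<infinity>k::int. p ^ nat (k\<^sup>2))"

definition nome_psi :: "complex \<Rightarrow> complex" where
  "nome_psi p = (\<Sum>\<^sub>\<infinity>k::int. p ^ nat (k\<^sup>2 + k))"

lemma int_sq_add_self_nonneg: "0 \<le> (k::int)\<^sup>2 + k"
proof (cases "k \<ge> 0")
  case False
  then have "0 \<le> (-k) * (-k - 1)" by (intro mult_nonneg_nonneg) auto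
  then show ?thesis by (simp add: power2_eq_square algebra_simps)
qed auto

lemma has_sum_int_split:
  fixes f :: "int \<Rightarrow> 'a::banach"
  assumes "(\<lambda>n. f (int n)) abs_summable_on UNIV" "(\<lambda>n. f (- int n - 1)) abs_summable_on UNIV"
  shows "f abs_summable_on UNIV"
    and "(f has_sum ((\<Sum>n. f (int n)) + (\<Sum>n. f (- int n - 1)))) UNIV"
proof -
  have U: "(UNIV::int set) = range int \<union> range (\<lambda>n. - int n - 1)"
  proof -
    have "x \<in> range int \<union> range (\<lambda>n. - int n - 1)" for x :: int
    proof (cases "x \<ge> 0")
      case True then show ?thesis by (metis UnI1 rangeI zero_le_imp_eq_int)
    next
      case False
      then have "x = - int (nat (-x-1)) - 1" by simp
      then show ?thesis by blast
    qed
    then show ?thesis by blast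
  qed
  have D: "range int \<inter> range (\<lambda>n. - int n - 1) = {}" by auto
  have i1: "inj int" and i2: "inj (\<lambda>n. - int n - 1)" by (auto simp: inj_on_def)
  show "f abs_summable_on UNIV"
    unfolding U
    by (intro summable_on_Un_disjoint D)
       (use assms in \<open>auto simp: summable_on_reindex[OF i1] summable_on_reindex[OF i2] o_def\<close>)
  have s1: "((\<lambda>n. f (int n)) has_sum (\<Sum>n. f (int n))) UNIV"
    using assms(1) by (metis abs_summable_summable has_sum_imp_sums has_sum_infsum sums_unique)
  have s2: "((\<lambda>n. f (- int n - 1)) has_sum (\<Sum>n. f (- int n - 1))) UNIV"
    using assms(2) by (metis abs_summable_summable has_sum_imp_sums has_sum_infsum sums_unique)
  show "(f has_sum ((\<Sum>n. f (int n)) + (\<Sum>n. f (- int n - 1)))) UNIV"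
    unfolding U
    by (intro has_sum_Un_disjoint D)
       (use s1 s2 in \<open>auto simp: has_sum_reindex[OF i1] has_sum_reindex[OF i2] o_def\<close>)
qed

text \<open>Locally uniform comparison with the geometric series allows termwise differentiation.\<close>

lemma lacunary_series_has_derivative:
  fixes e :: "nat \<Rightarrow> nat"
  assumes e: "\<And>n. n \<le> e n"
  shows "\<exists>g g'. \<forall>p\<in>ball (0::complex) 1. ((\<lambda>n. p ^ e n) sums g p) \<and>
            ((\<lambda>n. of_nat (e n) * p ^ (e n - 1)) sums g' p) \<and> (g has_field_derivative g' p) (at p)"
proof (rule series_and_derivative_comparison_local)
  fix n x show "((\<lambda>p. p ^ e n) has_field_derivative of_nat (e n) * x ^ (e n - 1)) (at x)"
    by (auto intro!: derivative_eq_intros)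
next
  fix x :: complex assume "x \<in> ball 0 1"
  then have x: "cmod x < 1" by simp
  define r where "r = (1 + cmod x) / 2"
  have r: "cmod x < r" "r < 1" "0 \<le> r" using x by (auto simp: r_def add_nonneg_nonneg)
  have b: "norm (y ^ e n) \<le> r ^ n" if "y \<in> ball x (r - cmod x)" for y n
  proof -
    have "cmod y \<le> r"
      using that norm_triangle_ineq2[of y x] by (auto simp: dist_norm norm_minus_commute)
    then have "cmod y ^ e n \<le> r ^ e n" by (intro power_mono) auto
    also have "\<dots> \<le> r ^ n" using r e by (intro power_decreasing) auto
    finally show ?thesis by (simp add: norm_power)
  qed
  show "\<exists>d h. 0 < d \<and> summable h \<and> (\<forall>\<^sub>F n in sequentially. \<forall>y\<in>ball x d \<inter> ball 0 1. norm (y ^ e n) \<le> h n)"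
    by (rule exI[of _ "r - cmod x"], rule exI[of _ "\<lambda>n. r ^ n"])
       (use r b in \<open>auto intro!: summable_geometric always_eventually\<close>)
qed auto

lemma lacunary_abs_summable:
  fixes e :: "nat \<Rightarrow> nat" and p :: complex
  assumes e: "\<And>n. n \<le> e n" and p: "cmod p < 1"
  shows "(\<lambda>n. p ^ e n) abs_summable_on UNIV"
proof -
  have "summable (\<lambda>n. norm (p ^ e n))"
  proof (rule summable_comparison_test')
    show "summable (\<lambda>n. cmod p ^ n)" using p by (auto intro: summable_geometric)
    show "norm (norm (p ^ e n)) \<le> cmod p ^ n" for n
      using p e by (auto simp: norm_power intro!: power_decreasing)
  qed
  then show ?thesis
    by (simp add: norm_summable_imp_summable_on)
qed

lemma nat_succ_sq: "nat ((- int n - 1)\<^sup>2) = (n + 1)\<^sup>2" "nat ((int n)\<^sup>2) = n\<^sup>2"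
  and nat_pronic: "nat ((int n)\<^sup>2 + int n) = n\<^sup>2 + n" "nat ((- int n - 1)\<^sup>2 + (- int n - 1)) = n\<^sup>2 + n"
proof -
  have "(- int n - 1)\<^sup>2 = int ((n + 1)\<^sup>2)" by (simp add: power2_eq_square algebra_simps)
  then show "nat ((- int n - 1)\<^sup>2) = (n + 1)\<^sup>2" by (simp only: nat_int)
  have "(int n)\<^sup>2 = int (n\<^sup>2)" by simp
  then show "nat ((int n)\<^sup>2) = n\<^sup>2" by (simp only: nat_int)
  have "(int n)\<^sup>2 + int n = int (n\<^sup>2 + n)" by simp
  then show "nat ((int n)\<^sup>2 + int n) = n\<^sup>2 + n" by (simp only: nat_int)
  have "(- int n - 1)\<^sup>2 + (- int n - 1) = int (n\<^sup>2 + n)" by (simp add: power2_eq_square algebra_simps)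
  then show "nat ((- int n - 1)\<^sup>2 + (- int n - 1)) = n\<^sup>2 + n" by (simp only: nat_int)
qed

lemma le_succ_sq: "n \<le> (n + 1)\<^sup>2" "n \<le> n\<^sup>2" "n \<le> n\<^sup>2 + (n::nat)"
  by (auto simp: power2_eq_square)

lemma
  assumes "cmod p < 1"
  shows nome_phi_abs_summable: "(\<lambda>k::int. p ^ nat (k\<^sup>2)) abs_summable_on UNIV"
    and nome_phi_has_sum:
      "((\<lambda>k::int. p ^ nat (k\<^sup>2)) has_sum ((\<Sum>n. p ^ (n\<^sup>2)) + (\<Sum>n. p ^ ((n+1)\<^sup>2)))) UNIV"
proof -
  have 1: "(\<lambda>n. p ^ nat ((int n)\<^sup>2)) abs_summable_on UNIV"
    unfolding nat_succ_sq by (rule lacunary_abs_summable[OF le_succ_sq(2) assms])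
  have 2: "(\<lambda>n. p ^ nat ((- int n - 1)\<^sup>2)) abs_summable_on UNIV"
    unfolding nat_succ_sq by (rule lacunary_abs_summable[OF le_succ_sq(1) assms])
  show "(\<lambda>k::int. p ^ nat (k\<^sup>2)) abs_summable_on UNIV"
    by (rule has_sum_int_split(1)[of "\<lambda>k. p ^ nat (k\<^sup>2)", OF 1 2])
  show "((\<lambda>k::int. p ^ nat (k\<^sup>2)) has_sum ((\<Sum>n. p ^ (n\<^sup>2)) + (\<Sum>n. p ^ ((n+1)\<^sup>2)))) UNIV"
    using has_sum_int_split(2)[of "\<lambda>k. p ^ nat (k\<^sup>2)", OF 1 2] unfolding nat_succ_sq .
qed

lemma
  assumes "cmod p < 1"
  shows nome_psi_abs_summable: "(\<lambda>k::int. p ^ nat (k\<^sup>2 + k)) abs_summable_on UNIV"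
    and nome_psi_has_sum:
      "((\<lambda>k::int. p ^ nat (k\<^sup>2 + k)) has_sum ((\<Sum>n. p ^ (n\<^sup>2 + n)) + (\<Sum>n. p ^ (n\<^sup>2 + n)))) UNIV"
proof -
  have 1: "(\<lambda>n. p ^ nat ((int n)\<^sup>2 + int n)) abs_summable_on UNIV"
    unfolding nat_pronic by (rule lacunary_abs_summable[OF le_succ_sq(3) assms])
  have 2: "(\<lambda>n. p ^ nat ((- int n - 1)\<^sup>2 + (- int n - 1))) abs_summable_on UNIV"
    unfolding nat_pronic by (rule lacunary_abs_summable[OF le_succ_sq(3) assms])
  show "(\<lambda>k::int. p ^ nat (k\<^sup>2 + k)) abs_summable_on UNIV"
    by (rule has_sum_int_split(1)[of "\<lambda>k. p ^ nat (k\<^sup>2 + k)", OF 1 2])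
  show "((\<lambda>k::int. p ^ nat (k\<^sup>2 + k)) has_sum ((\<Sum>n. p ^ (n\<^sup>2 + n)) + (\<Sum>n. p ^ (n\<^sup>2 + n)))) UNIV"
    using has_sum_int_split(2)[of "\<lambda>k. p ^ nat (k\<^sup>2 + k)", OF 1 2] unfolding nat_pronic .
qed

lemma nome_phi_has_sum': "cmod p < 1 \<Longrightarrow> ((\<lambda>k::int. p ^ nat (k\<^sup>2)) has_sum nome_phi p) UNIV"
  and nome_psi_has_sum': "cmod p < 1 \<Longrightarrow> ((\<lambda>k::int. p ^ nat (k\<^sup>2 + k)) has_sum nome_psi p) UNIV"
  unfolding nome_phi_def nome_psi_def
  by (auto intro!: has_sum_infsum abs_summable_summable nome_phi_abs_summable nome_psi_abs_summable)

lemma suminf_sq_shift: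
  fixes p :: complex
  assumes "cmod p < 1"
  shows "(\<Sum>n. p ^ (n\<^sup>2)) = 1 + (\<Sum>n. p ^ ((n+1)\<^sup>2))"
proof -
  have "summable (\<lambda>n. p ^ (n\<^sup>2))"
    by (rule summable_on_imp_summable[OF abs_summable_summable[OF lacunary_abs_summable[OF le_succ_sq(2) assms]]])
  from suminf_split_head[OF this] show ?thesis by (simp add: algebra_simps)
qed

lemma nome_phi_eq:
  assumes "cmod p < 1"
  shows "nome_phi p = 1 + 2 * (\<Sum>n. p ^ ((n+1)\<^sup>2))"
  unfolding has_sum_unique[OF nome_phi_has_sum'[OF assms] nome_phi_has_sum[OF assms]]
    suminf_sq_shift[OF assms] by (simp only: mult_2 add.assoc)

lemma nome_psi_eq:
  assumes "cmod p < 1"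
  shows "nome_psi p = 2 * (\<Sum>n. p ^ (n\<^sup>2 + n))"
  unfolding has_sum_unique[OF nome_psi_has_sum'[OF assms] nome_psi_has_sum[OF assms]]
  by (simp only: mult_2)

lemma nome_phi_has_deriv_0: "(nome_phi has_field_derivative 2) (at 0)"
  and nome_phi_holomorphic: "nome_phi holomorphic_on ball 0 1"
  and nome_phi_deriv_sums: "cmod x < 1 \<Longrightarrow>
    (\<lambda>n. of_nat ((n+1)\<^sup>2) * x ^ ((n+1)\<^sup>2 - 1)) sums (deriv nome_phi x / 2)"
proof -
  obtain g g' where "\<forall>p\<in>ball (0::complex) 1. ((\<lambda>n. p ^ ((n+1)\<^sup>2)) sums g p) \<and>
            ((\<lambda>n. of_nat ((n+1)\<^sup>2) * p ^ ((n+1)\<^sup>2 - 1)) sums g' p) \<and> (g has_field_derivative g' p) (at p)"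
    using lacunary_series_has_derivative[of "\<lambda>n. (n+1)\<^sup>2", OF le_succ_sq(1)] by (elim exE) (rule that)
  note g = bspec[OF this]
  have phi: "nome_phi x = 1 + 2 * g x" if "x \<in> ball 0 1" for x
    using nome_phi_eq[of x] that sums_unique[OF conjunct1[OF g[OF that]]] by (simp only: mem_ball_0)
  have d: "(nome_phi has_field_derivative 2 * g' p) (at p)" if p: "p \<in> ball 0 1" for p
  proof (rule has_field_derivative_transform_within_open[of "\<lambda>p. 1 + 2 * g p" _ _ "ball 0 1"])
    have "(g has_field_derivative g' p) (at p)" using g[OF p] by blast
    then show "((\<lambda>p. 1 + 2 * g p) has_field_derivative 2 * g' p) (at p)"
      by (auto intro!: derivative_eq_intros)
  qed (use p phi in auto)
  have "(\<lambda>n. of_nat ((n+1)\<^sup>2) * (0::complex) ^ ((n+1)\<^sup>2 - 1)) sums (\<Sum>n\<in>{0}. of_nat ((n+1)\<^sup>2) * 0 ^ ((n+1)\<^sup>2 - 1))"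
  proof (rule sums_finite)
    fix n :: nat assume "n \<notin> {0}"
    then have "(n+1)\<^sup>2 - 1 \<noteq> 0" by (simp add: power2_eq_square)
    then show "of_nat ((n+1)\<^sup>2) * (0::complex) ^ ((n+1)\<^sup>2 - 1) = 0" by (simp only: power_0_left if_False mult_zero_right)
  qed auto
  moreover have "(0::complex) \<in> ball 0 1" by simp
  ultimately have "g' 0 = 1" using g[of 0] sums_unique2 by fastforce
  with d[of 0] show "(nome_phi has_field_derivative 2) (at 0)" by simp
  show "nome_phi holomorphic_on ball 0 1"
    unfolding holomorphic_on_open[OF open_ball] using d by blast
  show "(\<lambda>n. of_nat ((n+1)\<^sup>2) * x ^ ((n+1)\<^sup>2 - 1)) sums (deriv nome_phi x / 2)" if "cmod x < 1"
    using g[of x] DERIV_imp_deriv[OF d[of x]] that by simp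
qed

lemma nome_psi_holomorphic: "nome_psi holomorphic_on ball 0 1"
proof -
  obtain g g' where "\<forall>p\<in>ball (0::complex) 1. ((\<lambda>n. p ^ (n\<^sup>2+n)) sums g p) \<and>
            ((\<lambda>n. of_nat (n\<^sup>2+n) * p ^ (n\<^sup>2+n - 1)) sums g' p) \<and> (g has_field_derivative g' p) (at p)"
    using lacunary_series_has_derivative[of "\<lambda>n. n\<^sup>2+n", OF le_succ_sq(3)] by (elim exE) (rule that)
  note g = bspec[OF this]
  have "g holomorphic_on ball 0 1"
    unfolding holomorphic_on_open[OF open_ball] using g by blast
  then have "(\<lambda>p. 2 * g p) holomorphic_on ball 0 1"
    by (intro holomorphic_intros)
  moreover have "2 * g x = nome_psi x" if "x \<in> ball 0 1" for x
    using nome_psi_eq[of x] that sums_unique[OF conjunct1[OF g[OF that]]] by (simp only: mem_ball_0)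
  ultimately show ?thesis by (rule holomorphic_transform)
qed

lemma nome_phi_0 [simp]: "nome_phi 0 = 1"
  using nome_phi_eq[of 0] by (simp add: power_0_left)

lemma nome_psi_0 [simp]: "nome_psi 0 = 2"
proof -
  have "(\<Sum>n. (0::complex) ^ (n\<^sup>2 + n)) = (\<Sum>n\<in>{0}. 0 ^ (n\<^sup>2 + n))"
    by (rule suminf_finite) auto
  then show ?thesis using nome_psi_eq[of 0] by simp
qed

section \<open>Doubling identities\<close>

text \<open>Pairs \<open>(m, n)\<close> with even difference are \<open>(i + j, i - j)\<close>, those with odd difference are
  \<open>(i + j + 1, i - j)\<close>. This rotation of the lattice multiplies the form \<open>m\<^sup>2 + n\<^sup>2\<close> by 2 and is the
  source of all doubling identities.\<close>

lemma infsum_int_pairs: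
  fixes f :: "int \<times> int \<Rightarrow> complex"
  assumes f: "f summable_on UNIV"
  shows "infsum f UNIV = (\<Sum>\<^sub>\<infinity>(i,j). f (i + j, i - j)) + (\<Sum>\<^sub>\<infinity>(i,j). f (i + j + 1, i - j))"
proof -
  define a where "a = (\<lambda>(i::int,j::int). (i + j, i - j))"
  define b where "b = (\<lambda>(i::int,j::int). (i + j + 1, i - j))"
  have ia: "inj a" and ib: "inj b" by (auto simp: inj_on_def a_def b_def)
  have D: "range a \<inter> range b = {}"
  proof -
    have "even (m - n)" if "(m,n) \<in> range a" for m n using that by (auto simp: a_def)
    moreover have "odd (m - n)" if "(m,n) \<in> range b" for m n using that by (auto simp: b_def)
    ultimately show ?thesis by fast
  qed
  have U: "UNIV = range a \<union> range b"
  proof -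
    have "(m,n) \<in> range a \<union> range b" for m n
    proof (cases "even (m - n)")
      case True
      then obtain j where "m - n = 2 * j" by (elim evenE)
      then have "(m,n) = a (n + j, j)" by (auto simp: a_def)
      then show ?thesis by blast
    next
      case False
      then obtain j where "m - n = 2 * j + 1" by (elim oddE)
      then have "(m,n) = b (n + j, j)" by (auto simp: b_def)
      then show ?thesis by blast
    qed
    then show ?thesis by (metis UNIV_eq_I surj_pair)
  qed
  have "infsum f (range a \<union> range b) = infsum f (range a) + infsum f (range b)"
    by (intro infsum_Un_disjoint D summable_on_subset_banach[OF f]) auto
  also have "\<dots> = infsum (f \<circ> a) UNIV + infsum (f \<circ> b) UNIV"
    by (simp add: infsum_reindex ia ib)
  finally show ?thesis unfolding U[symmetric]
    by (simp add: a_def b_def o_def case_prod_unfold)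
qed

lemma infsum_product:
  fixes f :: "'a \<Rightarrow> complex" and g :: "'b \<Rightarrow> complex"
  assumes "f abs_summable_on UNIV" "g abs_summable_on UNIV"
  shows "(\<lambda>(x,y). f x * g y) summable_on UNIV"
    and "(\<Sum>\<^sub>\<infinity>(x,y). f x * g y) = infsum f UNIV * infsum g UNIV"
proof -
  have "(\<lambda>(x,y). f x * g y) abs_summable_on (UNIV \<times> UNIV)"
    unfolding Infinite_Sum.abs_summable_on_Sigma_iff
  proof (intro conjI ballI)
    fix x show "(\<lambda>y. case (x, y) of (x, y) \<Rightarrow> f x * g y) abs_summable_on UNIV"
      using assms(2) by (auto simp: norm_mult intro!: summable_on_cmult_right)
  next
    have "(\<lambda>x. norm (f x) * (\<Sum>\<^sub>\<infinity>y. norm (g y))) summable_on UNIV"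
      using assms(1) by (auto intro!: summable_on_cmult_left)
    moreover have "0 \<le> (\<Sum>\<^sub>\<infinity>y. norm (g y))" by (intro infsum_nonneg) auto
    ultimately show "(\<lambda>x. \<Sum>\<^sub>\<infinity>y. norm (case (x, y) of (x, y) \<Rightarrow> f x * g y)) abs_summable_on UNIV"
      by (simp add: norm_mult infsum_cmult_right' abs_mult)
  qed
  then show s: "(\<lambda>(x,y). f x * g y) summable_on UNIV"
    using abs_summable_summable by auto
  have "(\<Sum>\<^sub>\<infinity>(x,y)\<in>UNIV \<times> UNIV. f x * g y) = (\<Sum>\<^sub>\<infinity>x. \<Sum>\<^sub>\<infinity>y. f x * g y)"
    using s by (subst infsum_Sigma'_banach) auto
  also have "\<dots> = infsum f UNIV * infsum g UNIV"
    by (simp add: infsum_cmult_right' infsum_cmult_left')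
  finally show "(\<Sum>\<^sub>\<infinity>(x,y). f x * g y) = infsum f UNIV * infsum g UNIV" by simp
qed

lemma power_nat_add: "0 \<le> a \<Longrightarrow> 0 \<le> b \<Longrightarrow> p ^ nat a * p ^ nat b = (p::complex) ^ nat (a + b)"
  by (simp add: nat_add_distrib power_add)

text \<open>Bookkeeping of the exponents after the rotation.\<close>

lemma power_nat_double:
  fixes p :: complex
  assumes "0 \<le> a" "0 \<le> b" "0 \<le> c" "0 \<le> d"
  shows "a + b = 2 * (c + d) \<Longrightarrow> p ^ nat a * p ^ nat b = (p\<^sup>2) ^ nat c * (p\<^sup>2) ^ nat d"
    and "a + b = 1 + 2 * (c + d) \<Longrightarrow> p ^ nat a * p ^ nat b = p * ((p\<^sup>2) ^ nat c * (p\<^sup>2) ^ nat d)"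
proof -
  have *: "(p\<^sup>2) ^ nat c * (p\<^sup>2) ^ nat d = p ^ nat (2 * (c + d))"
    unfolding power_nat_add[OF assms(3,4)] using assms
    by (subst nat_mult_distrib) (simp_all add: power_mult)
  show "p ^ nat a * p ^ nat b = (p\<^sup>2) ^ nat c * (p\<^sup>2) ^ nat d" if "a + b = 2 * (c + d)"
    unfolding * power_nat_add[OF assms(1,2)] that ..
  show "p ^ nat a * p ^ nat b = p * ((p\<^sup>2) ^ nat c * (p\<^sup>2) ^ nat d)" if "a + b = 1 + 2 * (c + d)"
    unfolding * power_nat_add[OF assms(1,2)] that using assms by (simp add: nat_add_distrib)
qed

lemma nome_phi_square:
  assumes p: "cmod p < 1"
  shows "(nome_phi p)\<^sup>2 = (nome_phi (p\<^sup>2))\<^sup>2 + p * (nome_psi (p\<^sup>2))\<^sup>2"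
proof -
  have p2: "cmod (p\<^sup>2) < 1" using p by (simp add: norm_power power_less_one_iff)
  note ab = nome_phi_abs_summable[OF p] nome_phi_abs_summable[OF p2] nome_psi_abs_summable[OF p2]
  have "(nome_phi p)\<^sup>2 = (\<Sum>\<^sub>\<infinity>(m,n). p ^ nat (m\<^sup>2) * p ^ nat (n\<^sup>2))"
    unfolding infsum_product(2)[OF ab(1) ab(1)] by (simp only: nome_phi_def power2_eq_square[of "infsum _ _"])
  also have "\<dots> = (\<Sum>\<^sub>\<infinity>(i,j). p ^ nat ((i+j)\<^sup>2) * p ^ nat ((i-j)\<^sup>2))
      + (\<Sum>\<^sub>\<infinity>(i,j). p ^ nat ((i+j+1)\<^sup>2) * p ^ nat ((i-j)\<^sup>2))"
    using infsum_int_pairs[OF infsum_product(1)[OF ab(1) ab(1)]] by simp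
  also have "(\<lambda>(i::int,j). p ^ nat ((i+j)\<^sup>2) * p ^ nat ((i-j)\<^sup>2))
      = (\<lambda>(i,j). (p\<^sup>2) ^ nat (i\<^sup>2) * (p\<^sup>2) ^ nat (j\<^sup>2))"
    by (auto simp: fun_eq_iff intro!: power_nat_double(1)) (simp add: power2_eq_square algebra_simps)
  also have "(\<lambda>(i::int,j). p ^ nat ((i+j+1)\<^sup>2) * p ^ nat ((i-j)\<^sup>2))
      = (\<lambda>(i,j). p * ((p\<^sup>2) ^ nat (i\<^sup>2 + i) * (p\<^sup>2) ^ nat (j\<^sup>2 + j)))"
  proof -
    have "p ^ nat ((i+j+1)\<^sup>2) * p ^ nat ((i-j)\<^sup>2) = p * ((p\<^sup>2) ^ nat (i\<^sup>2 + i) * (p\<^sup>2) ^ nat (j\<^sup>2 + j))" for i j :: int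
      by (rule power_nat_double(2)) (auto simp: int_sq_add_self_nonneg, simp add: power2_eq_square algebra_simps)
    then show ?thesis by auto
  qed
  also have "(\<Sum>\<^sub>\<infinity>(i,j). (p\<^sup>2) ^ nat (i\<^sup>2) * (p\<^sup>2) ^ nat (j\<^sup>2)) = (nome_phi (p\<^sup>2))\<^sup>2"
    unfolding infsum_product(2)[OF ab(2) ab(2)] by (simp only: nome_phi_def power2_eq_square[of "infsum _ _"])
  also have "(\<Sum>\<^sub>\<infinity>(i,j). p * ((p\<^sup>2) ^ nat (i\<^sup>2+i) * (p\<^sup>2) ^ nat (j\<^sup>2+j))) = p * (nome_psi (p\<^sup>2))\<^sup>2"
    using infsum_product(2)[OF ab(3) ab(3)]
    by (simp add: nome_psi_def power2_eq_square[of "infsum _ _"] case_prod_unfold infsum_cmult_right')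
  finally show ?thesis .
qed

lemma nome_psi_square:
  assumes p: "cmod p < 1"
  shows "(nome_psi p)\<^sup>2 = 2 * nome_psi (p\<^sup>2) * nome_phi (p\<^sup>2)"
proof -
  have p2: "cmod (p\<^sup>2) < 1" using p by (simp add: norm_power power_less_one_iff)
  note ab = nome_psi_abs_summable[OF p] nome_psi_abs_summable[OF p2] nome_phi_abs_summable[OF p2]
  have "(nome_psi p)\<^sup>2 = (\<Sum>\<^sub>\<infinity>(m,n). p ^ nat (m\<^sup>2+m) * p ^ nat (n\<^sup>2+n))"
    unfolding infsum_product(2)[OF ab(1) ab(1)] by (simp only: nome_psi_def power2_eq_square[of "infsum _ _"])
  also have "\<dots> = (\<Sum>\<^sub>\<infinity>(i,j). p ^ nat ((i+j)\<^sup>2+(i+j)) * p ^ nat ((i-j)\<^sup>2+(i-j)))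
      + (\<Sum>\<^sub>\<infinity>(i,j). p ^ nat ((i+j+1)\<^sup>2+(i+j+1)) * p ^ nat ((i-j)\<^sup>2+(i-j)))"
    using infsum_int_pairs[OF infsum_product(1)[OF ab(1) ab(1)]] by simp
  also have "(\<lambda>(i::int,j). p ^ nat ((i+j)\<^sup>2+(i+j)) * p ^ nat ((i-j)\<^sup>2+(i-j)))
      = (\<lambda>(i,j). (p\<^sup>2) ^ nat (i\<^sup>2+i) * (p\<^sup>2) ^ nat (j\<^sup>2))"
    by (auto simp: fun_eq_iff int_sq_add_self_nonneg intro!: power_nat_double(1))
       (simp add: power2_eq_square algebra_simps)
  also have "(\<lambda>(i::int,j). p ^ nat ((i+j+1)\<^sup>2+(i+j+1)) * p ^ nat ((i-j)\<^sup>2+(i-j)))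
      = (\<lambda>(i,j). (p\<^sup>2) ^ nat ((i+1)\<^sup>2) * (p\<^sup>2) ^ nat (j\<^sup>2+j))"
    by (auto simp: fun_eq_iff int_sq_add_self_nonneg intro!: power_nat_double(1))
       (simp add: power2_eq_square algebra_simps)
  also have "(\<Sum>\<^sub>\<infinity>(i,j). (p\<^sup>2) ^ nat (i\<^sup>2+i) * (p\<^sup>2) ^ nat (j\<^sup>2)) = nome_psi (p\<^sup>2) * nome_phi (p\<^sup>2)"
    by (simp add: infsum_product(2)[OF ab(2) ab(3)] nome_phi_def nome_psi_def)
  also have "(\<Sum>\<^sub>\<infinity>(i,j). (p\<^sup>2) ^ nat ((i+1)\<^sup>2) * (p\<^sup>2) ^ nat (j\<^sup>2+j)) = nome_phi (p\<^sup>2) * nome_psi (p\<^sup>2)"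
  proof -
    have b: "bij (\<lambda>i::int. i + 1)" by (rule bij_plus_right)
    have "(\<lambda>i::int. (p\<^sup>2) ^ nat ((i+1)\<^sup>2)) abs_summable_on UNIV"
      using summable_on_reindex_bij_betw[OF b, of "\<lambda>i. norm ((p\<^sup>2) ^ nat (i\<^sup>2))"] ab(3) by simp
    moreover have "(\<Sum>\<^sub>\<infinity>i. (p\<^sup>2) ^ nat ((i+1)\<^sup>2)) = nome_phi (p\<^sup>2)"
      using infsum_reindex_bij_betw[OF b, of "\<lambda>i. (p\<^sup>2) ^ nat (i\<^sup>2)"] by (simp add: nome_phi_def)
    ultimately show ?thesis using infsum_product(2)[of "\<lambda>i::int. (p\<^sup>2) ^ nat ((i+1)\<^sup>2)", OF _ ab(2)]
      by (simp add: nome_psi_def)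
  qed
  finally show ?thesis by simp
qed

lemma minus_power_nat_sq: "(- x) ^ nat (k\<^sup>2) = (-1) powi k * (x::complex) ^ nat (k\<^sup>2)"
  by (subst power_minus) (auto simp: power_int_minus_left minus_one_power_iff even_nat_iff)

text \<open>The pairs of odd difference contribute a multiple of the square of
  \<open>\<Sum> (- 1) ^ i * p ^ (2 * (i\<^sup>2 + i))\<close>, which is \<open>0\<close> because the involution \<open>i \<mapsto> - 1 - i\<close> changes the sign of
  its terms.\<close>

lemma nome_phi_mult_minus:
  assumes p: "cmod p < 1"
  shows "nome_phi p * nome_phi (-p) = (nome_phi (- (p\<^sup>2)))\<^sup>2"
proof -
  have p2: "cmod (- (p\<^sup>2)) < 1" "cmod (p\<^sup>2) < 1" "cmod (-p) < 1" using p by (auto simp: norm_power power_less_one_iff)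
  note ab = nome_phi_abs_summable[OF p] nome_phi_abs_summable[OF p2(3)] nome_phi_abs_summable[OF p2(1)] nome_psi_abs_summable[OF p2(2)]
  define h where "h = (\<lambda>i::int. (-1) powi i * (p\<^sup>2) ^ nat (i\<^sup>2 + i))"
  have h: "h abs_summable_on UNIV" using ab(4) by (simp add: h_def norm_mult norm_power_int)
  have h0: "infsum h UNIV = 0"
  proof -
    have b: "bij (\<lambda>i::int. - 1 - i)"
      by (rule bij_betw_byWitness[where f' = "\<lambda>i. - 1 - i"]) auto
    have "infsum h UNIV = (\<Sum>\<^sub>\<infinity>i. h (- 1 - i))"
      by (rule infsum_reindex_bij_betw[OF b, symmetric])
    also have "(\<lambda>i. h (- 1 - i)) = (\<lambda>i. - h i)"
    proof
      fix i :: int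
      have "(-1-i)\<^sup>2 + (-1-i) = i\<^sup>2 + i" by (simp add: power2_eq_square algebra_simps)
      then show "h (- 1 - i) = - h i" unfolding h_def by (simp only:) (auto simp: power_int_minus_left)
    qed
    also have "(\<Sum>\<^sub>\<infinity>i. - h i) = - infsum h UNIV" by (rule infsum_uminus)
    finally show ?thesis by simp
  qed
  have "nome_phi p * nome_phi (-p) = (\<Sum>\<^sub>\<infinity>(m,n). p ^ nat (m\<^sup>2) * (-p) ^ nat (n\<^sup>2))"
    by (simp only: infsum_product(2)[OF ab(1) ab(2)] nome_phi_def)
  also have "\<dots> = (\<Sum>\<^sub>\<infinity>(i,j). p ^ nat ((i+j)\<^sup>2) * (-p) ^ nat ((i-j)\<^sup>2))
      + (\<Sum>\<^sub>\<infinity>(i,j). p ^ nat ((i+j+1)\<^sup>2) * (-p) ^ nat ((i-j)\<^sup>2))"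
    using infsum_int_pairs[OF infsum_product(1)[OF ab(1) ab(2)]] by simp
  also have "(\<lambda>(i::int,j). p ^ nat ((i+j)\<^sup>2) * (-p) ^ nat ((i-j)\<^sup>2))
      = (\<lambda>(i,j). (-(p\<^sup>2)) ^ nat (i\<^sup>2) * (-(p\<^sup>2)) ^ nat (j\<^sup>2))"
  proof -
    have "p ^ nat ((i+j)\<^sup>2) * (-p) ^ nat ((i-j)\<^sup>2) = (-(p\<^sup>2)) ^ nat (i\<^sup>2) * (-(p\<^sup>2)) ^ nat (j\<^sup>2)" for i j :: int
    proof -
      have "p ^ nat ((i+j)\<^sup>2) * p ^ nat ((i-j)\<^sup>2) = (p\<^sup>2) ^ nat (i\<^sup>2) * (p\<^sup>2) ^ nat (j\<^sup>2)"
        by (rule power_nat_double(1)) (simp_all, simp add: power2_eq_square algebra_simps)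
      then show ?thesis by (auto simp: minus_power_nat_sq power_int_minus_left)
    qed
    then show ?thesis by auto
  qed
  also have "(\<lambda>(i::int,j). p ^ nat ((i+j+1)\<^sup>2) * (-p) ^ nat ((i-j)\<^sup>2)) = (\<lambda>(i,j). p * (h i * h j))"
  proof -
    have "p ^ nat ((i+j+1)\<^sup>2) * (-p) ^ nat ((i-j)\<^sup>2) = p * (h i * h j)" for i j :: int
    proof -
      have "p ^ nat ((i+j+1)\<^sup>2) * p ^ nat ((i-j)\<^sup>2) = p * ((p\<^sup>2) ^ nat (i\<^sup>2 + i) * (p\<^sup>2) ^ nat (j\<^sup>2 + j))"
        by (rule power_nat_double(2)) (auto simp: int_sq_add_self_nonneg, simp add: power2_eq_square algebra_simps)
      then show ?thesis by (auto simp: minus_power_nat_sq h_def power_int_minus_left)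
    qed
    then show ?thesis by auto
  qed
  also have "(\<Sum>\<^sub>\<infinity>(i,j). (-(p\<^sup>2)) ^ nat (i\<^sup>2) * (-(p\<^sup>2)) ^ nat (j\<^sup>2)) = (nome_phi (-(p\<^sup>2)))\<^sup>2"
    unfolding infsum_product(2)[OF ab(3) ab(3)] by (simp only: nome_phi_def power2_eq_square[of "infsum _ _"])
  also have "(\<Sum>\<^sub>\<infinity>(i,j). p * (h i * h j)) = 0"
    using infsum_product(2)[OF h h] h0 by (simp add: case_prod_unfold infsum_cmult_right')
  finally show ?thesis by simp
qed

section \<open>Zeros and logarithmic derivatives\<close>

lemma cmod_square_less_1: "cmod p < 1 \<Longrightarrow> cmod (p\<^sup>2) < 1"
  by (simp add: norm_power power_less_one_iff)

lemma nome_square_sum: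
  assumes "cmod p < 1"
  shows "(nome_phi p)\<^sup>2 + (nome_phi (-p))\<^sup>2 = 2 * (nome_phi (p\<^sup>2))\<^sup>2"
    and "(nome_phi p)\<^sup>2 - (nome_phi (-p))\<^sup>2 = 2 * p * (nome_psi (p\<^sup>2))\<^sup>2"
  using nome_phi_square[of p] nome_phi_square[of "-p"] assms by auto

text \<open>Factor the difference of fourth powers; the doubling identities turn the factors into
  \<open>2 p \<psi>(p\<^sup>2)\<^sup>2\<close> and \<open>2 \<phi>(p\<^sup>2)\<^sup>2\<close>, whose product is \<open>p (\<psi>(p)\<^sup>2)\<^sup>2\<close>.\<close>

lemma nome_quartic:
  assumes "cmod p < 1"
  shows "nome_phi p ^ 4 = nome_phi (-p) ^ 4 + p * nome_psi p ^ 4"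
proof -
  have "nome_phi p ^ 4 - nome_phi (-p) ^ 4
      = ((nome_phi p)\<^sup>2 - (nome_phi (-p))\<^sup>2) * ((nome_phi p)\<^sup>2 + (nome_phi (-p))\<^sup>2)"
    by algebra
  also have "\<dots> = p * ((nome_psi p)\<^sup>2)\<^sup>2"
    unfolding nome_square_sum[OF assms] nome_psi_square[OF assms] by algebra
  finally show ?thesis by algebra
qed

lemma iterated_square_tendsto_0:
  fixes p :: complex
  assumes "cmod p < 1"
  shows "(\<lambda>n. p ^ (2 ^ n)) \<longlonglongrightarrow> 0"
proof -
  have "filterlim (\<lambda>n::nat. 2 ^ n :: nat) sequentially sequentially"
    by (rule filterlim_subseq) (auto simp: strict_mono_def)
  from filterlim_compose[OF LIMSEQ_power_zero[OF assms] this] show ?thesis .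
qed

text \<open>The values along \<open>p, p\<^sup>2, p ^ 4, \<dots>\<close> coincide and converge to the value at \<open>0\<close>.\<close>

lemma invariant_under_squaring:
  fixes f :: "complex \<Rightarrow> complex"
  assumes f: "isCont f 0" and inv: "\<And>p. cmod p < 1 \<Longrightarrow> f p = f (p\<^sup>2)" and p: "cmod p < 1"
  shows "f p = f 0"
proof -
  have it: "cmod (p ^ (2 ^ n)) < 1" for n using p by (auto simp: norm_power power_less_one_iff)
  have "f (p ^ (2 ^ n)) = f p" for n
  proof (induction n)
    case (Suc n)
    then show ?case using inv[OF it[of n]] by (simp add: power_mult[symmetric] mult.commute)
  qed auto
  moreover have "(\<lambda>n. f (p ^ (2 ^ n))) \<longlonglongrightarrow> f 0"
    by (rule isCont_tendsto_compose[OF f iterated_square_tendsto_0[OF p]])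
  ultimately show ?thesis by (simp add: LIMSEQ_const_iff)
qed

text \<open>By iteration \<open>f p = 4 ^ n * f (p ^ 2 ^ n)\<close>. A differentiable \<open>f\<close> with \<open>f 0 = 0\<close> is \<open>O(p)\<close>, and
  with \<open>m = 2 ^ n\<close> the bound \<open>m\<^sup>2 * p ^ m\<close> tends to \<open>0\<close>.\<close>

lemma quarter_under_squaring:
  fixes f :: "complex \<Rightarrow> complex"
  assumes f: "(f has_field_derivative D) (at 0)" and 0: "f 0 = 0"
    and dbl: "\<And>p. cmod p < 1 \<Longrightarrow> f p = 4 * f (p\<^sup>2)" and p: "cmod p < 1"
  shows "f p = 0"
proof (cases "p = 0")
  case False
  have it: "cmod (p ^ (2 ^ n)) < 1" for n using p by (auto simp: norm_power power_less_one_iff)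
  have eq: "f p = 4 ^ n * f (p ^ (2 ^ n))" for n
  proof (induction n)
    case (Suc n)
    then show ?case using dbl[OF it[of n]] by (simp add: power_mult[symmetric] mult.commute)
  qed auto
  have sub: "filterlim (\<lambda>n::nat. 2 ^ n :: nat) sequentially sequentially"
    by (rule filterlim_subseq) (auto simp: strict_mono_def)
  have "(\<lambda>h. f h / h) \<midarrow>0\<rightarrow> D" using f 0 by (simp add: DERIV_def)
  moreover have "filterlim (\<lambda>n. p ^ (2 ^ n)) (at 0) sequentially"
    unfolding filterlim_at using iterated_square_tendsto_0[OF p] False by auto
  ultimately have 1: "(\<lambda>n. f (p ^ (2 ^ n)) / p ^ (2 ^ n)) \<longlonglongrightarrow> D"
    by (rule filterlim_compose)
  have "(\<lambda>m. of_nat m ^ 2 * p ^ m) \<longlonglongrightarrow> 0"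
  proof -
    have "norm (csqrt p) < 1" using p by (simp add: norm_csqrt)
    from tendsto_power[OF powser_times_n_limit_0[OF this], of 2] show ?thesis
      by (simp add: power_mult_distrib power_mult[symmetric] mult.commute[of _ 2]) (simp add: power_mult)
  qed
  from filterlim_compose[OF this sub] have 2: "(\<lambda>n. 4 ^ n * p ^ (2 ^ n)) \<longlonglongrightarrow> 0"
    by (simp add: power_mult[symmetric] mult.commute[of _ 2]) (simp add: power_mult)
  have "(\<lambda>n. (4 ^ n * p ^ (2 ^ n)) * (f (p ^ (2 ^ n)) / p ^ (2 ^ n))) \<longlonglongrightarrow> 0 * D"
    by (rule tendsto_mult[OF 2 1])
  moreover have "(4 ^ n * p ^ (2 ^ n)) * (f (p ^ (2 ^ n)) / p ^ (2 ^ n)) = f p" for n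
    using False by (subst eq[of n]) simp
  ultimately show ?thesis by (simp add: LIMSEQ_const_iff)
qed (use 0 in simp)

lemma nome_phi_isCont: "cmod p < 1 \<Longrightarrow> isCont nome_phi p"
  using nome_phi_holomorphic
  by (metis at_within_open continuous_on_eq_continuous_at holomorphic_on_imp_continuous_on mem_ball_0 open_ball)

lemma nome_psi_isCont: "cmod p < 1 \<Longrightarrow> isCont nome_psi p"
  using nome_psi_holomorphic
  by (metis at_within_open continuous_on_eq_continuous_at holomorphic_on_imp_continuous_on mem_ball_0 open_ball)

text \<open>By \<open>nome_phi_mult_minus\<close> a zero \<open>p\<close> of \<open>\<phi>\<close> produces the zeros \<open>- p ^ 2 ^ n\<close> for \<open>n \<ge> 1\<close>, which
  accumulate at \<open>0\<close>, where \<open>\<phi>\<close> is \<open>1\<close>.\<close>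

lemma nome_phi_nonzero:
  assumes p: "cmod p < 1"
  shows "nome_phi p \<noteq> 0"
proof
  assume "nome_phi p = 0"
  then have *: "nome_phi (- (p\<^sup>2)) = 0" using nome_phi_mult_minus[OF p] by simp
  have it: "cmod (p ^ (2 ^ n)) < 1" for n using p by (auto simp: norm_power power_less_one_iff)
  have z: "nome_phi (- (p ^ (2 ^ Suc n))) = 0" for n
  proof (induction n)
    case (Suc n)
    then have "nome_phi (p ^ (2 ^ Suc n)) * nome_phi (- (p ^ (2 ^ Suc n))) = 0" by simp
    then have "nome_phi (- ((p ^ (2 ^ Suc n))\<^sup>2)) = 0"
      using nome_phi_mult_minus[OF it[of "Suc n"]] by (metis power_eq_0_iff)
    then show ?case by (simp add: power_mult[symmetric] mult.commute)
  qed (use * in simp)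
  have "(\<lambda>n. nome_phi (- (p ^ (2 ^ Suc n)))) \<longlonglongrightarrow> nome_phi (- 0)"
    by (intro isCont_tendsto_compose[OF nome_phi_isCont] tendsto_minus LIMSEQ_Suc[OF iterated_square_tendsto_0[OF p]]) simp
  then show False unfolding z by (simp add: LIMSEQ_const_iff)
qed

lemma nome_psi_nonzero:
  assumes p: "cmod p < 1"
  shows "nome_psi p \<noteq> 0"
proof
  assume "nome_psi p = 0"
  have it: "cmod (p ^ (2 ^ n)) < 1" for n using p by (auto simp: norm_power power_less_one_iff)
  have z: "nome_psi (p ^ (2 ^ n)) = 0" for n
  proof (induction n)
    case (Suc n)
    then have "nome_psi ((p ^ (2 ^ n))\<^sup>2) = 0"
      using nome_psi_square[OF it[of n]] nome_phi_nonzero[OF cmod_square_less_1[OF it[of n]]] by simp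
    then show ?case by (simp add: power_mult[symmetric] mult.commute)
  qed (use \<open>nome_psi p = 0\<close> in simp)
  have "(\<lambda>n. nome_psi (p ^ (2 ^ n))) \<longlonglongrightarrow> nome_psi 0"
    by (intro isCont_tendsto_compose[OF nome_psi_isCont] iterated_square_tendsto_0[OF p]) simp
  then show False unfolding z by (simp add: LIMSEQ_const_iff)
qed

lemma nome_has_deriv:
  assumes "cmod p < 1"
  shows "(nome_phi has_field_derivative deriv nome_phi p) (at p)"
    and "(nome_psi has_field_derivative deriv nome_psi p) (at p)"
  using assms nome_phi_holomorphic nome_psi_holomorphic
  by (auto intro!: holomorphic_derivI[of _ "ball 0 1"])

lemma nome_chain:
  assumes "(g has_field_derivative g') (at x)" "cmod (g x) < 1"
  shows "deriv nome_phi (g x) * g' = D \<Longrightarrow> ((\<lambda>x. nome_phi (g x)) has_field_derivative D) (at x)"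
    and "deriv nome_psi (g x) * g' = D \<Longrightarrow> ((\<lambda>x. nome_psi (g x)) has_field_derivative D) (at x)"
  using DERIV_chain2[OF nome_has_deriv(1)[OF assms(2)] assms(1)]
    DERIV_chain2[OF nome_has_deriv(2)[OF assms(2)] assms(1)] by auto

lemma DERIV_unique_unit_disc:
  assumes "(f has_field_derivative D) (at p)" "(g has_field_derivative E) (at (p::complex))"
    and "cmod p < 1" "\<And>x. cmod x < 1 \<Longrightarrow> f x = g x"
  shows "D = E"
proof -
  have "(g has_field_derivative D) (at p)"
    by (rule has_field_derivative_transform_within_open[OF assms(1), of "ball 0 1"]) (use assms in auto)
  then show ?thesis using assms(2) DERIV_unique by blast
qed

text \<open>The operator \<open>p d/dp\<close> is \<open>1 / (\<pi> \<i>)\<close> times \<open>d/dT\<close>. With it, \<open>dlog3 p\<close>, \<open>dlog3 (- p)\<close> and \<open>dlog2 p\<close>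
  are the logarithmic derivatives of the third, the fourth and the second theta constant. The summand
  \<open>1 / 4\<close> in \<open>dlog2\<close> comes from the factor \<open>p\<close> to the power \<open>1/4\<close> in front of \<open>\<psi>\<close>.\<close>

definition dlog3 :: "complex \<Rightarrow> complex" where "dlog3 p = p * deriv nome_phi p / nome_phi p"
definition dlog2 :: "complex \<Rightarrow> complex" where "dlog2 p = 1 / 4 + p * deriv nome_psi p / nome_psi p"

lemma nome_phi_mult_minus_deriv:
  assumes p: "cmod p < 1"
  shows "deriv nome_phi p * nome_phi (-p) - nome_phi p * deriv nome_phi (-p)
     = - 4 * p * nome_phi (- (p\<^sup>2)) * deriv nome_phi (- (p\<^sup>2))"
proof -
  have p2: "cmod (- (p\<^sup>2)) < 1" "cmod (p\<^sup>2) < 1" "cmod (-p) < 1" using p by (auto simp: cmod_square_less_1)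
  have "((\<lambda>p. nome_phi p * nome_phi (-p)) has_field_derivative
      (deriv nome_phi p * nome_phi (-p) - nome_phi p * deriv nome_phi (-p))) (at p)"
    by (rule derivative_eq_intros nome_chain p p2 refl)+ (simp add: algebra_simps)
  moreover have "((\<lambda>p. (nome_phi (- (p\<^sup>2)))\<^sup>2) has_field_derivative
      (- 4 * p * nome_phi (- (p\<^sup>2)) * deriv nome_phi (- (p\<^sup>2)))) (at p)"
    by (rule derivative_eq_intros nome_chain p p2 refl)+ (simp add: algebra_simps)
  ultimately show ?thesis
    by (rule DERIV_unique_unit_disc) (use p nome_phi_mult_minus in auto)
qed

lemma dlog3_plus_dlog4:
  assumes p: "cmod p < 1"
  shows "dlog3 p + dlog3 (-p) = 4 * dlog3 (- (p\<^sup>2))"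
proof -
  have p2: "cmod (- (p\<^sup>2)) < 1" "cmod (-p) < 1" using p by (auto simp: cmod_square_less_1)
  note nz = nome_phi_nonzero[OF p] nome_phi_nonzero[OF p2(1)] nome_phi_nonzero[OF p2(2)]
  have "dlog3 p + dlog3 (-p) = p * (deriv nome_phi p * nome_phi (-p) - nome_phi p * deriv nome_phi (-p)) / (nome_phi p * nome_phi (-p))"
    using nz by (simp add: dlog3_def field_simps)
  also have "\<dots> = p * (- 4 * p * nome_phi (- (p\<^sup>2)) * deriv nome_phi (- (p\<^sup>2))) / (nome_phi (- (p\<^sup>2)))\<^sup>2"
    unfolding nome_phi_mult_minus_deriv[OF p] nome_phi_mult_minus[OF p] ..
  also have "\<dots> = 4 * dlog3 (- (p\<^sup>2))"
    using nz by (simp add: dlog3_def field_simps power2_eq_square)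
  finally show ?thesis .
qed

lemma dlog2_double:
  assumes p: "cmod p < 1"
  shows "dlog2 p = dlog2 (p\<^sup>2) + dlog3 (p\<^sup>2)"
proof -
  have p2: "cmod (p\<^sup>2) < 1" using p by (auto simp: cmod_square_less_1)
  note nz = nome_psi_nonzero[OF p] nome_phi_nonzero[OF p2] nome_psi_nonzero[OF p2]
  have "((\<lambda>p. (nome_psi p)\<^sup>2) has_field_derivative (2 * nome_psi p * deriv nome_psi p)) (at p)"
    by (rule derivative_eq_intros nome_chain p p2 refl)+ (simp add: algebra_simps)
  moreover have "((\<lambda>p. 2 * nome_psi (p\<^sup>2) * nome_phi (p\<^sup>2)) has_field_derivative
      (4 * p * (deriv nome_psi (p\<^sup>2) * nome_phi (p\<^sup>2) + nome_psi (p\<^sup>2) * deriv nome_phi (p\<^sup>2)))) (at p)"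
    by (rule derivative_eq_intros nome_chain p p2 refl)+ (simp add: algebra_simps)
  ultimately have "2 * nome_psi p * deriv nome_psi p =
     4 * p * (deriv nome_psi (p\<^sup>2) * nome_phi (p\<^sup>2) + nome_psi (p\<^sup>2) * deriv nome_phi (p\<^sup>2))"
    by (rule DERIV_unique_unit_disc) (use p nome_psi_square in auto)
  then have "p * (2 * nome_psi p * deriv nome_psi p) / (2 * (nome_psi p)\<^sup>2) =
     p * (4 * p * (deriv nome_psi (p\<^sup>2) * nome_phi (p\<^sup>2) + nome_psi (p\<^sup>2) * deriv nome_phi (p\<^sup>2))) / (2 * (2 * nome_psi (p\<^sup>2) * nome_phi (p\<^sup>2)))"
    unfolding nome_psi_square[OF p] by simp
  then show ?thesis using nz by (simp add: dlog3_def dlog2_def field_simps power2_eq_square)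
qed

text \<open>Both sides, divided by \<open>p\<close>, transform in the same way under \<open>p \<mapsto> p\<^sup>2\<close>: differentiating the two
  doubling identities for \<open>\<phi>\<close> shows that their quotient is invariant under squaring, hence constant.\<close>

lemma dlog3_minus_dlog4:
  assumes p: "cmod p < 1"
  shows "dlog3 p - dlog3 (-p) = p * nome_psi p ^ 4 / 4"
proof -
  \<comment> \<open>The quotient of the two sides up to a constant, with the factor \<open>p\<close> cancelled so that
    it has a value at \<open>0\<close>.\<close>
  define f where "f = (\<lambda>p. (deriv nome_phi p / nome_phi p + deriv nome_phi (-p) / nome_phi (-p)) / nome_psi p ^ 4)"
  have hol: "deriv nome_phi holomorphic_on ball 0 1" by (intro holomorphic_deriv nome_phi_holomorphic) auto
  then have c: "isCont (deriv nome_phi) 0"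
    by (metis at_within_open continuous_on_eq_continuous_at holomorphic_on_imp_continuous_on centre_in_ball zero_less_one open_ball)
  have c': "isCont (\<lambda>x. deriv nome_phi (-x)) 0" "isCont (\<lambda>x. nome_phi (-x)) 0"
    by (rule isCont_o2[of _ uminus], simp, use c nome_phi_isCont[of 0] in simp)+
  have "isCont f 0"
    unfolding f_def using nome_phi_isCont[of 0] nome_psi_isCont[of 0] c c' by (auto intro!: continuous_intros)
  moreover have "f q = f (q\<^sup>2)" if q: "cmod q < 1" for q
  proof (cases "q = 0")
    case False
    have q2: "cmod (- (q\<^sup>2)) < 1" "cmod (q\<^sup>2) < 1" "cmod (-q) < 1" using q by (auto simp: cmod_square_less_1)
    note nz = nome_phi_nonzero[OF q] nome_phi_nonzero[OF q2(1)] nome_phi_nonzero[OF q2(2)] nome_phi_nonzero[OF q2(3)]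
       nome_psi_nonzero[OF q] nome_psi_nonzero[OF q2(2)]
    define A B C D where "A = deriv nome_phi q / nome_phi q" and "B = deriv nome_phi (-q) / nome_phi (-q)"
      and "C = deriv nome_phi (q\<^sup>2) / nome_phi (q\<^sup>2)" and "D = deriv nome_phi (-(q\<^sup>2)) / nome_phi (-(q\<^sup>2))"
    define a b c d where "a = nome_phi q" and "b = nome_phi (-q)" and "c = nome_phi (q\<^sup>2)" and "d = nome_phi (-(q\<^sup>2))"
    have dr: "deriv nome_phi q = A * a" "deriv nome_phi (-q) = B * b" "deriv nome_phi (q\<^sup>2) = C * c" "deriv nome_phi (-(q\<^sup>2)) = D * d"
      using nz by (auto simp: A_def B_def C_def D_def a_def b_def c_def d_def)
    have "((\<lambda>p. (nome_phi p)\<^sup>2 + (nome_phi (-p))\<^sup>2) has_field_derivative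
       (2 * nome_phi q * deriv nome_phi q - 2 * nome_phi (-q) * deriv nome_phi (-q))) (at q)"
      by (rule derivative_eq_intros nome_chain q q2 refl)+ (simp add: algebra_simps)
    moreover have "((\<lambda>p. 2 * (nome_phi (p\<^sup>2))\<^sup>2) has_field_derivative
       8 * q * nome_phi (q\<^sup>2) * deriv nome_phi (q\<^sup>2)) (at q)"
      by (rule derivative_eq_intros nome_chain q q2 refl)+ (simp add: algebra_simps)
    ultimately have "2 * nome_phi q * deriv nome_phi q - 2 * nome_phi (-q) * deriv nome_phi (-q) =
        8 * q * nome_phi (q\<^sup>2) * deriv nome_phi (q\<^sup>2)"
      by (rule DERIV_unique_unit_disc) (use q nome_square_sum(1) in auto)
    then have 1: "a\<^sup>2 * A - b\<^sup>2 * B = 4 * q * c\<^sup>2 * C"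
      unfolding dr a_def[symmetric] b_def[symmetric] c_def[symmetric] by algebra
    have 2: "a * b * (A - B) = - 4 * q * d\<^sup>2 * D"
      using nome_phi_mult_minus_deriv[OF q] unfolding dr a_def[symmetric] b_def[symmetric] d_def[symmetric] by algebra
    have 3: "a * b = d\<^sup>2" using nome_phi_mult_minus[OF q] by (simp add: a_def b_def d_def)
    have "d \<noteq> 0" using nz by (simp add: d_def)
    moreover have "d\<^sup>2 * (A - B) = d\<^sup>2 * (- 4 * q * D)" using 2 unfolding 3 by (simp add: algebra_simps)
    ultimately have 4: "A - B = - 4 * q * D" by (metis mult_cancel_left power_not_zero)
    have 5: "a\<^sup>2 + b\<^sup>2 = 2 * c\<^sup>2" "a\<^sup>2 - b\<^sup>2 = 2 * q * (nome_psi (q\<^sup>2))\<^sup>2"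
      using nome_square_sum[OF q] by (auto simp: a_def b_def c_def)
    \<comment> \<open>The two differentiated identities are combined so that only \<open>C + D\<close> and \<open>A +
      B\<close> remain.\<close>
    have "2 * (4 * q * c\<^sup>2 * (C + D)) = 2 * ((A + B) * q * (nome_psi (q\<^sup>2))\<^sup>2)"
    proof -
      have "2 * (4 * q * c\<^sup>2 * (C + D)) = 2 * (a\<^sup>2 * A - b\<^sup>2 * B) - 2 * c\<^sup>2 * (A - B)"
        unfolding 1 4 by algebra
      also have "\<dots> = (A + B) * (a\<^sup>2 - b\<^sup>2)" unfolding 5(1)[symmetric] by algebra
      finally show ?thesis unfolding 5 by algebra
    qed
    then have 6: "4 * c\<^sup>2 * (C + D) = (A + B) * (nome_psi (q\<^sup>2))\<^sup>2" using False by (simp add: mult_ac)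
    have 7: "nome_psi q ^ 4 = 4 * (nome_psi (q\<^sup>2))\<^sup>2 * c\<^sup>2"
    proof -
      have "nome_psi q ^ 4 = ((nome_psi q)\<^sup>2)\<^sup>2" by simp
      also have "\<dots> = (2 * nome_psi (q\<^sup>2) * c)\<^sup>2" unfolding nome_psi_square[OF q] c_def ..
      finally show ?thesis by (simp add: power_mult_distrib)
    qed
    have "(C + D) * nome_psi q ^ 4 = (A + B) * nome_psi (q\<^sup>2) ^ 4"
      unfolding 7 using arg_cong[OF 6, of "\<lambda>x. x * (nome_psi (q\<^sup>2))\<^sup>2"] by algebra
    then have "(A + B) / nome_psi q ^ 4 = (C + D) / nome_psi (q\<^sup>2) ^ 4"
      using nz by (subst frac_eq_eq) auto
    then show ?thesis by (simp only: f_def A_def B_def C_def D_def)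
  qed auto
  ultimately have "f p = f 0" using p by (rule invariant_under_squaring)
  also have "f 0 = 1 / 4"
    using DERIV_imp_deriv[OF nome_phi_has_deriv_0] by (simp add: f_def)
  finally have "deriv nome_phi p / nome_phi p + deriv nome_phi (-p) / nome_phi (-p) = nome_psi p ^ 4 / 4"
    using nome_psi_nonzero[OF p] by (simp add: f_def field_simps)
  from arg_cong[OF this, of "\<lambda>x. p * x"] show ?thesis by (simp add: dlog3_def algebra_simps)
qed

text \<open>The logarithmic derivative of the quartic relation, combined with the preceding lemma.\<close>

lemma dlog2_minus_dlog3:
  assumes p: "cmod p < 1"
  shows "dlog2 p - dlog3 p = nome_phi (-p) ^ 4 / 4"
proof (cases "p = 0")
  case False
  have p2: "cmod (-p) < 1" using p by auto
  note nz = nome_psi_nonzero[OF p] nome_phi_nonzero[OF p] nome_phi_nonzero[OF p2]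
  define a b h where "a = nome_phi p" and "b = nome_phi (-p)" and "h = nome_psi p"
  have "((\<lambda>p. nome_phi p ^ 4) has_field_derivative (4 * a ^ 3 * deriv nome_phi p)) (at p)"
    unfolding a_def by (rule derivative_eq_intros nome_chain p refl)+ (simp add: algebra_simps)
  moreover have "((\<lambda>p. nome_phi (-p) ^ 4 + p * nome_psi p ^ 4) has_field_derivative
      (- 4 * b ^ 3 * deriv nome_phi (-p) + h ^ 4 + 4 * p * h ^ 3 * deriv nome_psi p)) (at p)"
  proof -
    have d1: "((\<lambda>p. nome_phi (-p)) has_field_derivative - deriv nome_phi (-p)) (at p)"
      by (rule nome_chain DERIV_minus DERIV_ident p2)+ simp
    show ?thesis
      by (rule DERIV_cong[OF DERIV_add[OF DERIV_power[OF d1, of 4]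
            DERIV_mult[OF DERIV_ident DERIV_power[OF nome_has_deriv(2)[OF p], of 4]]]])
         (simp add: b_def h_def algebra_simps)
  qed
  ultimately have 1: "4 * a ^ 3 * deriv nome_phi p = - 4 * b ^ 3 * deriv nome_phi (-p) + h ^ 4 + 4 * p * h ^ 3 * deriv nome_psi p"
    by (rule DERIV_unique_unit_disc) (rule p, rule nome_quartic)
  have d: "p * deriv nome_phi p = dlog3 p * a" "p * deriv nome_phi (-p) = - dlog3 (-p) * b" "p * deriv nome_psi p = (dlog2 p - 1/4) * h"
    using nz by (auto simp: dlog3_def dlog2_def a_def b_def h_def)
  have "4 * a ^ 3 * (p * deriv nome_phi p) = - 4 * b ^ 3 * (p * deriv nome_phi (-p)) + p * h ^ 4 + 4 * p * h ^ 3 * (p * deriv nome_psi p)"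
    using arg_cong[OF 1, of "\<lambda>x. p * x"] by (simp add: algebra_simps)
  then have "4 * (a ^ 4 * dlog3 p) = 4 * (b ^ 4 * dlog3 (-p) + p * h ^ 4 * dlog2 p)"
    unfolding d by (simp add: algebra_simps power4_eq_xxxx power3_eq_cube)
  then have 2: "a ^ 4 * dlog3 p = b ^ 4 * dlog3 (-p) + p * h ^ 4 * dlog2 p" by (simp only: mult_cancel_left) simp
  have 3: "a ^ 4 = b ^ 4 + p * h ^ 4" using nome_quartic[OF p] by (simp add: a_def b_def h_def)
  have 4: "dlog3 (-p) = dlog3 p - p * h ^ 4 / 4" unfolding h_def dlog3_minus_dlog4[OF p, symmetric] by simp
  have "(p * h ^ 4) * (dlog2 p - dlog3 p) = (p * h ^ 4) * (b ^ 4 / 4)"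
    using 2 unfolding 3 4 by (simp add: field_simps)
  moreover have "p * h ^ 4 \<noteq> 0" using False nz by (simp add: h_def)
  ultimately show ?thesis unfolding b_def by (metis mult_cancel_left)
qed (simp add: dlog2_def dlog3_def)

section \<open>Ramanujan's differential equation\<close>

text \<open>The logarithmic derivative of the product of the three theta constants. It is a quarter of the
  normalized Eisenstein series of weight 2, which the last lemma of the section on Lambert series shows.\<close>

definition dlog_sum :: "complex \<Rightarrow> complex" where "dlog_sum p = dlog2 p + dlog3 p + dlog3 (- p)"

text \<open>The fourth powers of the second and third theta constants as functions of the nome.\<close>

definition quart2 :: "complex \<Rightarrow> complex" where "quart2 p = p * nome_psi p ^ 4"
definition quart3 :: "complex \<Rightarrow> complex" where "quart3 p = nome_phi p ^ 4"

lemma dlog_eq_dlog_sum: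
  assumes "cmod p < 1"
  shows "dlog3 (- p) = dlog_sum p / 3 - (quart2 p + quart3 p) / 12"
    and "dlog3 p = dlog_sum p / 3 + (2 * quart2 p - quart3 p) / 12"
    and "dlog2 p = dlog_sum p / 3 + (2 * quart3 p - quart2 p) / 12"
proof -
  have 1: "dlog3 p = dlog3 (-p) + quart2 p / 4" unfolding quart2_def dlog3_minus_dlog4[OF assms, symmetric] by simp
  have 2: "dlog2 p = dlog3 p + (quart3 p - quart2 p) / 4"
    unfolding quart2_def quart3_def nome_quartic[OF assms] using dlog2_minus_dlog3[OF assms] by (simp add: field_simps)
  show "dlog3 (- p) = dlog_sum p / 3 - (quart2 p + quart3 p) / 12" "dlog3 p = dlog_sum p / 3 + (2 * quart2 p - quart3 p) / 12"
    "dlog2 p = dlog_sum p / 3 + (2 * quart3 p - quart2 p) / 12"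
    unfolding dlog_sum_def 2 1 by (simp_all add: field_simps)
qed

lemma dlog_sum_double:
  assumes "cmod p < 1"
  shows "dlog_sum p = dlog_sum (p\<^sup>2) + 3 * dlog3 (- (p\<^sup>2))"
    and "dlog_sum p = 2 * dlog_sum (p\<^sup>2) - (quart2 (p\<^sup>2) + quart3 (p\<^sup>2)) / 4"
proof -
  show 1: "dlog_sum p = dlog_sum (p\<^sup>2) + 3 * dlog3 (- (p\<^sup>2))"
    using dlog2_double[OF assms] dlog3_plus_dlog4[OF assms] by (simp add: dlog_sum_def)
  show "dlog_sum p = 2 * dlog_sum (p\<^sup>2) - (quart2 (p\<^sup>2) + quart3 (p\<^sup>2)) / 4"
    unfolding 1 dlog_eq_dlog_sum(1)[OF cmod_square_less_1[OF assms]] by (simp add: field_simps)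
qed

lemma dlog_sum_holomorphic: "dlog_sum holomorphic_on ball 0 1"
proof -
  have 1: "dlog3 holomorphic_on ball 0 1" unfolding dlog3_def
    by (intro holomorphic_intros holomorphic_deriv nome_phi_holomorphic) (auto simp: nome_phi_nonzero)
  have "(dlog3 \<circ> uminus) holomorphic_on ball 0 1"
    by (rule holomorphic_on_compose_gen[OF _ 1]) (auto intro!: holomorphic_intros)
  then have 2: "(\<lambda>p. dlog3 (-p)) holomorphic_on ball 0 1" by (simp add: o_def)
  have 3: "dlog2 holomorphic_on ball 0 1" unfolding dlog2_def
    by (intro holomorphic_intros holomorphic_deriv nome_psi_holomorphic) (auto simp: nome_psi_nonzero)
  show ?thesis unfolding dlog_sum_def by (intro holomorphic_intros 1 2 3)
qed

lemma quart2_has_deriv: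
  assumes p: "cmod p < 1"
  obtains D where "(quart2 has_field_derivative D) (at p)" "p * D = 4 * quart2 p * dlog2 p"
proof
  show "(quart2 has_field_derivative (nome_psi p ^ 4 + p * (4 * nome_psi p ^ 3 * deriv nome_psi p))) (at p)"
    unfolding quart2_def[abs_def]
    by (rule DERIV_cong[OF DERIV_mult[OF DERIV_ident DERIV_power[OF nome_has_deriv(2)[OF p], of 4]]]) simp
  show "p * (nome_psi p ^ 4 + p * (4 * nome_psi p ^ 3 * deriv nome_psi p)) = 4 * quart2 p * dlog2 p"
    using nome_psi_nonzero[OF p] by (simp add: dlog2_def quart2_def field_simps power4_eq_xxxx power3_eq_cube)
qed

lemma quart3_has_deriv:
  assumes p: "cmod p < 1"
  obtains D where "(quart3 has_field_derivative D) (at p)" "p * D = 4 * quart3 p * dlog3 p"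
proof
  show "(quart3 has_field_derivative (4 * nome_phi p ^ 3 * deriv nome_phi p)) (at p)"
    unfolding quart3_def[abs_def]
    by (rule DERIV_cong[OF DERIV_power[OF nome_has_deriv(1)[OF p], of 4]]) simp
  show "p * (4 * nome_phi p ^ 3 * deriv nome_phi p) = 4 * quart3 p * dlog3 p"
    using nome_phi_nonzero[OF p] by (simp add: dlog3_def quart3_def field_simps power4_eq_xxxx power3_eq_cube)
qed

text \<open>The expression on the left is the Eisenstein series of weight 4 in terms of theta constants.\<close>

lemma quart_double:
  assumes p: "cmod p < 1"
  shows "(quart3 p)\<^sup>2 - quart3 p * quart2 p + (quart2 p)\<^sup>2 = (quart3 (p\<^sup>2))\<^sup>2 + 14 * quart3 (p\<^sup>2) * quart2 (p\<^sup>2) + (quart2 (p\<^sup>2))\<^sup>2"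
proof -
  define a b where "a = nome_phi (p\<^sup>2)" and "b = nome_psi (p\<^sup>2)"
  have "quart3 p = ((nome_phi p)\<^sup>2)\<^sup>2" "quart2 p = p * ((nome_psi p)\<^sup>2)\<^sup>2" by (simp_all add: quart2_def quart3_def)
  then have "quart3 p = (a\<^sup>2 + p * b\<^sup>2)\<^sup>2" "quart2 p = p * (2 * b * a)\<^sup>2"
    unfolding nome_phi_square[OF p] nome_psi_square[OF p] a_def b_def by simp_all
  moreover have "quart3 (p\<^sup>2) = a ^ 4" "quart2 (p\<^sup>2) = p\<^sup>2 * b ^ 4" by (simp_all add: quart2_def quart3_def a_def b_def)
  ultimately show ?thesis by algebra
qed

text \<open>The two sides are compared by \<open>quarter_under_squaring\<close>: their difference \<open>f\<close> vanishes at the cusp,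
  and the doubling formula for \<open>dlog_sum\<close>, differentiated once, together with \<open>quart_double\<close> gives
  \<open>f p = 4 * f (p\<^sup>2)\<close>.\<close>

lemma ramanujan_dlog_sum:
  assumes p: "cmod p < 1"
  shows "24 * p * deriv dlog_sum p = 16 * (dlog_sum p)\<^sup>2 - ((quart3 p)\<^sup>2 - quart3 p * quart2 p + (quart2 p)\<^sup>2)"
proof -
  define E where "E = (\<lambda>p. (quart3 p)\<^sup>2 - quart3 p * quart2 p + (quart2 p)\<^sup>2)"
  define f where "f = (\<lambda>p. 24 * p * deriv dlog_sum p - 16 * (dlog_sum p)\<^sup>2 + E p)"
  have "f holomorphic_on ball 0 1"
    unfolding f_def E_def quart2_def quart3_def
    by (intro holomorphic_intros holomorphic_deriv dlog_sum_holomorphic nome_phi_holomorphic nome_psi_holomorphic) auto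
  then have "(f has_field_derivative deriv f 0) (at 0)"
    by (rule holomorphic_derivI) auto
  moreover have "f 0 = 0" by (simp add: f_def E_def dlog_sum_def dlog3_def dlog2_def quart2_def quart3_def power2_eq_square)
  moreover have "f q = 4 * f (q\<^sup>2)" if q: "cmod q < 1" for q
  proof (cases "q = 0")
    case False
    have q2: "cmod (q\<^sup>2) < 1" using q by (rule cmod_square_less_1)
    obtain D2 where D2: "(quart2 has_field_derivative D2) (at (q\<^sup>2))" "q\<^sup>2 * D2 = 4 * quart2 (q\<^sup>2) * dlog2 (q\<^sup>2)"
      using quart2_has_deriv[OF q2] .
    obtain D3 where D3: "(quart3 has_field_derivative D3) (at (q\<^sup>2))" "q\<^sup>2 * D3 = 4 * quart3 (q\<^sup>2) * dlog3 (q\<^sup>2)"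
      using quart3_has_deriv[OF q2] .
    have dG: "(dlog_sum has_field_derivative deriv dlog_sum p) (at p)" if "cmod p < 1" for p
      using that by (intro holomorphic_derivI[OF dlog_sum_holomorphic]) auto
    have sq: "((\<lambda>x. x\<^sup>2) has_field_derivative 2 * q) (at q)" by (auto intro!: derivative_eq_intros)
    have "((\<lambda>x. 2 * dlog_sum (x\<^sup>2) - (quart2 (x\<^sup>2) + quart3 (x\<^sup>2)) / 4) has_field_derivative
       2 * (deriv dlog_sum (q\<^sup>2) * (2 * q)) - (D2 * (2 * q) + D3 * (2 * q)) / 4) (at q)"
      by (intro DERIV_diff DERIV_cmult DERIV_cdivide DERIV_add DERIV_chain2[OF dG[OF q2] sq]
        DERIV_chain2[OF D2(1) sq] DERIV_chain2[OF D3(1) sq])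
    from DERIV_unique_unit_disc[OF dG[OF q] this q dlog_sum_double(2)]
    have "deriv dlog_sum q = 2 * (deriv dlog_sum (q\<^sup>2) * (2 * q)) - (D2 * (2 * q) + D3 * (2 * q)) / 4" .
    from arg_cong[OF this, of "\<lambda>x. q * x"]
    have dd: "q * deriv dlog_sum q = 4 * (q\<^sup>2 * deriv dlog_sum (q\<^sup>2)) - (q\<^sup>2 * D2 + q\<^sup>2 * D3) / 2"
      by (simp add: algebra_simps power2_eq_square add_divide_distrib)
    have E1: "E q = (quart3 (q\<^sup>2))\<^sup>2 + 14 * quart3 (q\<^sup>2) * quart2 (q\<^sup>2) + (quart2 (q\<^sup>2))\<^sup>2"
      unfolding E_def by (rule quart_double[OF q])
    have E2: "E (q\<^sup>2) = (quart3 (q\<^sup>2))\<^sup>2 - quart3 (q\<^sup>2) * quart2 (q\<^sup>2) + (quart2 (q\<^sup>2))\<^sup>2"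
      by (simp add: E_def)
    have "f q = 24 * (q * deriv dlog_sum q) - 16 * (dlog_sum q)\<^sup>2 + E q" by (simp add: f_def)
    also have "\<dots> = 4 * f (q\<^sup>2)"
      unfolding dd D2 D3 E1 dlog_sum_double(2)[OF q] dlog_eq_dlog_sum(2,3)[OF q2] f_def E2
      by (simp add: field_simps power2_eq_square)
    finally show ?thesis .
  qed (use \<open>f 0 = 0\<close> in simp)
  ultimately have "f p = 0" using p by (rule quarter_under_squaring)
  then show ?thesis by (simp add: f_def E_def algebra_simps)
qed

section \<open>A finite triple product\<close>

text \<open>The coefficient of \<open>z ^ k\<close> in the product of the \<open>(1 + z p ^ (2 j - 1)) (1 + p ^ (2 j - 1) / z)\<close> for
  \<open>1 \<le> j \<le> N\<close>. The recursion multiplies by one more factor, so that no Laurent polynomials are needed.\<close>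

fun tp_coeff :: "complex \<Rightarrow> nat \<Rightarrow> int \<Rightarrow> complex" where
  "tp_coeff p 0 k = (if k = 0 then 1 else 0)"
| "tp_coeff p (Suc N) k = (1 + (p ^ (2*N+1))\<^sup>2) * tp_coeff p N k + p ^ (2*N+1) * (tp_coeff p N (k - 1) + tp_coeff p N (k + 1))"

lemma tp_coeff_eq_0: "\<bar>k\<bar> > int N \<Longrightarrow> tp_coeff p N k = 0"
  by (induction N arbitrary: k) auto

lemma tp_coeff_summable: "(\<lambda>k. c k * tp_coeff p N (k + a)) summable_on UNIV"
proof (rule finite_nonzero_values_imp_summable_on)
  have "{x \<in> UNIV. c x * tp_coeff p N (x + a) \<noteq> 0} \<subseteq> {- int N - a..int N - a}"
  proof
    fix x assume "x \<in> {x \<in> UNIV. c x * tp_coeff p N (x + a) \<noteq> 0}"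
    then have "\<not> \<bar>x + a\<bar> > int N" using tp_coeff_eq_0[of N "x + a" p] by auto
    then show "x \<in> {- int N - a..int N - a}" by auto
  qed
  then show "finite {x \<in> UNIV. c x * tp_coeff p N (x + a) \<noteq> 0}"
    by (rule finite_subset) simp
qed

lemma tp_coeff_shift: "(\<Sum>\<^sub>\<infinity>k. c k * tp_coeff p N (k + a)) = (\<Sum>\<^sub>\<infinity>k. c (k - a) * tp_coeff p N k)"
proof -
  have b: "bij (\<lambda>k::int. k + a)" by (rule bij_plus_right)
  show ?thesis using infsum_reindex_bij_betw[OF b, of "\<lambda>k. c (k - a) * tp_coeff p N k"] by simp
qed

lemma tp_coeff_sum_Suc:
  "(\<Sum>\<^sub>\<infinity>k. c k * tp_coeff p (Suc N) k) =
     (1 + (p ^ (2*N+1))\<^sup>2) * (\<Sum>\<^sub>\<infinity>k. c k * tp_coeff p N k) + p ^ (2*N+1) * (\<Sum>\<^sub>\<infinity>k. (c (k - 1) + c (k + 1)) * tp_coeff p N k)"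
proof -
  let ?P = "p ^ (2*N+1)"
  have s: "(\<lambda>k. c k * tp_coeff p N k) summable_on UNIV" "(\<lambda>k. c k * tp_coeff p N (k - 1)) summable_on UNIV" "(\<lambda>k. c k * tp_coeff p N (k + 1)) summable_on UNIV"
    "(\<lambda>k. c (k - 1) * tp_coeff p N k) summable_on UNIV" "(\<lambda>k. c (k + 1) * tp_coeff p N k) summable_on UNIV"
    using tp_coeff_summable[of c p N 0] tp_coeff_summable[of c p N "-1"] tp_coeff_summable[of c p N 1]
      tp_coeff_summable[of "\<lambda>k. c (k - 1)" p N 0] tp_coeff_summable[of "\<lambda>k. c (k + 1)" p N 0] by auto
  have "(\<Sum>\<^sub>\<infinity>k. c k * tp_coeff p (Suc N) k) =
     (\<Sum>\<^sub>\<infinity>k. (1 + ?P\<^sup>2) * (c k * tp_coeff p N k) + ?P * (c k * tp_coeff p N (k - 1) + c k * tp_coeff p N (k + 1)))"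
    by (rule infsum_cong) (simp add: algebra_simps)
  also have "\<dots> = (1 + ?P\<^sup>2) * (\<Sum>\<^sub>\<infinity>k. c k * tp_coeff p N k) +
      ?P * ((\<Sum>\<^sub>\<infinity>k. c k * tp_coeff p N (k - 1)) + (\<Sum>\<^sub>\<infinity>k. c k * tp_coeff p N (k + 1)))"
    using s by (simp add: infsum_add summable_on_add summable_on_cmult_right infsum_cmult_right')
  also have "(\<Sum>\<^sub>\<infinity>k. c k * tp_coeff p N (k - 1)) + (\<Sum>\<^sub>\<infinity>k. c k * tp_coeff p N (k + 1)) = (\<Sum>\<^sub>\<infinity>k. (c (k - 1) + c (k + 1)) * tp_coeff p N k)"
    using tp_coeff_shift[of c p N "-1"] tp_coeff_shift[of c p N 1] s(4,5) by (simp add: infsum_add algebra_simps)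
  finally show ?thesis .
qed

text \<open>The product and its second derivative \<open>(z d/dz)\<^sup>2\<close> at \<open>z = - 1\<close>. The sums are finite, but written over
  all integers so that they can be shifted.\<close>

definition tp_sum :: "complex \<Rightarrow> nat \<Rightarrow> complex" where
  "tp_sum p N = (\<Sum>\<^sub>\<infinity>k. (-1) powi k * tp_coeff p N k)"
definition tp_moment :: "complex \<Rightarrow> nat \<Rightarrow> complex" where
  "tp_moment p N = (\<Sum>\<^sub>\<infinity>k. (-1) powi k * of_int k ^ 2 * tp_coeff p N k)"

lemma sign_shift: "(-1) powi (k + 1) = - ((-1) powi k :: complex)" "(-1) powi (k - 1) = - ((-1) powi k :: complex)"
  by (auto simp: power_int_minus_left)

lemma tp_sum_Suc: "tp_sum p (Suc N) = (1 - p ^ (2*N+1))\<^sup>2 * tp_sum p N"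
proof -
  have "(\<Sum>\<^sub>\<infinity>k. ((-1) powi (k - 1) + (-1) powi (k + 1)) * tp_coeff p N k) = - 2 * tp_sum p N"
    unfolding tp_sum_def sign_shift by (subst infsum_cmult_right'[symmetric]) (simp add: algebra_simps)
  then show ?thesis
    unfolding tp_sum_def tp_coeff_sum_Suc[of _ p N] by (simp add: power2_eq_square algebra_simps)
qed

lemma tp_moment_Suc: "tp_moment p (Suc N) = (1 - p ^ (2*N+1))\<^sup>2 * tp_moment p N - 2 * p ^ (2*N+1) * tp_sum p N"
proof -
  have s: "(\<lambda>k. (-1) powi k * tp_coeff p N k) summable_on UNIV" "(\<lambda>k. (-1) powi k * of_int k ^ 2 * tp_coeff p N k) summable_on UNIV"
    using tp_coeff_summable[of _ p N 0] by auto
  have "(\<Sum>\<^sub>\<infinity>k. ((-1) powi (k - 1) * of_int (k - 1) ^ 2 + (-1) powi (k + 1) * of_int (k + 1) ^ 2) * tp_coeff p N k) =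
    (\<Sum>\<^sub>\<infinity>k. (- 2) * ((-1) powi k * of_int k ^ 2 * tp_coeff p N k) + (- 2) * ((-1) powi k * tp_coeff p N k))"
    unfolding sign_shift by (rule infsum_cong) (simp add: power2_eq_square algebra_simps)
  also have "\<dots> = - 2 * tp_moment p N - 2 * tp_sum p N"
    using s unfolding tp_sum_def tp_moment_def
    by (subst infsum_add) (auto simp only: infsum_cmult_right' intro!: summable_on_cmult_right, simp)
  finally have *: "(\<Sum>\<^sub>\<infinity>k. ((-1) powi (k - 1) * of_int (k - 1) ^ 2 + (-1) powi (k + 1) * of_int (k + 1) ^ 2) * tp_coeff p N k) =
     - 2 * tp_moment p N - 2 * tp_sum p N" .
  show ?thesis
    unfolding tp_moment_def tp_coeff_sum_Suc[of _ p N] * by (simp add: tp_moment_def power2_eq_square algebra_simps)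
qed

lemma tp_sum_nonzero:
  assumes "cmod p < 1"
  shows "tp_sum p N \<noteq> 0"
proof (induction N)
  case 0
  have "tp_sum p 0 = (\<Sum>\<^sub>\<infinity>k\<in>{0}. (-1) powi k * tp_coeff p 0 k)" unfolding tp_sum_def
    by (rule infsum_cong_neutral) auto
  then show ?case by simp
next
  case (Suc N)
  have "cmod (p ^ (2*N+1)) < 1" using assms by (auto simp: norm_power power_less_one_iff simp del: power_Suc)
  then have "p ^ (2*N+1) \<noteq> 1" by auto
  then show ?case using Suc by (simp add: tp_sum_Suc)
qed

text \<open>At \<open>z = - 1\<close> the first logarithmic derivative vanishes by symmetry, so this quotient is the second
  one; each factor of the product contributes one summand to it.\<close>

lemma tp_moment_div_tp_sum:
  assumes "cmod p < 1"
  shows "tp_moment p N / tp_sum p N = - 2 * (\<Sum>j<N. p ^ (2*j+1) / (1 - p ^ (2*j+1))\<^sup>2)"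
proof (induction N)
  case 0
  have "tp_moment p 0 = (\<Sum>\<^sub>\<infinity>k\<in>{0}. (-1) powi k * of_int k ^ 2 * tp_coeff p 0 k)" unfolding tp_moment_def
    by (rule infsum_cong_neutral) auto
  then show ?case by simp
next
  case (Suc N)
  have "cmod (p ^ (2*N+1)) < 1" using assms by (auto simp: norm_power power_less_one_iff simp del: power_Suc)
  then have "1 - p ^ (2*N+1) \<noteq> 0" by auto
  then have "tp_moment p (Suc N) / tp_sum p (Suc N) = tp_moment p N / tp_sum p N - 2 * (p ^ (2*N+1) / (1 - p ^ (2*N+1))\<^sup>2)"
    unfolding tp_sum_Suc tp_moment_Suc using tp_sum_nonzero[OF assms, of N]
    by (simp add: diff_divide_distrib del: power_Suc)
  then show ?case using Suc by simp
qed

text \<open>The reciprocal is continued by \<open>0\<close> to negative indices. With this convention \<open>q_pochhammer_inv_step\<close>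
  holds for all integers, and the closed form of the coefficients needs no case distinction at the ends
  of their support.\<close>

definition q_pochhammer :: "complex \<Rightarrow> nat \<Rightarrow> complex" where "q_pochhammer q n = (\<Prod>i<n. 1 - q ^ Suc i)"
definition q_pochhammer_inv :: "complex \<Rightarrow> int \<Rightarrow> complex" where "q_pochhammer_inv q n = (if n < 0 then 0 else 1 / q_pochhammer q (nat n))"

lemma q_pochhammer_nonzero: "cmod q < 1 \<Longrightarrow> q_pochhammer q n \<noteq> 0"
proof -
  assume "cmod q < 1"
  then have "cmod (q ^ Suc i) < 1" for i by (auto simp: norm_power power_less_one_iff simp del: power_Suc)
  then have "q ^ Suc i \<noteq> 1" for i by (metis norm_one order_less_irrefl)
  then show ?thesis unfolding q_pochhammer_def by (simp del: power_Suc)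
qed

lemma q_pochhammer_inv_step:
  assumes "cmod q < 1"
  shows "q_pochhammer_inv q (n - 1) = (1 - q powi n) * q_pochhammer_inv q n"
proof (cases "n \<ge> 1")
  case True
  define m where "m = nat (n - 1)"
  have m: "n = int m + 1" using True by (simp add: m_def)
  have "1 - q ^ Suc m \<noteq> 0" using q_pochhammer_nonzero[OF assms, of "Suc m"] by (simp add: q_pochhammer_def)
  moreover have "nat (int m + 1) = Suc m" by simp
  moreover have "q powi (int m + 1) = q ^ Suc m" using power_int_of_nat[of q "Suc m"] by (simp add: add.commute)
  ultimately show ?thesis using q_pochhammer_nonzero[OF assms, of m]
    unfolding m by (simp add: q_pochhammer_inv_def q_pochhammer_def)
next
  case False
  then show ?thesis by (cases "n = 0") (auto simp: q_pochhammer_inv_def)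
qed

text \<open>A Gaussian binomial coefficient. Writing both neighbours of \<open>k\<close> through the same two reciprocals
  \<open>x\<close> and \<open>y\<close> reduces the induction step to a polynomial identity in \<open>U\<close> and \<open>V\<close>.\<close>

lemma tp_coeff_closed_form:
  assumes p: "cmod p < 1" "p \<noteq> 0"
  shows "tp_coeff p N k = p powi (k\<^sup>2) * q_pochhammer (p\<^sup>2) (2 * N) * q_pochhammer_inv (p\<^sup>2) (int N - k) * q_pochhammer_inv (p\<^sup>2) (int N + k)"
proof (induction N arbitrary: k)
  case 0
  show ?case by (auto simp: q_pochhammer_inv_def q_pochhammer_def)
next
  case (Suc N)
  let ?q = "p\<^sup>2"
  note st = q_pochhammer_inv_step[OF cmod_square_less_1[OF p(1)]]
  define x y where "x = q_pochhammer_inv ?q (int N + 1 - k)" and "y = q_pochhammer_inv ?q (int N + 1 + k)"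
  define U V where "U = ?q powi (int N + 1 - k)" and "V = ?q powi (int N + 1 + k)"
  have q0: "?q \<noteq> 0" using p by simp
  have Uq: "?q powi (int N - k) = U / ?q" "?q powi (int N + k) = V / ?q"
    using power_int_diff[of ?q "int N + 1 - k" 1] power_int_diff[of ?q "int N + 1 + k" 1] q0
    by (simp_all add: U_def V_def)
  have r: "q_pochhammer_inv ?q (int N - k) = (1 - U) * x" "q_pochhammer_inv ?q (int N + k) = (1 - V) * y"
    "q_pochhammer_inv ?q (int N - k - 1) = (1 - U / ?q) * ((1 - U) * x)" "q_pochhammer_inv ?q (int N + k - 1) = (1 - V / ?q) * ((1 - V) * y)"
    using st[of "int N + 1 - k"] st[of "int N + 1 + k"] st[of "int N - k"] st[of "int N + k"]
    by (simp_all add: Uq) (simp_all add: U_def V_def x_def y_def)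
  define P where "P = p ^ (2 * N + 1)"
  have PP: "P = p powi (2 * int N + 1)" unfolding P_def using power_int_of_nat[of p "2 * N + 1"] by (simp add: add.commute)
  have qp: "?q powi n = p powi (2 * n)" for n :: int
    by (simp add: power_int_mult)
  have e1: "P * p powi ((k-1)\<^sup>2) = p powi (k\<^sup>2) * U"
    unfolding PP U_def qp using p by (simp add: power_int_add[symmetric]) (simp add: power2_eq_square algebra_simps)
  have e2: "P * p powi ((k+1)\<^sup>2) = p powi (k\<^sup>2) * V"
    unfolding PP V_def qp using p by (simp add: power_int_add[symmetric]) (simp add: power2_eq_square algebra_simps)
  have e3: "P\<^sup>2 = U * V / ?q"
    unfolding PP U_def V_def qp using p
    by (simp add: power_int_add[symmetric] power_int_power' ) (simp add: power_int_add power_int_diff power2_eq_square power4_eq_xxxx field_simps)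
  have e4: "q_pochhammer ?q (2 * Suc N) = q_pochhammer ?q (2 * N) * (1 - P\<^sup>2) * (1 - P\<^sup>2 * ?q)"
    by (simp add: q_pochhammer_def P_def power_mult[symmetric] power_add[symmetric] power2_eq_square algebra_simps)
  have "tp_coeff p (Suc N) k = (1 + P\<^sup>2) * (p powi (k\<^sup>2) * q_pochhammer ?q (2 * N) * ((1 - U) * x) * ((1 - V) * y))
      + (P * p powi ((k-1)\<^sup>2)) * q_pochhammer ?q (2 * N) * x * ((1 - V / ?q) * ((1 - V) * y))
      + (P * p powi ((k+1)\<^sup>2)) * q_pochhammer ?q (2 * N) * ((1 - U / ?q) * ((1 - U) * x)) * y"
  proof -
    have x: "q_pochhammer_inv ?q (int N - (k - 1)) = x" and y: "q_pochhammer_inv ?q (int N + (k + 1)) = y"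
      by (simp_all add: x_def y_def algebra_simps)
    have i: "int N + (k - 1) = int N + k - 1" "int N - (k + 1) = int N - k - 1" by simp_all
    show ?thesis
      unfolding tp_coeff.simps(2) P_def[symmetric] Suc[of k] Suc[of "k - 1"] Suc[of "k + 1"] i x y r
      by (simp add: distrib_left mult_ac)
  qed
  also have "\<dots> = p powi (k\<^sup>2) * q_pochhammer ?q (2 * N) * x * y *
      ((1 + U * V / ?q) * (1 - U) * (1 - V) + U * (1 - V / ?q) * (1 - V) + V * (1 - U / ?q) * (1 - U))"
    unfolding e1 e2 e3 by (simp add: algebra_simps diff_divide_distrib add_divide_distrib)
  also have "(1 + U * V / ?q) * (1 - U) * (1 - V) + U * (1 - V / ?q) * (1 - V) + V * (1 - U / ?q) * (1 - U)
     = (1 - U * V / ?q) * (1 - U * V / ?q * ?q)"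
    using q0 by (simp add: field_simps)
  also have "p powi (k\<^sup>2) * q_pochhammer ?q (2 * N) * x * y * ((1 - U * V / ?q) * (1 - U * V / ?q * ?q)) =
     p powi (k\<^sup>2) * q_pochhammer ?q (2 * Suc N) * q_pochhammer_inv ?q (int (Suc N) - k) * q_pochhammer_inv ?q (int (Suc N) + k)"
  proof -
    have x: "q_pochhammer_inv ?q (int (Suc N) - k) = x" and y: "q_pochhammer_inv ?q (int (Suc N) + k) = y"
      by (simp_all add: x_def y_def algebra_simps)
    show ?thesis unfolding e4 e3 x y by (simp only: mult_ac)
  qed
  finally show ?case .
qed

section \<open>The Lambert series\<close>

text \<open>Dominated convergence for sums over the integers, by splitting at \<open>0\<close>.\<close>

lemma tannery_int:
  fixes a :: "int \<Rightarrow> nat \<Rightarrow> complex"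
  assumes lim: "\<And>k. (\<lambda>n. a k n) \<longlonglongrightarrow> b k" and bound: "\<And>k n. norm (a k n) \<le> M k"
    and M: "M summable_on UNIV"
  shows "(\<lambda>n. \<Sum>\<^sub>\<infinity>k. a k n) \<longlonglongrightarrow> infsum b UNIV"
proof -
  have bb: "norm (b k) \<le> M k" for k
    by (rule tendsto_upperbound[OF tendsto_norm[OF lim]]) (auto intro!: always_eventually bound)
  define i1 i2 where "i1 = int" and "i2 = (\<lambda>n. - int n - 1)"
  have inj: "inj i1" "inj i2" by (auto simp: inj_on_def i1_def i2_def)
  have Ms: "(\<lambda>n. M (i n)) summable_on UNIV" if "inj i" for i :: "nat \<Rightarrow> int"
    using summable_on_subset_banach[OF M, of "range i"] summable_on_reindex[OF that, of M] by (simp add: o_def)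
  have abs: "(\<lambda>n. c (i n)) abs_summable_on UNIV" if "\<And>k. norm (c k) \<le> M k" "inj i" for c :: "int \<Rightarrow> complex" and i :: "nat \<Rightarrow> int"
    by (rule Infinite_Sum.abs_summable_on_comparison_test'[OF Ms[OF that(2)]]) (rule that)
  have split: "infsum c UNIV = (\<Sum>n. c (i1 n)) + (\<Sum>n. c (i2 n))" if "\<And>k. norm (c k) \<le> M k" for c :: "int \<Rightarrow> complex"
    using has_sum_int_split(2)[of c] abs[OF that inj(1)] abs[OF that inj(2)]
    by (auto simp: i1_def i2_def infsumI)
  have T: "(\<lambda>n. \<Sum>j. a (i j) n) \<longlonglongrightarrow> (\<Sum>j. b (i j))" if "inj i" for i :: "nat \<Rightarrow> int"
  proof -
    have "\<forall>\<^sub>F (j, n) in sequentially \<times>\<^sub>F sequentially. norm (a (i j) n) \<le> M (i j)"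
      by (rule always_eventually) (auto intro: bound)
    from tannerys_theorem[OF lim this summable_on_imp_summable[OF Ms[OF that]]] show ?thesis by simp
  qed
  show ?thesis
    using tendsto_add[OF T[OF inj(1)] T[OF inj(2)]] split[of "\<lambda>k. a k n" for n] split[of b] bound bb by simp
qed

text \<open>With \<open>s\<^sup>2 = cmod p\<close> one factor \<open>s ^ (k\<^sup>2)\<close> absorbs the weight \<open>k\<^sup>2\<close>.\<close>

lemma sq_weighted_summable:
  fixes p :: complex
  assumes p: "cmod p < 1"
  shows "(\<lambda>k::int. of_int k ^ 2 * p ^ nat (k\<^sup>2)) abs_summable_on UNIV"
proof -
  define s where "s = sqrt (cmod p)"
  have s: "0 \<le> s" "s < 1" "cmod p = s * s" using p by (auto simp: s_def)
  have "Bseq (\<lambda>m. of_nat m * s ^ m)"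
    using powser_times_n_limit_0[of s] s by (auto intro: convergent_imp_Bseq convergentI)
  then obtain B where B: "\<And>m. norm (of_nat m * s ^ m) \<le> B" by (auto simp: Bseq_def)
  have sm: "(\<lambda>k::int. of_real s ^ nat (k\<^sup>2) :: complex) abs_summable_on UNIV"
    using s by (intro nome_phi_abs_summable) auto
  show ?thesis
  proof (rule Infinite_Sum.abs_summable_on_comparison_test'[where g = "\<lambda>k. B * norm (of_real s ^ nat (k\<^sup>2) :: complex)"])
    show "(\<lambda>k::int. B * norm (of_real s ^ nat (k\<^sup>2) :: complex)) summable_on UNIV"
      using sm by (rule summable_on_cmult_right)
    fix k :: int
    have "norm (of_int k ^ 2 * p ^ nat (k\<^sup>2)) = (of_nat (nat (k\<^sup>2)) * s ^ nat (k\<^sup>2)) * s ^ nat (k\<^sup>2)"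
      by (simp add: norm_mult norm_power s(3) power_mult_distrib)
    also have "\<dots> \<le> B * s ^ nat (k\<^sup>2)"
      using B[of "nat (k\<^sup>2)"] s by (intro mult_right_mono) auto
    finally show "norm (of_int k ^ 2 * p ^ nat (k\<^sup>2)) \<le> B * norm (of_real s ^ nat (k\<^sup>2) :: complex)"
      using s by (simp add: norm_power)
  qed
qed

text \<open>The heat equation: \<open>(z d/dz)\<^sup>2\<close> and \<open>p d/dp\<close> agree on \<open>p ^ (k\<^sup>2) z ^ k\<close>.\<close>

lemma nome_phi_theta_operator:
  assumes p: "cmod p < 1"
  shows "(\<Sum>\<^sub>\<infinity>k::int. of_int k ^ 2 * p ^ nat (k\<^sup>2)) = p * deriv nome_phi p"
proof -
  define f where "f = (\<lambda>k::int. of_int k ^ 2 * p ^ nat (k\<^sup>2))"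
  have ab: "f abs_summable_on UNIV" unfolding f_def by (rule sq_weighted_summable[OF p])
  have a1: "(\<lambda>n. f (int n)) abs_summable_on UNIV"
    using summable_on_subset_banach[OF ab, of "range int"] summable_on_reindex[of int UNIV "\<lambda>k. norm (f k)"] by (simp add: o_def)
  have a2: "(\<lambda>n. f (- int n - 1)) abs_summable_on UNIV"
    using summable_on_subset_banach[OF ab, of "range (\<lambda>n. - int n - 1)"]
      summable_on_reindex[of "\<lambda>n. - int n - 1" UNIV "\<lambda>k. norm (f k)"] by (simp add: o_def inj_on_def)
  have f1: "f (int n) = of_nat (n\<^sup>2) * p ^ (n\<^sup>2)" for n by (simp add: f_def nat_succ_sq)
  have f2: "f (- int n - 1) = of_nat ((n+1)\<^sup>2) * p ^ ((n+1)\<^sup>2)" for n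
    unfolding f_def nat_succ_sq by (simp add: power2_eq_square algebra_simps)
  have "summable (\<lambda>n. f (int n))" by (rule summable_on_imp_summable[OF abs_summable_summable[OF a1]])
  from suminf_split_head[OF this] have "(\<Sum>n. f (int n)) = (\<Sum>n. f (int (Suc n)))" by (simp add: f_def)
  also have "(\<lambda>n. f (int (Suc n))) = (\<lambda>n. f (- int n - 1))"
    by (rule ext) (simp only: f1 f2 Suc_eq_plus1)
  finally have "infsum f UNIV = 2 * (\<Sum>n. f (- int n - 1))"
    using infsumI[OF has_sum_int_split(2)[OF a1 a2]] by simp
  moreover have "(\<lambda>n. f (- int n - 1)) sums (p * (deriv nome_phi p / 2))"
  proof -
    have "p * (of_nat ((n+1)\<^sup>2) * p ^ ((n+1)\<^sup>2 - 1)) = f (- int n - 1)" for n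
      unfolding f2 using power_Suc[of p "(n+1)\<^sup>2 - 1"] by (simp add: mult_ac)
    then show ?thesis using sums_mult[OF nome_phi_deriv_sums[OF p], of p] by simp
  qed
  ultimately have "infsum f UNIV = p * deriv nome_phi p" by (simp add: sums_iff mult.commute)
  then show ?thesis by (simp only: f_def)
qed

lemma q_pochhammer_inv_limit:
  assumes q: "cmod q < 1"
  obtains c M where "c \<noteq> 0" "\<And>k. (\<lambda>N. q_pochhammer_inv q (int N + k)) \<longlonglongrightarrow> c" "\<And>n. norm (q_pochhammer_inv q n) \<le> M"
proof -
  have "summable (\<lambda>i. norm (q ^ Suc i))"
    using q by (simp add: norm_power norm_mult summable_geometric)
  then have "summable (\<lambda>i. norm ((1 - q ^ Suc i) - 1))" by simp
  then have cp: "convergent_prod (\<lambda>i. 1 - q ^ Suc i)"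
    by (rule abs_convergent_prod_imp_convergent_prod[OF summable_imp_abs_convergent_prod])
  have nz: "1 - q ^ Suc i \<noteq> 0" for i
  proof -
    have "cmod (q ^ Suc i) < 1" using q by (auto simp: norm_power power_less_one_iff simp del: power_Suc)
    then show ?thesis by auto
  qed
  define Q where "Q = prodinf (\<lambda>i. 1 - q ^ Suc i)"
  have Q: "Q \<noteq> 0" unfolding Q_def using prodinf_nonzero[OF cp] nz by blast
  have "(\<lambda>n. \<Prod>i\<le>n. 1 - q ^ Suc i) \<longlonglongrightarrow> Q" unfolding Q_def by (rule convergent_prod_LIMSEQ[OF cp])
  then have "(\<lambda>n. q_pochhammer q (Suc n)) \<longlonglongrightarrow> Q" by (simp only: q_pochhammer_def lessThan_Suc_atMost)
  then have lim0: "(\<lambda>n. q_pochhammer q n) \<longlonglongrightarrow> Q" by (simp only: filterlim_sequentially_Suc)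
  then have lim: "(\<lambda>n. 1 / q_pochhammer q n) \<longlonglongrightarrow> 1 / Q" by (intro tendsto_intros Q)
  then obtain B where B: "\<And>n. norm (1 / q_pochhammer q n) \<le> B"
    using convergent_imp_Bseq[OF convergentI[OF lim]] unfolding Bseq_def by blast
  show thesis
  proof (rule that[of "1 / Q" B])
    show "1 / Q \<noteq> 0" using Q by simp
    show "norm (q_pochhammer_inv q n) \<le> B" for n
      using B[of "nat n"] order_trans[OF norm_ge_zero B[of 0]] by (auto simp: q_pochhammer_inv_def)
    fix k :: int
    have "filterlim (\<lambda>N. nat (int N + k)) sequentially sequentially"
      unfolding filterlim_at_top
    proof
      fix Z show "\<forall>\<^sub>F N in sequentially. Z \<le> nat (int N + k)"
        using eventually_ge_at_top[of "Z + nat \<bar>k\<bar>"] by eventually_elim linarith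
    qed
    from filterlim_compose[OF lim this] have "(\<lambda>N. 1 / q_pochhammer q (nat (int N + k))) \<longlonglongrightarrow> 1 / Q" .
    then show "(\<lambda>N. q_pochhammer_inv q (int N + k)) \<longlonglongrightarrow> 1 / Q"
    proof (rule Lim_transform_eventually)
      show "\<forall>\<^sub>F N in sequentially. 1 / q_pochhammer q (nat (int N + k)) = q_pochhammer_inv q (int N + k)"
        using eventually_ge_at_top[of "nat \<bar>k\<bar>"] by eventually_elim (auto simp: q_pochhammer_inv_def)
    qed
  qed
qed

text \<open>In the limit \<open>N \<rightarrow> \<infinity>\<close> the coefficients of the finite triple product, divided by \<open>q_pochhammer (p\<^sup>2) (2 N)\<close>,
  tend to \<open>p ^ (k\<^sup>2)\<close> times a nonzero constant \<open>c\<^sup>2\<close>, which cancels in the quotient of the second moment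
  by the sum.\<close>

lemma dlog4_lambert:
  assumes p: "cmod p < 1"
  shows "(\<lambda>j. p ^ (2*j+1) / (1 - p ^ (2*j+1))\<^sup>2) sums (- dlog3 (- p) / 2)"
proof (cases "p = 0")
  case True
  then show ?thesis by (simp add: dlog3_def)
next
  case False
  let ?q = "p\<^sup>2"
  have q: "cmod ?q < 1" by (rule cmod_square_less_1[OF p])
  obtain c M where c: "c \<noteq> 0" and lim: "\<And>k. (\<lambda>N. q_pochhammer_inv ?q (int N + k)) \<longlonglongrightarrow> c" and M: "\<And>n. norm (q_pochhammer_inv ?q n) \<le> M"
    using q_pochhammer_inv_limit[OF q] by blast
  have M0: "0 \<le> M" using order_trans[OF norm_ge_zero M[of 0]] .
  have key: "(\<lambda>N. (\<Sum>\<^sub>\<infinity>k. (-1) powi k * w k * tp_coeff p N k) / q_pochhammer ?q (2 * N)) \<longlonglongrightarrow> c\<^sup>2 * (\<Sum>\<^sub>\<infinity>k. w k * (- p) ^ nat (k\<^sup>2))"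
    if w: "(\<lambda>k. w k * p ^ nat (k\<^sup>2)) abs_summable_on UNIV" for w :: "int \<Rightarrow> complex"
  proof -
    define a where "a = (\<lambda>k N. (w k * (- p) ^ nat (k\<^sup>2)) * (q_pochhammer_inv ?q (int N + (- k)) * q_pochhammer_inv ?q (int N + k)))"
    have "(\<lambda>N. \<Sum>\<^sub>\<infinity>k. a k N) \<longlonglongrightarrow> (\<Sum>\<^sub>\<infinity>k. (w k * (- p) ^ nat (k\<^sup>2)) * (c * c))"
    proof (rule tannery_int)
      show "(\<lambda>n. a k n) \<longlonglongrightarrow> (w k * (- p) ^ nat (k\<^sup>2)) * (c * c)" for k
        unfolding a_def by (intro tendsto_intros lim)
      show "norm (a k n) \<le> norm (w k * p ^ nat (k\<^sup>2)) * (M * M)" for k n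
        unfolding a_def norm_mult[of "w k * _"] norm_mult[of "q_pochhammer_inv _ _"]
        using M M0 by (intro mult_mono) (auto simp: norm_mult norm_power)
      show "(\<lambda>k. norm (w k * p ^ nat (k\<^sup>2)) * (M * M)) summable_on UNIV"
        using w by (rule summable_on_cmult_left)
    qed
    moreover have "(\<Sum>\<^sub>\<infinity>k. a k N) = (\<Sum>\<^sub>\<infinity>k. (-1) powi k * w k * tp_coeff p N k) / q_pochhammer ?q (2 * N)" for N
    proof -
      have "a k N = ((-1) powi k * w k * tp_coeff p N k) * (1 / q_pochhammer ?q (2 * N))" for k
        using q_pochhammer_nonzero[OF q] unfolding tp_coeff_closed_form[OF p False] a_def minus_power_nat_sq
        by (simp add: power_int_def)
      then show ?thesis by (simp only: infsum_cmult_left') simp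
    qed
    moreover have "(\<Sum>\<^sub>\<infinity>k. (w k * (- p) ^ nat (k\<^sup>2)) * (c * c)) = c\<^sup>2 * (\<Sum>\<^sub>\<infinity>k. w k * (- p) ^ nat (k\<^sup>2))"
      unfolding infsum_cmult_left' by (simp add: power2_eq_square[of c])
    ultimately show ?thesis by simp
  qed
  have A: "(\<lambda>N. tp_sum p N / q_pochhammer ?q (2 * N)) \<longlonglongrightarrow> c\<^sup>2 * nome_phi (- p)"
    using key[of "\<lambda>_. 1"] nome_phi_abs_summable[OF p] by (simp add: tp_sum_def nome_phi_def)
  have mp: "cmod (- p) < 1" using p by simp
  have C: "(\<lambda>N. tp_moment p N / q_pochhammer ?q (2 * N)) \<longlonglongrightarrow> c\<^sup>2 * (- p * deriv nome_phi (- p))"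
    using key[of "\<lambda>k. of_int k ^ 2"] sq_weighted_summable[OF p] nome_phi_theta_operator[OF mp] by (simp add: tp_moment_def)
  have "(\<lambda>N. (tp_moment p N / q_pochhammer ?q (2 * N)) / (tp_sum p N / q_pochhammer ?q (2 * N))) \<longlonglongrightarrow> (c\<^sup>2 * (- p * deriv nome_phi (- p))) / (c\<^sup>2 * nome_phi (- p))"
    by (rule tendsto_divide[OF C A]) (use c nome_phi_nonzero[OF mp] in simp)
  then have "(\<lambda>N. tp_moment p N / tp_sum p N) \<longlonglongrightarrow> dlog3 (- p)"
    using c q_pochhammer_nonzero[OF q] by (simp add: dlog3_def)
  then have "(\<lambda>N. - (tp_moment p N / tp_sum p N) / 2) \<longlonglongrightarrow> - dlog3 (- p) / 2" by (intro tendsto_intros) auto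
  then show ?thesis unfolding tp_moment_div_tp_sum[OF p] sums_def by simp
qed

definition lambert :: "complex \<Rightarrow> complex" where
  "lambert q = (\<Sum>n. q ^ (n+1) / (1 - q ^ (n+1))\<^sup>2)"

lemma lambert_term_bound:
  assumes q: "cmod q < 1"
  shows "norm (q ^ (n+1) / (1 - q ^ (n+1))\<^sup>2) \<le> cmod q / (1 - cmod q)\<^sup>2 * cmod q ^ n"
proof -
  have "cmod (q ^ (n+1)) \<le> cmod q ^ 1"
    unfolding norm_power using q by (intro power_decreasing) auto
  then have "1 - cmod q \<le> cmod (1 - q ^ (n+1))"
    using norm_triangle_ineq2[of 1 "q ^ (n+1)"] by simp
  then have "(1 - cmod q)\<^sup>2 \<le> (cmod (1 - q ^ (n+1)))\<^sup>2" using q by (intro power_mono) auto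
  moreover have "0 < (1 - cmod q)\<^sup>2" using q by simp
  ultimately have "cmod q ^ (n+1) / (cmod (1 - q ^ (n+1)))\<^sup>2 \<le> cmod q ^ (n+1) / (1 - cmod q)\<^sup>2"
    by (intro divide_left_mono) (auto intro!: mult_pos_pos)
  then show ?thesis by (simp add: norm_divide norm_power norm_mult)
qed

lemma lambert_abs_summable:
  assumes q: "cmod q < 1"
  shows "summable (\<lambda>n. norm (q ^ (n+1) / (1 - q ^ (n+1))\<^sup>2))"
proof (rule summable_comparison_test')
  show "summable (\<lambda>n. cmod q / (1 - cmod q)\<^sup>2 * cmod q ^ n)"
    using q by (intro summable_mult summable_geometric) auto
  show "norm (norm (q ^ (n+1) / (1 - q ^ (n+1))\<^sup>2)) \<le> cmod q / (1 - cmod q)\<^sup>2 * cmod q ^ n" for n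
    using lambert_term_bound[OF q, of n] by simp
qed

lemma lambert_isCont_0: "isCont lambert 0"
proof -
  have b: "norm (lambert q) \<le> cmod q / (1 - cmod q)\<^sup>2 * (1 / (1 - cmod q))" if q: "cmod q < 1" for q
  proof -
    have "norm (lambert q) \<le> (\<Sum>n. norm (q ^ (n+1) / (1 - q ^ (n+1))\<^sup>2))"
      unfolding lambert_def by (rule summable_norm[OF lambert_abs_summable[OF q]])
    also have "\<dots> \<le> (\<Sum>n. cmod q / (1 - cmod q)\<^sup>2 * cmod q ^ n)"
      using q by (intro suminf_le lambert_term_bound lambert_abs_summable summable_mult summable_geometric) auto
    also have "\<dots> = cmod q / (1 - cmod q)\<^sup>2 * (1 / (1 - cmod q))"
      using q by (subst suminf_mult) (auto simp: suminf_geometric intro!: summable_geometric)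
    finally show ?thesis .
  qed
  have "lambert \<midarrow>0\<rightarrow> 0"
  proof (rule Lim_null_comparison)
    show "\<forall>\<^sub>F q in at 0. norm (lambert q) \<le> cmod q / (1 - cmod q)\<^sup>2 * (1 / (1 - cmod q))"
      using b by (auto simp: eventually_at intro!: exI[of _ 1])
    show "(\<lambda>q::complex. cmod q / (1 - cmod q)\<^sup>2 * (1 / (1 - cmod q))) \<midarrow>0\<rightarrow> 0"
      by (rule tendsto_eq_intros refl | simp)+
  qed
  moreover have "lambert 0 = 0" by (simp add: lambert_def)
  ultimately show ?thesis by (simp add: isCont_def)
qed

text \<open>Terms of odd index form the series of \<open>dlog4_lambert\<close>, terms of even index the same Lambert series
  at \<open>q\<^sup>2\<close>.\<close>

lemma lambert_split:
  assumes q: "cmod q < 1"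
  shows "lambert q = - dlog3 (- q) / 2 + lambert (q\<^sup>2)"
proof -
  have "(\<lambda>n. (q\<^sup>2) ^ (n+1) / (1 - (q\<^sup>2) ^ (n+1))\<^sup>2) sums lambert (q\<^sup>2)"
    unfolding lambert_def by (rule summable_sums[OF summable_norm_cancel[OF lambert_abs_summable[OF cmod_square_less_1[OF q]]]])
  from sums_add[OF dlog4_lambert[OF q] this]
  have 1: "(\<lambda>n. q ^ (2*n+1) / (1 - q ^ (2*n+1))\<^sup>2 + (q\<^sup>2) ^ (n+1) / (1 - (q\<^sup>2) ^ (n+1))\<^sup>2) sums
      (- dlog3 (- q) / 2 + lambert (q\<^sup>2))" .
  have "(\<lambda>n. q ^ (n+1) / (1 - q ^ (n+1))\<^sup>2) sums lambert q"
    unfolding lambert_def by (rule summable_sums[OF summable_norm_cancel[OF lambert_abs_summable[OF q]]])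
  from sums_group[OF this, of 2]
  have "(\<lambda>n. \<Sum>i\<in>{n*2..<n*2+2}. q ^ (i+1) / (1 - q ^ (i+1))\<^sup>2) sums lambert q" by simp
  also have "(\<lambda>n. \<Sum>i\<in>{n*2..<n*2+2}. q ^ (i+1) / (1 - q ^ (i+1))\<^sup>2)
     = (\<lambda>n. q ^ (2*n+1) / (1 - q ^ (2*n+1))\<^sup>2 + (q\<^sup>2) ^ (n+1) / (1 - (q\<^sup>2) ^ (n+1))\<^sup>2)"
  proof
    fix n :: nat
    have "{n*2..<n*2+2} = {2*n, 2*n+1}" by auto
    moreover have "(q\<^sup>2) ^ (n+1) = q ^ (2*n+1+1)"
      unfolding power_mult[symmetric] by simp
    ultimately show "(\<Sum>i\<in>{n*2..<n*2+2}. q ^ (i+1) / (1 - q ^ (i+1))\<^sup>2) =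
       q ^ (2*n+1) / (1 - q ^ (2*n+1))\<^sup>2 + (q\<^sup>2) ^ (n+1) / (1 - (q\<^sup>2) ^ (n+1))\<^sup>2" by simp
  qed
  finally show ?thesis using 1 by (rule sums_unique2)
qed

text \<open>By \<open>dlog_sum_double\<close> and \<open>lambert_split\<close> the sum \<open>4 * dlog_sum p + 24 * lambert (p\<^sup>2)\<close> is invariant under
  squaring, hence equal to its value at \<open>0\<close>.\<close>

lemma dlog_sum_lambert:
  assumes p: "cmod p < 1"
  shows "4 * dlog_sum p = 1 - 24 * lambert (p\<^sup>2)"
proof -
  define e where "e = (\<lambda>p. 4 * dlog_sum p + 24 * lambert (p\<^sup>2))"
  have "isCont dlog_sum 0"
    using dlog_sum_holomorphic
    by (metis at_within_open continuous_on_eq_continuous_at holomorphic_on_imp_continuous_on centre_in_ball zero_less_one open_ball)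
  moreover have "isCont (\<lambda>p. lambert (p\<^sup>2)) 0"
    by (rule isCont_o2[of _ "\<lambda>p. p\<^sup>2"]) (use lambert_isCont_0 in auto)
  ultimately have "isCont e 0" unfolding e_def by (intro continuous_intros)
  moreover have "e q = e (q\<^sup>2)" if "cmod q < 1" for q
    unfolding e_def dlog_sum_double(1)[OF that] lambert_split[OF cmod_square_less_1[OF that]] by simp
  ultimately have "e p = e 0" using p by (rule invariant_under_squaring)
  also have "e 0 = 1" by (simp add: e_def dlog_sum_def dlog3_def dlog2_def lambert_def)
  finally show ?thesis by (simp add: e_def algebra_simps)
qed

section \<open>Differential equations of the theta constants\<close>

definition nome :: "complex \<Rightarrow> complex" where "nome T = exp (of_real pi * \<i> * T)"

lemma cmod_nome: "cmod (nome T) = exp (- pi * Im T)"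
  by (simp add: nome_def)

lemma cmod_nome_less_1: "Im T > 0 \<Longrightarrow> cmod (nome T) < 1"
  by (simp add: cmod_nome)

lemma exp_int_nome: "0 \<le> k \<Longrightarrow> exp (of_int k * of_real pi * \<i> * T) = nome T ^ nat k"
  unfolding nome_def exp_of_nat_mult[symmetric] by (simp add: mult_ac)

lemma theta3_eq: "theta3 T = nome_phi (nome T)"
  and theta4_eq: "theta4 T = nome_phi (- nome T)"
  and theta2_eq: "theta2 T = exp (of_real pi * \<i> * T / 4) * nome_psi (nome T)"
  unfolding theta3_def theta4_def theta2_def nome_phi_def nome_psi_def minus_power_nat_sq
  by (simp_all add: exp_int_nome int_sq_add_self_nonneg del: of_int_power of_int_add)

lemma theta2_pow4: "theta2 T ^ 4 = quart2 (nome T)"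
  and theta3_pow4: "theta3 T ^ 4 = quart3 (nome T)"
proof -
  have "exp (of_real pi * \<i> * T / 4) ^ 4 = nome T"
    unfolding nome_def exp_of_nat_mult[symmetric] by simp
  then show "theta2 T ^ 4 = quart2 (nome T)" by (simp add: theta2_eq quart2_def power_mult_distrib)
  show "theta3 T ^ 4 = quart3 (nome T)" by (simp add: theta3_eq quart3_def)
qed

lemma jacobi_quartic: "Im T > 0 \<Longrightarrow> theta2 T ^ 4 + theta4 T ^ 4 = theta3 T ^ 4"
  using nome_quartic[OF cmod_nome_less_1[of T]] by (simp add: theta2_pow4 theta3_eq theta4_eq quart2_def)

lemma theta_nonzero:
  assumes "Im T > 0"
  shows "theta2 T \<noteq> 0" "theta3 T \<noteq> 0" "theta4 T \<noteq> 0"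
  using cmod_nome_less_1[OF assms]
  by (simp_all add: theta2_eq theta3_eq theta4_eq nome_phi_nonzero nome_psi_nonzero)

lemma eta_eq:
  assumes "Im T > 0"
  shows "eta T = of_real (pi\<^sup>2) / 3 * dlog_sum (nome T)"
proof -
  let ?q = "(nome T)\<^sup>2"
  have q: "cmod ?q < 1" by (intro cmod_square_less_1 cmod_nome_less_1 assms)
  have qk: "exp (2 * of_nat k * of_real pi * \<i> * T) = ?q ^ k" for k
    unfolding nome_def exp_of_nat_mult[symmetric] by (simp add: mult_ac)
  have "((\<lambda>n. ?q ^ (n+1) / (1 - ?q ^ (n+1))\<^sup>2) has_sum lambert ?q) UNIV"
    unfolding lambert_def
    by (rule norm_summable_imp_has_sum[OF lambert_abs_summable[OF q] summable_sums[OF summable_norm_cancel[OF lambert_abs_summable[OF q]]]])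
  then have "((\<lambda>k. ?q ^ k / (1 - ?q ^ k)\<^sup>2) has_sum lambert ?q) (range (\<lambda>n. n + 1))"
    by (subst has_sum_reindex) (auto simp: inj_on_def o_def)
  also have "range (\<lambda>n::nat. n + 1) = {1..}"
    by (auto simp: image_def intro: exI[of _ "x - 1" for x]) (metis Suc_le_D)
  finally have "(\<Sum>\<^sub>\<infinity>k\<in>{1::nat..}. ?q ^ k / (1 - ?q ^ k)\<^sup>2) = lambert ?q" by (rule infsumI)
  then have "eta T = 2 * (of_real pi)\<^sup>2 * (1 / 24 - lambert ?q)" by (simp add: eta_def qk)
  also have "1 / 24 - lambert ?q = dlog_sum (nome T) / 6"
  proof -
    have "lambert ?q = (1 - 4 * dlog_sum (nome T)) / 24"
      unfolding dlog_sum_lambert[OF cmod_nome_less_1[OF assms]] by simp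
    show ?thesis unfolding \<open>lambert ?q = _\<close> by (simp add: field_simps)
  qed
  finally show ?thesis by simp
qed

lemma nome_deriv: "(nome has_field_derivative of_real pi * \<i> * nome T) (at T)"
  unfolding nome_def by (auto intro!: derivative_eq_intros)

lemma theta_has_deriv:
  assumes T: "Im T > 0"
  shows "(theta3 has_field_derivative \<i> / of_real pi * (eta T + of_real (pi\<^sup>2) / 12 * (theta3 T ^ 4 - 2 * theta4 T ^ 4)) * theta3 T) (at T)"
    and "(theta4 has_field_derivative \<i> / of_real pi * (eta T + of_real (pi\<^sup>2) / 12 * (theta4 T ^ 4 - 2 * theta3 T ^ 4)) * theta4 T) (at T)"
    and "(theta2 has_field_derivative \<i> / of_real pi * (eta T + of_real (pi\<^sup>2) / 12 * (theta3 T ^ 4 + theta4 T ^ 4)) * theta2 T) (at T)"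
proof -
  let ?p = "nome T"
  have p: "cmod ?p < 1" "cmod (- ?p) < 1" using cmod_nome_less_1[OF T] by auto
  note nz = nome_phi_nonzero[OF p(1)] nome_phi_nonzero[OF p(2)] nome_psi_nonzero[OF p(1)]
  have dlog_val: "dlog_sum ?p = 3 * eta T / of_real (pi\<^sup>2)" unfolding eta_eq[OF T] by simp
  have t: "quart2 ?p = theta3 T ^ 4 - theta4 T ^ 4" "quart3 ?p = theta3 T ^ 4"
    using jacobi_quartic[OF T] by (auto simp: theta2_pow4[symmetric] theta3_pow4[symmetric] algebra_simps)
  have 3: "of_real pi * \<i> * dlog3 ?p = \<i> / of_real pi * (eta T + of_real (pi\<^sup>2) / 12 * (theta3 T ^ 4 - 2 * theta4 T ^ 4))"
    unfolding dlog_eq_dlog_sum(2)[OF p(1)] dlog_val t by (simp add: field_simps power2_eq_square)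
  have 4: "of_real pi * \<i> * dlog3 (- ?p) = \<i> / of_real pi * (eta T + of_real (pi\<^sup>2) / 12 * (theta4 T ^ 4 - 2 * theta3 T ^ 4))"
    unfolding dlog_eq_dlog_sum(1)[OF p(1)] dlog_val t by (simp add: field_simps power2_eq_square)
  have 2: "of_real pi * \<i> * dlog2 ?p = \<i> / of_real pi * (eta T + of_real (pi\<^sup>2) / 12 * (theta3 T ^ 4 + theta4 T ^ 4))"
    unfolding dlog_eq_dlog_sum(3)[OF p(1)] dlog_val t by (simp add: field_simps power2_eq_square)
  have f: "theta3 = (\<lambda>T. nome_phi (nome T))" "theta4 = (\<lambda>T. nome_phi (- nome T))"
    "theta2 = (\<lambda>T. exp (of_real pi * \<i> * T / 4) * nome_psi (nome T))"
    by (auto simp: theta3_eq theta4_eq theta2_eq)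
  have "(theta3 has_field_derivative of_real pi * \<i> * dlog3 ?p * theta3 T) (at T)"
    unfolding f(1) by (rule nome_chain nome_deriv p)+ (use nz in \<open>simp add: dlog3_def\<close>)
  then show "(theta3 has_field_derivative \<i> / of_real pi * (eta T + of_real (pi\<^sup>2) / 12 * (theta3 T ^ 4 - 2 * theta4 T ^ 4)) * theta3 T) (at T)"
    unfolding 3 .
  have "(theta4 has_field_derivative of_real pi * \<i> * dlog3 (- ?p) * theta4 T) (at T)"
    unfolding f(2) by (rule nome_chain(1) DERIV_minus nome_deriv p)+ (use nz in \<open>simp add: dlog3_def\<close>)
  then show "(theta4 has_field_derivative \<i> / of_real pi * (eta T + of_real (pi\<^sup>2) / 12 * (theta4 T ^ 4 - 2 * theta3 T ^ 4)) * theta4 T) (at T)"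
    unfolding 4 .
  have d1: "((\<lambda>T. exp (of_real pi * \<i> * T / 4)) has_field_derivative (of_real pi * \<i> / 4 * exp (of_real pi * \<i> * T / 4))) (at T)"
    by (auto intro!: derivative_eq_intros)
  have d2: "((\<lambda>T. nome_psi (nome T)) has_field_derivative (deriv nome_psi ?p * (of_real pi * \<i> * ?p))) (at T)"
    by (rule nome_chain(2)[OF nome_deriv p(1)]) simp
  have "(theta2 has_field_derivative of_real pi * \<i> * dlog2 ?p * theta2 T) (at T)"
    unfolding f(3) by (rule DERIV_cong[OF DERIV_mult[OF d1 d2]]) (use nz in \<open>simp add: dlog2_def field_simps\<close>)
  then show "(theta2 has_field_derivative \<i> / of_real pi * (eta T + of_real (pi\<^sup>2) / 12 * (theta3 T ^ 4 + theta4 T ^ 4)) * theta2 T) (at T)"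
    unfolding 2 .
qed

lemma eta_has_deriv:
  assumes T: "Im T > 0"
  shows "(eta has_field_derivative \<i> / of_real pi * (2 * (eta T)\<^sup>2 - of_real (pi^4) / 72 * (theta3 T ^ 8 - theta3 T ^ 4 * theta4 T ^ 4 + theta4 T ^ 8))) (at T)"
proof -
  let ?p = "nome T"
  have p: "cmod ?p < 1" using cmod_nome_less_1[OF T] by auto
  have t: "quart2 ?p = theta3 T ^ 4 - theta4 T ^ 4" "quart3 ?p = theta3 T ^ 4"
    using jacobi_quartic[OF T] by (auto simp: theta2_pow4[symmetric] theta3_pow4[symmetric] algebra_simps)
  have dlog_val: "dlog_sum ?p = 3 * eta T / of_real (pi\<^sup>2)" unfolding eta_eq[OF T] by simp
  have dG: "(dlog_sum has_field_derivative deriv dlog_sum ?p) (at ?p)"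
    using p by (intro holomorphic_derivI[OF dlog_sum_holomorphic]) auto
  define E where "E = theta3 T ^ 8 - theta3 T ^ 4 * theta4 T ^ 4 + theta4 T ^ 8"
  have E: "(quart3 ?p)\<^sup>2 - quart3 ?p * quart2 ?p + (quart2 ?p)\<^sup>2 = E"
    unfolding t E_def by algebra
  have R: "?p * deriv dlog_sum ?p = (16 * (3 * eta T / of_real (pi\<^sup>2))\<^sup>2 - E) / 24"
    using ramanujan_dlog_sum[OF p] unfolding E dlog_val by (simp add: field_simps)
  have "((\<lambda>T. of_real (pi\<^sup>2) / 3 * dlog_sum (nome T)) has_field_derivative of_real (pi\<^sup>2) / 3 * (deriv dlog_sum ?p * (of_real pi * \<i> * ?p))) (at T)"
    by (intro DERIV_cmult DERIV_chain2[OF dG nome_deriv])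
  then have "(eta has_field_derivative of_real (pi\<^sup>2) / 3 * (deriv dlog_sum ?p * (of_real pi * \<i> * ?p))) (at T)"
    by (rule has_field_derivative_transform_within_open[where S = "{T. Im T > 0}"])
       (use T in \<open>auto simp: eta_eq open_halfspace_Im_gt\<close>)
  moreover have "of_real (pi\<^sup>2) / 3 * (deriv dlog_sum ?p * (of_real pi * \<i> * ?p)) = of_real (pi\<^sup>2) / 3 * (of_real pi * \<i>) * (?p * deriv dlog_sum ?p)"
    by simp
  moreover have "\<dots> = \<i> / of_real pi * (2 * (eta T)\<^sup>2 - of_real (pi^4) / 72 * E)"
    unfolding R by (simp add: field_simps power2_eq_square power4_eq_xxxx)
  ultimately show ?thesis unfolding E_def by (simp only:)
qed

section \<open>The general solution\<close>

lemma csqrt_const_sq: "(csqrt (of_real pi * \<i> / 6))\<^sup>2 = of_real pi * \<i> / 6"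
  by simp

lemma frac_lin_has_deriv:
  assumes "\<gamma> * \<tau> + \<delta> \<noteq> 0" "\<alpha> * \<delta> - \<beta> * \<gamma> = 1"
  shows "(frac_lin \<alpha> \<beta> \<gamma> \<delta> has_field_derivative 1 / (\<gamma> * \<tau> + \<delta>)\<^sup>2) (at \<tau>)"
proof -
  have "((\<lambda>\<tau>. (\<alpha> * \<tau> + \<beta>) / (\<gamma> * \<tau> + \<delta>)) has_field_derivative
      (\<alpha> * (\<gamma> * \<tau> + \<delta>) - (\<alpha> * \<tau> + \<beta>) * \<gamma>) / ((\<gamma> * \<tau> + \<delta>) * (\<gamma> * \<tau> + \<delta>))) (at \<tau>)"
    using assms(1) by (auto intro!: derivative_eq_intros)
  moreover have "\<alpha> * (\<gamma> * \<tau> + \<delta>) - (\<alpha> * \<tau> + \<beta>) * \<gamma> = 1"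
    using assms(2) by (simp add: algebra_simps)
  ultimately show ?thesis by (simp add: frac_lin_def[abs_def] power2_eq_square)
qed

text \<open>How a theta constant transforms under \<open>\<tau> \<mapsto> (\<alpha> \<tau> + \<beta>) / (\<gamma> \<tau> + \<delta>)\<close> as a function of weight 1: the term
  \<open>- \<gamma> / (\<gamma> \<tau> + \<delta>)\<close> from the denominator is the inhomogeneous part of \<open>gen_u\<close>.\<close>

lemma theta_sq_over_linear_has_deriv:
  assumes f: "(f has_field_derivative \<i> / of_real pi * (eta T + of_real (pi\<^sup>2) / 12 * X) * f T) (at T)"
    and T: "T = frac_lin \<alpha> \<beta> \<gamma> \<delta> \<tau>" and w: "\<gamma> * \<tau> + \<delta> \<noteq> 0" "\<alpha> * \<delta> - \<beta> * \<gamma> = 1"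
  shows "((\<lambda>\<tau>. c * ((f (frac_lin \<alpha> \<beta> \<gamma> \<delta> \<tau>))\<^sup>2 / (\<gamma> * \<tau> + \<delta>))) has_field_derivative
     (gen_u \<alpha> \<beta> \<gamma> \<delta> \<tau> + of_real pi * \<i> / 6 * X / (\<gamma> * \<tau> + \<delta>)\<^sup>2) * (c * ((f T)\<^sup>2 / (\<gamma> * \<tau> + \<delta>)))) (at \<tau>)"
proof -
  let ?w = "\<gamma> * \<tau> + \<delta>"
  define K where "K = eta T + of_real (pi\<^sup>2) / 12 * X"
  have fc: "((\<lambda>\<tau>. f (frac_lin \<alpha> \<beta> \<gamma> \<delta> \<tau>)) has_field_derivative (\<i> / of_real pi * K * f T) * (1 / ?w\<^sup>2)) (at \<tau>)"
    using f unfolding T K_def by (rule DERIV_chain2[OF _ frac_lin_has_deriv[OF w]])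
  have wd: "((\<lambda>\<tau>. \<gamma> * \<tau> + \<delta>) has_field_derivative \<gamma>) (at \<tau>)" by (auto intro!: derivative_eq_intros)
  have u: "gen_u \<alpha> \<beta> \<gamma> \<delta> \<tau> + of_real pi * \<i> / 6 * X / ?w\<^sup>2 = 2 * \<i> / of_real pi * K / ?w\<^sup>2 - \<gamma> / ?w"
    using w(1) unfolding gen_u_def T[symmetric] K_def by (simp add: divide_simps) (simp add: algebra_simps power2_eq_square)
  show ?thesis
    unfolding u
    by (rule DERIV_cong[OF DERIV_cmult[OF DERIV_divide[OF DERIV_power[OF fc, of 2] wd w(1)]]])
       (unfold T[symmetric], use w(1) in \<open>simp add: divide_simps power2_eq_square\<close>, use w(1) in \<open>simp add: algebra_simps\<close>)
qed

theorem general_solution_solves_S: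
  assumes d: "\<alpha> * \<delta> - \<beta> * \<gamma> = 1"
  shows "solves_S (gen_dom \<alpha> \<beta> \<gamma> \<delta>)
          (gen_x \<alpha> \<beta> \<gamma> \<delta> \<epsilon>) (gen_y \<alpha> \<beta> \<gamma> \<delta>) (gen_z \<alpha> \<beta> \<gamma> \<delta>) (gen_u \<alpha> \<beta> \<gamma> \<delta>)"
  unfolding solves_S_def
proof (intro ballI conjI)
  fix \<tau> assume "\<tau> \<in> gen_dom \<alpha> \<beta> \<gamma> \<delta>"
  then have w: "\<gamma> * \<tau> + \<delta> \<noteq> 0" and Im: "Im (frac_lin \<alpha> \<beta> \<gamma> \<delta> \<tau>) > 0" by (auto simp: gen_dom_def)
  define T where "T = frac_lin \<alpha> \<beta> \<gamma> \<delta> \<tau>"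
  define W where "W = \<gamma> * \<tau> + \<delta>"
  define c where "c = csqrt (of_real pi * \<i> / 6)"
  have c2: "c * c = of_real pi * \<i> / 6" using csqrt_const_sq by (simp add: c_def power2_eq_square)
  have IT: "Im T > 0" using Im by (simp add: T_def)
  note td = theta_has_deriv[OF IT]
  note D = td[THEN theta_sq_over_linear_has_deriv, OF T_def w d]
  have y2: "(gen_y \<alpha> \<beta> \<gamma> \<delta> \<tau>)\<^sup>2 = of_real pi * \<i> / 6 * theta3 T ^ 4 / W\<^sup>2"
    unfolding gen_y_def T_def[symmetric] W_def[symmetric] power_mult_distrib csqrt_const_sq by (simp add: power_divide power_mult[symmetric])
  have z2: "(gen_z \<alpha> \<beta> \<gamma> \<delta> \<tau>)\<^sup>2 = of_real pi * \<i> / 6 * theta4 T ^ 4 / W\<^sup>2"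
    unfolding gen_z_def T_def[symmetric] W_def[symmetric] power_mult_distrib csqrt_const_sq by (simp add: power_divide power_mult[symmetric])
  show "(gen_x \<alpha> \<beta> \<gamma> \<delta> \<epsilon> has_field_derivative (gen_u \<alpha> \<beta> \<gamma> \<delta> \<tau> + (gen_y \<alpha> \<beta> \<gamma> \<delta> \<tau>)\<^sup>2 + (gen_z \<alpha> \<beta> \<gamma> \<delta> \<tau>)\<^sup>2) * gen_x \<alpha> \<beta> \<gamma> \<delta> \<epsilon> \<tau>) (at \<tau>)"
  proof -
    have e: "gen_u \<alpha> \<beta> \<gamma> \<delta> \<tau> + (gen_y \<alpha> \<beta> \<gamma> \<delta> \<tau>)\<^sup>2 + (gen_z \<alpha> \<beta> \<gamma> \<delta> \<tau>)\<^sup>2 =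
        gen_u \<alpha> \<beta> \<gamma> \<delta> \<tau> + of_real pi * \<i> / 6 * (theta3 T ^ 4 + theta4 T ^ 4) / (\<gamma> * \<tau> + \<delta>)\<^sup>2"
      unfolding y2 z2 W_def[symmetric] by (simp add: right_diff_distrib distrib_left add_divide_distrib diff_divide_distrib)
    show ?thesis using D(3)[of \<epsilon>] unfolding e by (simp only: gen_x_def[abs_def] c_def T_def)
  qed
  show "(gen_y \<alpha> \<beta> \<gamma> \<delta> has_field_derivative (gen_u \<alpha> \<beta> \<gamma> \<delta> \<tau> + (gen_y \<alpha> \<beta> \<gamma> \<delta> \<tau>)\<^sup>2 - 2 * (gen_z \<alpha> \<beta> \<gamma> \<delta> \<tau>)\<^sup>2) * gen_y \<alpha> \<beta> \<gamma> \<delta> \<tau>) (at \<tau>)"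
  proof -
    have e: "gen_u \<alpha> \<beta> \<gamma> \<delta> \<tau> + (gen_y \<alpha> \<beta> \<gamma> \<delta> \<tau>)\<^sup>2 - 2 * (gen_z \<alpha> \<beta> \<gamma> \<delta> \<tau>)\<^sup>2 =
        gen_u \<alpha> \<beta> \<gamma> \<delta> \<tau> + of_real pi * \<i> / 6 * (theta3 T ^ 4 - 2 * theta4 T ^ 4) / (\<gamma> * \<tau> + \<delta>)\<^sup>2"
      unfolding y2 z2 W_def[symmetric] by (simp add: right_diff_distrib distrib_left add_divide_distrib diff_divide_distrib)
    show ?thesis using D(1)[of c] unfolding e by (simp only: gen_y_def[abs_def] c_def T_def)
  qed
  show "(gen_z \<alpha> \<beta> \<gamma> \<delta> has_field_derivative (gen_u \<alpha> \<beta> \<gamma> \<delta> \<tau> - 2 * (gen_y \<alpha> \<beta> \<gamma> \<delta> \<tau>)\<^sup>2 + (gen_z \<alpha> \<beta> \<gamma> \<delta> \<tau>)\<^sup>2) * gen_z \<alpha> \<beta> \<gamma> \<delta> \<tau>) (at \<tau>)"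
  proof -
    have e: "gen_u \<alpha> \<beta> \<gamma> \<delta> \<tau> - 2 * (gen_y \<alpha> \<beta> \<gamma> \<delta> \<tau>)\<^sup>2 + (gen_z \<alpha> \<beta> \<gamma> \<delta> \<tau>)\<^sup>2 =
        gen_u \<alpha> \<beta> \<gamma> \<delta> \<tau> + of_real pi * \<i> / 6 * (theta4 T ^ 4 - 2 * theta3 T ^ 4) / (\<gamma> * \<tau> + \<delta>)\<^sup>2"
      unfolding y2 z2 W_def[symmetric] by (simp add: right_diff_distrib distrib_left add_divide_distrib diff_divide_distrib)
    show ?thesis using D(2)[of c] unfolding e by (simp only: gen_z_def[abs_def] c_def T_def)
  qed
  define E where "E = theta3 T ^ 8 - theta3 T ^ 4 * theta4 T ^ 4 + theta4 T ^ 8"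
  have ec: "((\<lambda>\<tau>. eta (frac_lin \<alpha> \<beta> \<gamma> \<delta> \<tau>)) has_field_derivative
      (\<i> / of_real pi * (2 * (eta T)\<^sup>2 - of_real (pi^4) / 72 * E)) * (1 / (\<gamma> * \<tau> + \<delta>)\<^sup>2)) (at \<tau>)"
    using eta_has_deriv[OF IT] unfolding T_def E_def by (rule DERIV_chain2[OF _ frac_lin_has_deriv[OF w d]])
  have wd: "((\<lambda>\<tau>. \<gamma> * \<tau> + \<delta>) has_field_derivative \<gamma>) (at \<tau>)" by (auto intro!: derivative_eq_intros)
  have w2: "(\<gamma> * \<tau> + \<delta>)\<^sup>2 \<noteq> 0" using w by simp
  have W0: "W \<noteq> 0" using w by (simp add: W_def)
  have r: "- (gen_y \<alpha> \<beta> \<gamma> \<delta> \<tau> ^ 4) + (gen_y \<alpha> \<beta> \<gamma> \<delta> \<tau>)\<^sup>2 * (gen_z \<alpha> \<beta> \<gamma> \<delta> \<tau>)\<^sup>2 - gen_z \<alpha> \<beta> \<gamma> \<delta> \<tau> ^ 4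
     = of_real (pi\<^sup>2) / 36 * E / W ^ 4"
  proof -
    have "gen_y \<alpha> \<beta> \<gamma> \<delta> \<tau> ^ 4 = ((gen_y \<alpha> \<beta> \<gamma> \<delta> \<tau>)\<^sup>2)\<^sup>2" "gen_z \<alpha> \<beta> \<gamma> \<delta> \<tau> ^ 4 = ((gen_z \<alpha> \<beta> \<gamma> \<delta> \<tau>)\<^sup>2)\<^sup>2" by simp_all
    then show ?thesis
      unfolding y2 z2 E_def using W0
      by (simp add: power_mult_distrib power_divide field_simps) (simp add: power_mult[symmetric] power2_eq_square)
  qed
  have "(gen_u \<alpha> \<beta> \<gamma> \<delta> \<tau>)\<^sup>2 + of_real (pi\<^sup>2) / 36 * E / W ^ 4 =
     2 * \<i> / of_real pi * ((\<i> / of_real pi * (2 * (eta T)\<^sup>2 - of_real (pi^4) / 72 * E)) / W ^ 4 - 2 * \<gamma> * eta T / W ^ 3) + \<gamma>\<^sup>2 / W\<^sup>2"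
    unfolding gen_u_def T_def[symmetric] W_def[symmetric]
    using W0 by (simp add: field_simps power2_eq_square power3_eq_cube power4_eq_xxxx)
  then have U: "(gen_u \<alpha> \<beta> \<gamma> \<delta> \<tau>)\<^sup>2 - gen_y \<alpha> \<beta> \<gamma> \<delta> \<tau> ^ 4 + (gen_y \<alpha> \<beta> \<gamma> \<delta> \<tau>)\<^sup>2 * (gen_z \<alpha> \<beta> \<gamma> \<delta> \<tau>)\<^sup>2 - gen_z \<alpha> \<beta> \<gamma> \<delta> \<tau> ^ 4 =
     2 * \<i> / of_real pi * ((\<i> / of_real pi * (2 * (eta T)\<^sup>2 - of_real (pi^4) / 72 * E)) / W ^ 4 - 2 * \<gamma> * eta T / W ^ 3) + \<gamma>\<^sup>2 / W\<^sup>2"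
    unfolding r[symmetric] by (simp add: algebra_simps)
  show "(gen_u \<alpha> \<beta> \<gamma> \<delta> has_field_derivative (gen_u \<alpha> \<beta> \<gamma> \<delta> \<tau>)\<^sup>2 - gen_y \<alpha> \<beta> \<gamma> \<delta> \<tau> ^ 4 + (gen_y \<alpha> \<beta> \<gamma> \<delta> \<tau>)\<^sup>2 * (gen_z \<alpha> \<beta> \<gamma> \<delta> \<tau>)\<^sup>2 - gen_z \<alpha> \<beta> \<gamma> \<delta> \<tau> ^ 4) (at \<tau>)"
    unfolding U unfolding gen_u_def[abs_def]
    by (rule DERIV_cong[OF DERIV_diff[OF DERIV_cmult[OF DERIV_divide[OF ec DERIV_power[OF wd, of 2] w2]] DERIV_divide[OF DERIV_const wd w]]])
       (unfold T_def[symmetric] W_def[symmetric], use W0 in \<open>simp add: field_simps power2_eq_square power3_eq_cube power4_eq_xxxx\<close>)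
qed

section \<open>Shift, doubling and the elliptic moduli\<close>

lemma nome_psi_minus: "nome_psi (- p) = nome_psi p"
  unfolding nome_psi_def
proof (rule infsum_cong)
  fix k :: int
  have "even (k\<^sup>2 + k)" by auto
  then have "even (nat (k\<^sup>2 + k))" using int_sq_add_self_nonneg[of k] by (simp add: even_nat_iff)
  then show "(- p) ^ nat (k\<^sup>2 + k) = p ^ nat (k\<^sup>2 + k)" by (simp add: power_minus_even)
qed

lemma nome_shift: "nome (T + 1) = - nome T"
  by (simp add: nome_def distrib_left exp_add)

lemma nome_double: "nome (2 * T) = (nome T)\<^sup>2"
  unfolding nome_def exp_of_nat_mult[symmetric] by (simp add: mult_ac)

lemma theta3_shift: "theta3 (T + 1) = theta4 T"
  and theta4_shift: "theta4 (T + 1) = theta3 T"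
  by (simp_all add: theta3_eq theta4_eq nome_shift)

lemma theta2_shift_sq: "(theta2 (T + 1))\<^sup>2 = \<i> * (theta2 T)\<^sup>2"
proof -
  have "(exp (of_real pi * \<i> * (T + 1) / 4))\<^sup>2 = exp (of_real pi * \<i> / 2) * (exp (of_real pi * \<i> * T / 4))\<^sup>2"
    unfolding exp_of_nat_mult[symmetric] exp_add[symmetric]
    by (rule arg_cong[of _ _ exp]) (simp add: field_simps)
  also have "exp (of_real pi * \<i> / 2) = \<i>" using cis_pi_half by (simp add: cis_conv_exp mult_ac)
  finally show ?thesis by (simp add: theta2_eq nome_shift nome_psi_minus power_mult_distrib)
qed

lemma theta_double:
  assumes "Im T > 0"
  shows "2 * (theta3 (2 * T))\<^sup>2 = (theta3 T)\<^sup>2 + (theta4 T)\<^sup>2"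
    and "2 * (theta2 (2 * T))\<^sup>2 = (theta3 T)\<^sup>2 - (theta4 T)\<^sup>2"
proof -
  have "(exp (of_real pi * \<i> * (2 * T) / 4))\<^sup>2 = nome T"
    unfolding nome_def exp_of_nat_mult[symmetric] by (simp add: mult_ac)
  then show "2 * (theta3 (2 * T))\<^sup>2 = (theta3 T)\<^sup>2 + (theta4 T)\<^sup>2"
    "2 * (theta2 (2 * T))\<^sup>2 = (theta3 T)\<^sup>2 - (theta4 T)\<^sup>2"
    using nome_square_sum[OF cmod_nome_less_1[OF assms]]
    by (simp_all add: theta3_eq theta4_eq theta2_eq nome_double power_mult_distrib)
qed

text \<open>The elliptic modulus \<open>k\<close> and the complementary modulus.\<close>

definition ell_modulus :: "complex \<Rightarrow> complex" where "ell_modulus T = (theta2 T)\<^sup>2 / (theta3 T)\<^sup>2"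
definition ell_comodulus :: "complex \<Rightarrow> complex" where "ell_comodulus T = (theta4 T)\<^sup>2 / (theta3 T)\<^sup>2"

lemma ell_modulus_comodulus: "Im T > 0 \<Longrightarrow> (ell_modulus T)\<^sup>2 + (ell_comodulus T)\<^sup>2 = 1"
  using jacobi_quartic[of T] theta_nonzero[of T]
  by (simp add: ell_modulus_def ell_comodulus_def power_divide power_mult[symmetric] add_divide_distrib[symmetric])

lemma ell_modulus_double:
  assumes "Im T > 0"
  shows "1 + ell_comodulus T \<noteq> 0" "ell_modulus (2 * T) = (1 - ell_comodulus T) / (1 + ell_comodulus T)"
proof -
  have T2: "Im (2 * T) > 0" using assms by simp
  have e: "1 + ell_comodulus T = 2 * (theta3 (2 * T))\<^sup>2 / (theta3 T)\<^sup>2"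
    "1 - ell_comodulus T = 2 * (theta2 (2 * T))\<^sup>2 / (theta3 T)\<^sup>2"
    unfolding theta_double[OF assms] using theta_nonzero[OF assms] by (simp_all add: ell_comodulus_def field_simps)
  show "1 + ell_comodulus T \<noteq> 0" "ell_modulus (2 * T) = (1 - ell_comodulus T) / (1 + ell_comodulus T)"
    unfolding e using theta_nonzero[OF assms] theta_nonzero[OF T2] by (simp_all add: ell_modulus_def)
qed

lemma ell_comodulus_has_deriv:
  assumes T: "Im T > 0"
  shows "(ell_comodulus has_field_derivative - (of_real pi * \<i> / 2 * theta2 T ^ 4 * ell_comodulus T)) (at T)"
proof -
  note nz = theta_nonzero[OF T]
  define E where "E = eta T"
  define a b where "a = theta3 T" and "b = theta4 T"
  have q: "theta2 T ^ 4 = a ^ 4 - b ^ 4" using jacobi_quartic[OF T] by (simp add: a_def b_def algebra_simps)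
  have nz': "a \<noteq> 0" "a\<^sup>2 \<noteq> 0" using nz by (auto simp: a_def)
  have d: "((\<lambda>T. (theta4 T)\<^sup>2 / (theta3 T)\<^sup>2) has_field_derivative
     ((2 * b * (\<i> / of_real pi * (E + of_real (pi\<^sup>2) / 12 * (b ^ 4 - 2 * a ^ 4)) * b)) * a\<^sup>2 -
       b\<^sup>2 * (2 * a * (\<i> / of_real pi * (E + of_real (pi\<^sup>2) / 12 * (a ^ 4 - 2 * b ^ 4)) * a))) / (a\<^sup>2 * a\<^sup>2)) (at T)"
    using nz DERIV_divide[OF DERIV_power[OF theta_has_deriv(2)[OF T], of 2] DERIV_power[OF theta_has_deriv(1)[OF T], of 2]]
    unfolding a_def b_def E_def by (simp add: mult_ac)
  have "((2 * b * (\<i> / of_real pi * (E + of_real (pi\<^sup>2) / 12 * (b ^ 4 - 2 * a ^ 4)) * b)) * a\<^sup>2 -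
       b\<^sup>2 * (2 * a * (\<i> / of_real pi * (E + of_real (pi\<^sup>2) / 12 * (a ^ 4 - 2 * b ^ 4)) * a))) / (a\<^sup>2 * a\<^sup>2)
     = - (of_real pi * \<i> / 2 * (a ^ 4 - b ^ 4) * (b\<^sup>2 / a\<^sup>2))"
    using nz' by (simp add: divide_simps) (simp add: algebra_simps power2_eq_square power4_eq_xxxx)
  then show ?thesis
    using d unfolding q ell_comodulus_def[abs_def] by (simp only: a_def b_def)
qed

lemma ell_modulus_has_deriv:
  assumes T: "Im T > 0"
  shows "(ell_modulus has_field_derivative (of_real pi * \<i> / 2 * theta4 T ^ 4 * ell_modulus T)) (at T)"
proof -
  note nz = theta_nonzero[OF T]
  define E where "E = eta T"
  define a b c where "a = theta3 T" and "b = theta4 T" and "c = theta2 T"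
  have nz': "a \<noteq> 0" "a\<^sup>2 \<noteq> 0" using nz by (auto simp: a_def)
  have d: "((\<lambda>T. (theta2 T)\<^sup>2 / (theta3 T)\<^sup>2) has_field_derivative
     ((2 * c * (\<i> / of_real pi * (E + of_real (pi\<^sup>2) / 12 * (a ^ 4 + b ^ 4)) * c)) * a\<^sup>2 -
       c\<^sup>2 * (2 * a * (\<i> / of_real pi * (E + of_real (pi\<^sup>2) / 12 * (a ^ 4 - 2 * b ^ 4)) * a))) / (a\<^sup>2 * a\<^sup>2)) (at T)"
    using nz DERIV_divide[OF DERIV_power[OF theta_has_deriv(3)[OF T], of 2] DERIV_power[OF theta_has_deriv(1)[OF T], of 2]]
    unfolding a_def b_def c_def E_def by (simp add: mult_ac)
  have "((2 * c * (\<i> / of_real pi * (E + of_real (pi\<^sup>2) / 12 * (a ^ 4 + b ^ 4)) * c)) * a\<^sup>2 -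
       c\<^sup>2 * (2 * a * (\<i> / of_real pi * (E + of_real (pi\<^sup>2) / 12 * (a ^ 4 - 2 * b ^ 4)) * a))) / (a\<^sup>2 * a\<^sup>2)
     = of_real pi * \<i> / 2 * b ^ 4 * (c\<^sup>2 / a\<^sup>2)"
    using nz' by (simp add: divide_simps) (simp add: algebra_simps power2_eq_square power4_eq_xxxx)
  then show ?thesis
    using d unfolding ell_modulus_def[abs_def] by (simp only: a_def b_def c_def)
qed

section \<open>The imaginary axis\<close>

text \<open>The normal density with mean \<open>0\<close> and variance \<open>1 / (2 \<pi> \<epsilon>)\<close> is \<open>sqrt \<epsilon>\<close> times this function.\<close>

lemma gauss_has_integral:
  assumes "\<epsilon> > 0"
  shows "((\<lambda>x::real. exp (- pi * \<epsilon> * x\<^sup>2)) has_integral 1 / sqrt \<epsilon>) UNIV"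
proof -
  \<comment> \<open>The standard deviation for which the exponent is \<open>- \<pi> \<epsilon> x\<^sup>2\<close>.\<close>
  define \<sigma> where "\<sigma> = 1 / sqrt (2 * pi * \<epsilon>)"
  have s: "\<sigma> > 0" using assms by (simp add: \<sigma>_def)
  have s2: "\<sigma>\<^sup>2 = 1 / (2 * pi * \<epsilon>)" using assms by (simp add: \<sigma>_def power_divide)
  have nd: "normal_density 0 \<sigma> x = sqrt \<epsilon> * exp (- pi * \<epsilon> * x\<^sup>2)" for x
    using assms unfolding normal_density_def s2 by (simp add: real_sqrt_divide)
  have "(normal_density 0 \<sigma> has_integral 1) UNIV"
    using has_integral_integral_lborel[OF integrable_normal_density[OF s, of 0]] integral_normal_density[OF s, of 0] by simp
  then have "((\<lambda>x. (1 / sqrt \<epsilon>) * normal_density 0 \<sigma> x) has_integral (1 / sqrt \<epsilon>) * 1) UNIV"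
    by (rule has_integral_mult_right)
  then show ?thesis using assms by (simp add: nd)
qed

text \<open>A sum of values of a decreasing function differs from its integral by at most the first value,
  which is \<open>1\<close>.\<close>

lemma gauss_sum_bounds:
  assumes e: "\<epsilon> > 0" and sm: "summable (\<lambda>n. exp (- pi * \<epsilon> * (real n)\<^sup>2))"
  shows "1 / (2 * sqrt \<epsilon>) \<le> (\<Sum>n. exp (- pi * \<epsilon> * (real n)\<^sup>2))"
    and "(\<Sum>n. exp (- pi * \<epsilon> * (real n)\<^sup>2)) \<le> 1 / (2 * sqrt \<epsilon>) + 1"
proof -
  define f where "f = (\<lambda>x::real. exp (- pi * \<epsilon> * x\<^sup>2))"
  have cont: "continuous_on A f" for A unfolding f_def by (intro continuous_intros)
  have int: "f integrable_on {a..b}" for a b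
    by (rule integrable_continuous_real[OF cont])
  interpret antimono_fun_sum_integral_diff f
  proof
    show "f x \<ge> f y" if "x \<ge> 0" "x \<le> y" for x y
      using that e unfolding f_def by (auto intro!: mult_left_mono power_mono)
  qed (use cont in \<open>auto simp: f_def\<close>)
  have sym: "integral {-real n..real n} f = 2 * integral {0..real n} f" for n
  proof -
    have "integral {-real n..real n} f = integral {-real n..0} f + integral {0..real n} f"
      using Henstock_Kurzweil_Integration.integral_combine[of "- real n" 0 "real n" f] int by simp
    also have "integral {-real n..0} f = integral {0..real n} f"
    proof -
      have "(\<lambda>x. f (- x)) = f" by (auto simp: f_def)
      then show ?thesis using Henstock_Kurzweil_Integration.integral_reflect_real[of "real n" 0 f] by simp
    qed
    finally show ?thesis by simp
  qed
  have "(\<lambda>n. integral {-real n..real n} f) \<longlonglongrightarrow> 1 / sqrt \<epsilon>"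
  proof (rule LIMSEQ_I)
    fix r :: real assume "r > 0"
    have "(f has_integral 1 / sqrt \<epsilon>) UNIV" unfolding f_def by (rule gauss_has_integral[OF e])
    then obtain B where B: "B > 0" "\<And>a b. ball 0 B \<subseteq> cbox a b \<Longrightarrow> norm (integral (cbox a b) f - 1 / sqrt \<epsilon>) < r"
      using \<open>r > 0\<close> unfolding has_integral_alt'[of f] by auto
    show "\<exists>no. \<forall>n\<ge>no. norm (integral {-real n..real n} f - 1 / sqrt \<epsilon>) < r"
    proof (intro exI allI impI)
      fix n :: nat assume "nat \<lceil>B\<rceil> \<le> n"
      then have "B \<le> real n" by linarith
      then have "ball 0 B \<subseteq> cbox (- real n) (real n)" by (auto simp: dist_norm)
      from B(2)[OF this] show "norm (integral {-real n..real n} f - 1 / sqrt \<epsilon>) < r" by simp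
    qed
  qed
  then have lim1: "(\<lambda>n. integral {0..real n} f) \<longlonglongrightarrow> 1 / (2 * sqrt \<epsilon>)"
    unfolding sym using tendsto_divide[of "\<lambda>n. 2 * integral {0..real n} f" "1 / sqrt \<epsilon>" sequentially "\<lambda>_. 2" 2] by (simp add: mult.commute)
  have "(\<lambda>n. \<Sum>k\<le>n. f (real k)) \<longlonglongrightarrow> (\<Sum>n. f (real n))"
    using summable_LIMSEQ'[OF sm] by (simp add: f_def)
  from tendsto_diff[OF this lim1] have lim: "sum_integral_diff_series \<longlonglongrightarrow> (\<Sum>n. f (real n)) - 1 / (2 * sqrt \<epsilon>)"
    by (simp add: sum_integral_diff_series_def[abs_def])
  have "0 \<le> (\<Sum>n. f (real n)) - 1 / (2 * sqrt \<epsilon>)"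
    by (rule LIMSEQ_le_const[OF lim]) (use sum_integral_diff_series_nonneg in auto)
  moreover have "(\<Sum>n. f (real n)) - 1 / (2 * sqrt \<epsilon>) \<le> sum_integral_diff_series 0"
    by (rule LIMSEQ_le_const2[OF lim]) (use sum_integral_diff_series_antimono in auto)
  moreover have "sum_integral_diff_series 0 = 1" by (simp add: sum_integral_diff_series_def) (simp add: f_def)
  ultimately show "1 / (2 * sqrt \<epsilon>) \<le> (\<Sum>n. exp (- pi * \<epsilon> * (real n)\<^sup>2))"
    "(\<Sum>n. exp (- pi * \<epsilon> * (real n)\<^sup>2)) \<le> 1 / (2 * sqrt \<epsilon>) + 1" by (simp_all add: f_def)
qed

lemma theta3_axis_bounds:
  assumes e: "\<epsilon> > 0"
  shows "theta3 (\<i> * of_real \<epsilon>) = of_real (Re (theta3 (\<i> * of_real \<epsilon>)))"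
    and "\<bar>Re (theta3 (\<i> * of_real \<epsilon>)) - 1 / sqrt \<epsilon>\<bar> \<le> 1"
proof -
  define s where "s = exp (- pi * \<epsilon>)"
  have s: "0 < s" "s < 1" using e by (auto simp: s_def)
  have nm: "nome (\<i> * of_real \<epsilon>) = of_real s"
  proof -
    have "of_real pi * \<i> * (\<i> * of_real \<epsilon>) = complex_of_real (- pi * \<epsilon>)" by (simp add: complex_eq_iff)
    then show ?thesis unfolding nome_def s_def by (simp only: exp_of_real)
  qed
  have pw: "s ^ (n\<^sup>2) = exp (- pi * \<epsilon> * (real n)\<^sup>2)" for n
    unfolding s_def exp_of_nat_mult[symmetric] by (simp add: mult_ac)
  have "summable (\<lambda>n. (of_real s :: complex) ^ (n\<^sup>2))"
    by (rule summable_on_imp_summable[OF abs_summable_summable[OF lacunary_abs_summable[OF le_succ_sq(2)]]])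
      (use s in simp)
  then have "summable (\<lambda>n. of_real (s ^ (n\<^sup>2)) :: complex)" by simp
  then have sm: "summable (\<lambda>n. s ^ (n\<^sup>2))" by (simp only: summable_of_real_iff)
  have "theta3 (\<i> * of_real \<epsilon>) = 1 + 2 * (\<Sum>n. (of_real s :: complex) ^ ((n+1)\<^sup>2))"
    unfolding theta3_eq nm using s by (intro nome_phi_eq) auto
  also have "\<dots> = 2 * (\<Sum>n. (of_real s :: complex) ^ (n\<^sup>2)) - 1"
    using suminf_sq_shift[of "of_real s"] s by simp
  also have "(\<Sum>n. (of_real s :: complex) ^ (n\<^sup>2)) = of_real (\<Sum>n. s ^ (n\<^sup>2))"
    using suminf_of_real[OF sm, where 'a = complex] by (simp only: of_real_power)
  finally have t: "theta3 (\<i> * of_real \<epsilon>) = of_real (2 * (\<Sum>n. s ^ (n\<^sup>2)) - 1)" by simp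
  then show "theta3 (\<i> * of_real \<epsilon>) = of_real (Re (theta3 (\<i> * of_real \<epsilon>)))" by simp
  have "1 / (2 * sqrt \<epsilon>) \<le> (\<Sum>n. s ^ (n\<^sup>2))" "(\<Sum>n. s ^ (n\<^sup>2)) \<le> 1 / (2 * sqrt \<epsilon>) + 1"
    using gauss_sum_bounds[OF e] sm unfolding pw by auto
  then show "\<bar>Re (theta3 (\<i> * of_real \<epsilon>)) - 1 / sqrt \<epsilon>\<bar> \<le> 1"
    unfolding t by (simp add: abs_le_iff)
qed

text \<open>The behaviour of the third theta constant at the cusp \<open>0\<close>, where the defining series is useless: it
  is a Riemann sum of the Gaussian integral.\<close>

lemma theta3_cusp_limit:
  "((\<lambda>\<epsilon>. \<epsilon> * (Re (theta3 (\<i> * of_real \<epsilon>)))\<^sup>2) \<longlongrightarrow> 1) (at_right 0)"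
proof -
  have "((\<lambda>\<epsilon>. sqrt \<epsilon> * Re (theta3 (\<i> * of_real \<epsilon>)) - 1) \<longlongrightarrow> 0) (at_right 0)"
  proof (rule Lim_null_comparison)
    have "norm (sqrt \<epsilon> * Re (theta3 (\<i> * of_real \<epsilon>)) - 1) \<le> sqrt \<epsilon>" if e: "\<epsilon> > 0" for \<epsilon>
    proof -
      have "sqrt \<epsilon> * Re (theta3 (\<i> * of_real \<epsilon>)) - 1 = sqrt \<epsilon> * (Re (theta3 (\<i> * of_real \<epsilon>)) - 1 / sqrt \<epsilon>)"
        using e by (simp add: field_simps)
      also have "norm \<dots> \<le> sqrt \<epsilon> * 1"
        unfolding norm_mult using theta3_axis_bounds(2)[OF e] e by (intro mult_mono) auto
      finally show ?thesis by simp
    qed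
    then show "\<forall>\<^sub>F \<epsilon> in at_right 0. norm (sqrt \<epsilon> * Re (theta3 (\<i> * of_real \<epsilon>)) - 1) \<le> sqrt \<epsilon>"
      by (auto simp: eventually_at_right_less intro: eventually_mono[OF eventually_at_right_less[of 0]])
    show "(sqrt \<longlongrightarrow> 0) (at_right 0)"
      by (rule tendsto_eq_rhs[OF tendsto_real_sqrt[OF tendsto_ident_at]]) simp
  qed
  then have "((\<lambda>\<epsilon>. sqrt \<epsilon> * Re (theta3 (\<i> * of_real \<epsilon>))) \<longlongrightarrow> 1) (at_right 0)"
    by (simp add: LIM_zero_iff)
  from tendsto_power[OF this, of 2]
  have "((\<lambda>\<epsilon>. (sqrt \<epsilon> * Re (theta3 (\<i> * of_real \<epsilon>)))\<^sup>2) \<longlongrightarrow> 1) (at_right 0)" by simp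
  then show ?thesis
    by (rule Lim_transform_eventually)
       (auto intro: eventually_mono[OF eventually_at_right_less[of 0]] simp: power_mult_distrib)
qed

text \<open>Under the Landen recursion a difference of the logarithms at least doubles when \<open>t\<close> is doubled, since
  \<open>Y > X\<close> means \<open>S < R\<close> and the recursion gives \<open>Y / X\<close> at \<open>2 t\<close> as \<open>(Y / X)\<^sup>2 * ((1 + R) / (1 + S))\<^sup>2\<close> at \<open>t\<close>.
  Equal rates of growth therefore leave no room for a difference.\<close>

lemma landen_orbit_le:
  fixes X R Y S :: "real \<Rightarrow> real"
  assumes posX: "\<And>t. t > 0 \<Longrightarrow> 0 < X t \<and> 0 < R t \<and> (X t)\<^sup>2 + (R t)\<^sup>2 = 1 \<and> X (2 * t) = (1 - R t) / (1 + R t)"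
    and posY: "\<And>t. t > 0 \<Longrightarrow> 0 < Y t \<and> 0 < S t \<and> (Y t)\<^sup>2 + (S t)\<^sup>2 = 1 \<and> Y (2 * t) = (1 - S t) / (1 + S t)"
    and limX: "((\<lambda>t. ln (X t) / t) \<longlongrightarrow> L) at_top" and limY: "((\<lambda>t. ln (Y t) / t) \<longlongrightarrow> L) at_top"
    and t: "t > 0"
  shows "Y t \<le> X t"
proof (rule ccontr)
  assume "\<not> Y t \<le> X t"
  define d where "d = ln (Y t) - ln (X t)"
  have d: "d > 0" using \<open>\<not> Y t \<le> X t\<close> posX[OF t] posY[OF t] by (simp add: d_def)
  have step: "2 * (ln (Y s) - ln (X s)) \<le> ln (Y (2 * s)) - ln (X (2 * s))" if s: "s > 0" and less: "X s < Y s" for s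
  proof -
    have X: "0 < X s" "0 < R s" "(X s)\<^sup>2 = (1 - R s) * (1 + R s)" "X (2 * s) = (1 - R s) / (1 + R s)"
      using posX[OF s] by (auto simp: power2_eq_square algebra_simps)
    have Y: "0 < Y s" "0 < S s" "(Y s)\<^sup>2 = (1 - S s) * (1 + S s)" "Y (2 * s) = (1 - S s) / (1 + S s)"
      using posY[OF s] by (auto simp: power2_eq_square algebra_simps)
    have "(X s)\<^sup>2 < (Y s)\<^sup>2" using less X(1) by (intro power_strict_mono) auto
    then have "(S s)\<^sup>2 < (R s)\<^sup>2" using posX[OF s] posY[OF s] by auto
    then have SR: "S s < R s" using X(2) by (meson less_eq_real_def power_mono_iff not_less power2_less_imp_less)
    have "0 < 1 - R s"
    proof -
      have "0 < (X s)\<^sup>2" using X(1) by simp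
      then show ?thesis unfolding X(3) using X(2) by (simp add: zero_less_mult_iff)
    qed
    then have pos: "0 < 1 - R s" "0 < 1 - S s" "0 < 1 + R s" "0 < 1 + S s" using SR X Y by auto
    have "2 * ln (X s) = ln ((X s)\<^sup>2)" "2 * ln (Y s) = ln ((Y s)\<^sup>2)" using X(1) Y(1) by (auto simp: ln_realpow)
    then have "2 * ln (X s) = ln (1 - R s) + ln (1 + R s)" "2 * ln (Y s) = ln (1 - S s) + ln (1 + S s)"
      unfolding X(3) Y(3) using pos by (auto simp: ln_mult)
    moreover have "ln (X (2 * s)) = ln (1 - R s) - ln (1 + R s)" "ln (Y (2 * s)) = ln (1 - S s) - ln (1 + S s)"
      unfolding X(4) Y(4) using pos by (auto simp: ln_div)
    moreover have "ln (1 + S s) \<le> ln (1 + R s)" using SR pos by simp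
    ultimately show ?thesis by simp
  qed
  have grow: "2 ^ n * d \<le> ln (Y (2 ^ n * t)) - ln (X (2 ^ n * t))" for n
  proof (induction n)
    case (Suc n)
    have p: "2 ^ n * t > 0" using t by simp
    have "0 < 2 ^ n * d" using d by simp
    then have "ln (X (2 ^ n * t)) < ln (Y (2 ^ n * t))" using Suc by linarith
    then have "X (2 ^ n * t) < Y (2 ^ n * t)" using posX[OF p] posY[OF p] by simp
    from step[OF p this] Suc show ?case by (simp add: mult.assoc)
  qed (simp add: d_def)
  have "filterlim (\<lambda>n. 2 ^ n * t) at_top sequentially"
    by (rule filterlim_at_top_mult_tendsto_pos[OF tendsto_const t])
       (use filterlim_realpow_sequentially_gt1[of "2::real"] in \<open>simp add: filterlim_at_infinity_imp_filterlim_at_top\<close>)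
  then have "(\<lambda>n. ln (Y (2 ^ n * t)) / (2 ^ n * t) - ln (X (2 ^ n * t)) / (2 ^ n * t)) \<longlonglongrightarrow> L - L"
    by (intro tendsto_diff filterlim_compose[OF limX] filterlim_compose[OF limY])
  moreover have "d / t \<le> ln (Y (2 ^ n * t)) / (2 ^ n * t) - ln (X (2 ^ n * t)) / (2 ^ n * t)" for n
  proof -
    have "d / t = (2 ^ n * d) / (2 ^ n * t)" by simp
    also have "\<dots> \<le> (ln (Y (2 ^ n * t)) - ln (X (2 ^ n * t))) / (2 ^ n * t)"
      using grow[of n] t by (intro divide_right_mono) auto
    finally show ?thesis by (simp add: diff_divide_distrib)
  qed
  ultimately have "d / t \<le> L - L" by (intro LIMSEQ_le_const) auto
  moreover have "0 < d / t" using d t by simp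
  ultimately show False by simp
qed

lemma nome_phi_real: "p \<in> \<real> \<Longrightarrow> nome_phi p \<in> \<real>"
  and nome_psi_real: "p \<in> \<real> \<Longrightarrow> nome_psi p \<in> \<real>"
  unfolding nome_phi_def nome_psi_def
  by (simp_all add: Reals_cnj_iff infsum_cnj[symmetric])

lemma theta_axis_real:
  fixes t :: real
  shows "theta2 (\<i> * of_real t) \<in> \<real>" "theta3 (\<i> * of_real t) \<in> \<real>" "theta4 (\<i> * of_real t) \<in> \<real>"
proof -
  have *: "of_real pi * \<i> * (\<i> * of_real t) = complex_of_real (- pi * t)" by (simp add: complex_eq_iff)
  then have n: "nome (\<i> * of_real t) \<in> \<real>" unfolding nome_def * exp_of_real by simp
  have "exp (of_real pi * \<i> * (\<i> * of_real t) / 4) = exp (complex_of_real (- pi * t / 4))" unfolding * by simp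
  then have "exp (of_real pi * \<i> * (\<i> * of_real t) / 4) \<in> \<real>" by (simp only: exp_of_real Reals_of_real)
  then show "theta2 (\<i> * of_real t) \<in> \<real>" "theta3 (\<i> * of_real t) \<in> \<real>" "theta4 (\<i> * of_real t) \<in> \<real>"
    using n by (auto simp: theta2_eq theta3_eq theta4_eq intro!: nome_phi_real nome_psi_real Reals_mult)
qed

text \<open>On the imaginary axis all theta constants are real, and so are these restrictions.\<close>

definition axis_modulus :: "real \<Rightarrow> real" where "axis_modulus t = Re (ell_modulus (\<i> * of_real t))"
definition axis_comodulus :: "real \<Rightarrow> real" where "axis_comodulus t = Re (ell_comodulus (\<i> * of_real t))"
definition axis_theta2 :: "real \<Rightarrow> real" where "axis_theta2 t = Re (theta2 (\<i> * of_real t))"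
definition axis_theta3 :: "real \<Rightarrow> real" where "axis_theta3 t = Re (theta3 (\<i> * of_real t))"

lemma axis_theta_eq: "theta2 (\<i> * of_real t) = of_real (axis_theta2 t)" "theta3 (\<i> * of_real t) = of_real (axis_theta3 t)"
  unfolding axis_theta2_def axis_theta3_def using theta_axis_real[of t] by (auto simp: complex_is_Real_iff complex_eq_iff)

lemma axis_modulus_eq:
  assumes "t > 0"
  shows "ell_modulus (\<i> * of_real t) = of_real (axis_modulus t)" "ell_comodulus (\<i> * of_real t) = of_real (axis_comodulus t)"
    "0 < axis_modulus t" "0 < axis_comodulus t"
proof -
  have I: "Im (\<i> * of_real t) > 0" using assms by simp
  obtain a b c where e: "theta2 (\<i> * of_real t) = of_real a" "theta3 (\<i> * of_real t) = of_real b" "theta4 (\<i> * of_real t) = of_real c"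
    using theta_axis_real[of t] by (metis Reals_cases)
  have nz: "a \<noteq> 0" "b \<noteq> 0" "c \<noteq> 0" using theta_nonzero[OF I] unfolding e by auto
  have x: "ell_modulus (\<i> * of_real t) = of_real (a\<^sup>2 / b\<^sup>2)" and r: "ell_comodulus (\<i> * of_real t) = of_real (c\<^sup>2 / b\<^sup>2)"
    unfolding ell_modulus_def ell_comodulus_def e by simp_all
  show "ell_modulus (\<i> * of_real t) = of_real (axis_modulus t)" "ell_comodulus (\<i> * of_real t) = of_real (axis_comodulus t)" "0 < axis_modulus t" "0 < axis_comodulus t"
    unfolding axis_modulus_def axis_comodulus_def x r using nz by simp_all
qed

lemma axis_modulus_landen:
  assumes t: "t > 0"
  shows "(axis_modulus t)\<^sup>2 + (axis_comodulus t)\<^sup>2 = 1" "axis_modulus (2 * t) = (1 - axis_comodulus t) / (1 + axis_comodulus t)"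
proof -
  have I: "Im (\<i> * of_real t) > 0" using t by simp
  have "complex_of_real ((axis_modulus t)\<^sup>2 + (axis_comodulus t)\<^sup>2) = 1"
    using ell_modulus_comodulus[OF I] unfolding axis_modulus_eq[OF t] by simp
  then show "(axis_modulus t)\<^sup>2 + (axis_comodulus t)\<^sup>2 = 1" by (simp only: of_real_eq_1_iff)
  have "ell_modulus (\<i> * of_real (2 * t)) = (1 - ell_comodulus (\<i> * of_real t)) / (1 + ell_comodulus (\<i> * of_real t))"
    using ell_modulus_double(2)[OF I] by (simp add: mult_ac)
  then have "complex_of_real (axis_modulus (2 * t)) = of_real ((1 - axis_comodulus t) / (1 + axis_comodulus t))"
    using axis_modulus_eq(1)[of "2 * t"] t unfolding axis_modulus_eq[OF t] by simp
  then show "axis_modulus (2 * t) = (1 - axis_comodulus t) / (1 + axis_comodulus t)" by (simp only: of_real_eq_iff)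
qed

lemma ln_axis_modulus_limit: "((\<lambda>t. ln (axis_modulus t) / t) \<longlongrightarrow> - pi / 2) at_top"
proof -
  define g where "g = (\<lambda>p. (nome_psi p / nome_phi p)\<^sup>2)"
  have s0: "((\<lambda>t. exp (- pi * t)) \<longlongrightarrow> 0) at_top" by real_asymp
  have g: "((\<lambda>t. g (of_real (exp (- pi * t)))) \<longlongrightarrow> 4) at_top"
  proof -
    have "isCont g 0" unfolding g_def using nome_phi_isCont[of 0] nome_psi_isCont[of 0]
      by (intro continuous_intros) auto
    moreover have "((\<lambda>t. of_real (exp (- pi * t))) \<longlongrightarrow> (0::complex)) at_top"
      using tendsto_of_real[OF s0] by simp
    ultimately have "((\<lambda>t. g (of_real (exp (- pi * t)))) \<longlongrightarrow> g 0) at_top"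
      by (rule isCont_tendsto_compose)
    then show ?thesis by (simp add: g_def)
  qed
  then have g': "((\<lambda>t. Re (g (of_real (exp (- pi * t))))) \<longlongrightarrow> 4) at_top"
    using tendsto_Re[OF g] by simp
  have eq: "axis_modulus t = exp (- pi * t / 2) * Re (g (of_real (exp (- pi * t))))" for t
  proof -
    have *: "of_real pi * \<i> * (\<i> * of_real t) = complex_of_real (- pi * t)" by (simp add: complex_eq_iff)
    have n: "nome (\<i> * of_real t) = of_real (exp (- pi * t))" unfolding nome_def * exp_of_real ..
    have "(exp (complex_of_real (- pi * t) / 4))\<^sup>2 = complex_of_real (exp (- pi * t / 2))"
      unfolding exp_of_nat_mult[symmetric] exp_of_real[symmetric] by simp
    then have "ell_modulus (\<i> * of_real t) = complex_of_real (exp (- pi * t / 2)) * g (of_real (exp (- pi * t)))"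
      unfolding ell_modulus_def theta2_eq theta3_eq n * by (simp add: power_mult_distrib g_def power_divide)
    then show ?thesis unfolding axis_modulus_def by simp
  qed
  have "((\<lambda>t. - pi / 2 + ln (Re (g (of_real (exp (- pi * t))))) / t) \<longlongrightarrow> - pi / 2 + 0) at_top"
  proof (intro tendsto_intros real_tendsto_divide_at_top filterlim_ident)
    show "((\<lambda>t. ln (Re (g (of_real (exp (- pi * t)))))) \<longlongrightarrow> ln 4) at_top"
      by (intro tendsto_intros g') simp
  qed
  then have "((\<lambda>t. - pi / 2 + ln (Re (g (of_real (exp (- pi * t))))) / t) \<longlongrightarrow> - pi / 2) at_top" by simp
  then show ?thesis
  proof (rule Lim_transform_eventually)
    show "\<forall>\<^sub>F t in at_top. - pi / 2 + ln (Re (g (of_real (exp (- pi * t))))) / t = ln (axis_modulus t) / t"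
      using eventually_gt_at_top[of 0]
    proof eventually_elim
      case (elim t)
      have "0 < Re (g (of_real (exp (- pi * t))))" using axis_modulus_eq(3)[OF elim] unfolding eq by (simp add: zero_less_mult_iff)
      then have l: "ln (axis_modulus t) = - pi * t / 2 + ln (Re (g (of_real (exp (- pi * t)))))" unfolding eq by (simp add: ln_mult)
      show ?case unfolding l using elim by (simp add: field_simps)
    qed
  qed
qed

lemma axis_comodulus_has_deriv:
  assumes t: "t > 0"
  shows "(axis_comodulus has_real_derivative (pi / 2 * axis_theta2 t ^ 4 * axis_comodulus t)) (at t)"
proof -
  have I: "Im (\<i> * of_real t) > 0" using t by simp
  have d: "((\<lambda>t::real. \<i> * of_real t) has_vector_derivative \<i>) (at t)"
    by (auto intro!: derivative_eq_intros)
  have "((ell_comodulus \<circ> (\<lambda>t::real. \<i> * of_real t)) has_vector_derivative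
     \<i> * (- (of_real pi * \<i> / 2 * theta2 (\<i> * of_real t) ^ 4 * ell_comodulus (\<i> * of_real t)))) (at t)"
    by (rule field_vector_diff_chain_at[OF d ell_comodulus_has_deriv[OF I]])
  also have "\<i> * (- (of_real pi * \<i> / 2 * theta2 (\<i> * of_real t) ^ 4 * ell_comodulus (\<i> * of_real t))) = of_real (pi / 2 * axis_theta2 t ^ 4 * axis_comodulus t)"
    unfolding axis_theta_eq axis_modulus_eq[OF t] by (simp add: mult_ac)
  finally have "((\<lambda>t. Re (ell_comodulus (\<i> * of_real t))) has_vector_derivative Re (of_real (pi / 2 * axis_theta2 t ^ 4 * axis_comodulus t))) (at t)"
    using bounded_linear.has_vector_derivative[OF bounded_linear_Re] by (fastforce simp: o_def)
  then show ?thesis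
    by (simp add: has_real_derivative_iff_has_vector_derivative axis_comodulus_def[abs_def])
qed

text \<open>The duplication formulas express the square of the second theta constant as the difference of the
  squares of the third one at \<open>T / 2\<close> and at \<open>T\<close>, so its limit is \<open>2 - 1\<close>.\<close>

lemma axis_theta2_cusp_limit: "((\<lambda>t. (axis_theta2 (1 / t))\<^sup>2 / t) \<longlongrightarrow> 1) at_top"
proof -
  have f: "((\<lambda>\<epsilon>. \<epsilon> * (axis_theta3 \<epsilon>)\<^sup>2) \<longlongrightarrow> 1) (at_right 0)"
    unfolding axis_theta3_def by (rule theta3_cusp_limit)
  have 1: "((\<lambda>t. (1 / t) * (axis_theta3 (1 / t))\<^sup>2) \<longlongrightarrow> 1) at_top"
    by (rule filterlim_compose[OF f]) real_asymp
  have 2: "((\<lambda>t. (1 / (2 * t)) * (axis_theta3 (1 / (2 * t)))\<^sup>2) \<longlongrightarrow> 1) at_top"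
    by (rule filterlim_compose[OF f]) real_asymp
  have "((\<lambda>t. 2 * ((1 / (2 * t)) * (axis_theta3 (1 / (2 * t)))\<^sup>2) - (1 / t) * (axis_theta3 (1 / t))\<^sup>2) \<longlongrightarrow> 2 * 1 - 1) at_top"
    by (intro tendsto_intros 1 2)
  then have "((\<lambda>t. 2 * ((1 / (2 * t)) * (axis_theta3 (1 / (2 * t)))\<^sup>2) - (1 / t) * (axis_theta3 (1 / t))\<^sup>2) \<longlongrightarrow> 1) at_top" by simp
  then show ?thesis
  proof (rule Lim_transform_eventually)
    show "\<forall>\<^sub>F t in at_top. 2 * ((1 / (2 * t)) * (axis_theta3 (1 / (2 * t)))\<^sup>2) - (1 / t) * (axis_theta3 (1 / t))\<^sup>2 = (axis_theta2 (1 / t))\<^sup>2 / t"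
      using eventually_gt_at_top[of 0]
    proof eventually_elim
      case (elim t)
      let ?T = "\<i> * of_real (1 / (2 * t))"
      have I: "Im ?T > 0" using elim by simp
      have dbl: "2 * ?T = \<i> * of_real (1 / t)" by simp
      have "2 * ((theta2 (2 * ?T))\<^sup>2 + (theta3 (2 * ?T))\<^sup>2) = 2 * (theta3 ?T)\<^sup>2"
        unfolding distrib_left theta_double[OF I] by simp
      then have "(theta2 (2 * ?T))\<^sup>2 + (theta3 (2 * ?T))\<^sup>2 = (theta3 ?T)\<^sup>2"
        by (simp only: mult_cancel_left) simp
      then have "complex_of_real ((axis_theta2 (1 / t))\<^sup>2 + (axis_theta3 (1 / t))\<^sup>2) = of_real ((axis_theta3 (1 / (2 * t)))\<^sup>2)"
        unfolding dbl axis_theta_eq by simp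
      then have "(axis_theta2 (1 / t))\<^sup>2 + (axis_theta3 (1 / t))\<^sup>2 = (axis_theta3 (1 / (2 * t)))\<^sup>2" by (simp only: of_real_eq_iff)
      then show ?case using elim by (simp add: field_simps)
    qed
  qed
qed

text \<open>The logarithm is only known through its derivative, which converges to \<open>- \<pi> / 2\<close>; l'Hospital's rule
  transfers this to the quotient by \<open>t\<close>.\<close>

lemma ln_axis_comodulus_limit: "((\<lambda>t. ln (axis_comodulus (1 / t)) / t) \<longlongrightarrow> - pi / 2) at_top"
proof (rule lhospital_at_top_at_top[where f' = "\<lambda>t. - (pi / 2) * ((axis_theta2 (1 / t))\<^sup>2 / t)\<^sup>2" and g' = "\<lambda>_. 1"])
  show "\<forall>\<^sub>F t in at_top. ((\<lambda>t. ln (axis_comodulus (1 / t))) has_real_derivative - (pi / 2) * ((axis_theta2 (1 / t))\<^sup>2 / t)\<^sup>2) (at t)"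
    using eventually_gt_at_top[of 0]
  proof eventually_elim
    case (elim t)
    have "((\<lambda>t. 1 / t) has_real_derivative - (1 / t\<^sup>2)) (at t)"
      using elim by (auto intro!: derivative_eq_intros simp: power2_eq_square)
    from DERIV_chain2[OF axis_comodulus_has_deriv[of "1 / t"] this]
    have d: "((\<lambda>t. axis_comodulus (1 / t)) has_real_derivative (pi / 2 * axis_theta2 (1 / t) ^ 4 * axis_comodulus (1 / t)) * - (1 / t\<^sup>2)) (at t)"
      using elim by simp
    have p: "0 < axis_comodulus (1 / t)" using axis_modulus_eq(4)[of "1 / t"] elim by simp
    show ?case
      by (rule DERIV_cong[OF DERIV_chain2[OF DERIV_ln_divide[OF p] d]])
         (use p elim in \<open>simp add: field_simps power_mult[symmetric]\<close>)
  qed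
  have "((\<lambda>t. - (pi / 2) * ((axis_theta2 (1 / t))\<^sup>2 / t)\<^sup>2 / 1) \<longlongrightarrow> - (pi / 2) * 1\<^sup>2 / 1) at_top"
    by (intro tendsto_intros axis_theta2_cusp_limit) simp
  then show "((\<lambda>t. - (pi / 2) * ((axis_theta2 (1 / t))\<^sup>2 / t)\<^sup>2 / 1) \<longlongrightarrow> - pi / 2) at_top" by simp
qed (auto intro: filterlim_ident)

text \<open>The Landen map is an involution up to exchanging modulus and comodulus, so \<open>t \<mapsto> 1 / t\<close> turns one
  Landen orbit into another one.\<close>

lemma axis_comodulus_inverse:
  assumes t: "t > 0"
  shows "axis_comodulus (1 / t) = axis_modulus t"
proof -
  have A: "0 < axis_modulus t \<and> 0 < axis_comodulus t \<and> (axis_modulus t)\<^sup>2 + (axis_comodulus t)\<^sup>2 = 1 \<and> axis_modulus (2 * t) = (1 - axis_comodulus t) / (1 + axis_comodulus t)"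
    if "t > 0" for t using axis_modulus_eq[OF that] axis_modulus_landen[OF that] by auto
  have B: "0 < axis_comodulus (1 / t) \<and> 0 < axis_modulus (1 / t) \<and> (axis_comodulus (1 / t))\<^sup>2 + (axis_modulus (1 / t))\<^sup>2 = 1 \<and>
     axis_comodulus (1 / (2 * t)) = (1 - axis_modulus (1 / t)) / (1 + axis_modulus (1 / t))" if t: "t > 0" for t
  proof -
    have t1: "1 / t > 0" "1 / (2 * t) > 0" using t by auto
    have "axis_modulus (1 / t) = (1 - axis_comodulus (1 / (2 * t))) / (1 + axis_comodulus (1 / (2 * t)))"
      using axis_modulus_landen(2)[OF t1(2)] by simp
    then have "axis_comodulus (1 / (2 * t)) = (1 - axis_modulus (1 / t)) / (1 + axis_modulus (1 / t))"
      using axis_modulus_eq(4)[OF t1(2)] axis_modulus_eq(3)[OF t1(1)] by (subst eq_divide_eq, simp) (simp add: field_simps)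
    then show ?thesis using axis_modulus_eq[OF t1(1)] axis_modulus_landen(1)[OF t1(1)] by auto
  qed
  show ?thesis
  proof (rule antisym)
    show "axis_comodulus (1 / t) \<le> axis_modulus t"
      by (rule landen_orbit_le[of axis_modulus axis_comodulus "\<lambda>t. axis_comodulus (1 / t)" "\<lambda>t. axis_modulus (1 / t)", OF A B ln_axis_modulus_limit ln_axis_comodulus_limit t])
    show "axis_modulus t \<le> axis_comodulus (1 / t)"
      by (rule landen_orbit_le[of "\<lambda>t. axis_comodulus (1 / t)" "\<lambda>t. axis_modulus (1 / t)" axis_modulus axis_comodulus, OF B A ln_axis_comodulus_limit ln_axis_modulus_limit t])
  qed
qed

section \<open>Inversion\<close>

lemma Im_inversion: "Im T > 0 \<Longrightarrow> Im (- 1 / T) = Im T / (cmod T)\<^sup>2" "Im T > 0 \<Longrightarrow> Im (- 1 / T) > 0"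
proof -
  assume T: "Im T > 0"
  show 1: "Im (- 1 / T) = Im T / (cmod T)\<^sup>2" by (simp add: Im_divide cmod_power2)
  have "T \<noteq> 0" using T by auto
  then show "Im (- 1 / T) > 0" unfolding 1 using T by simp
qed

abbreviation upper :: "complex set" where "upper \<equiv> {T. Im T > 0}"

lemma ell_comodulus_inversion:
  assumes T: "Im T > 0"
  shows "ell_comodulus (- 1 / T) = ell_modulus T"
proof -
  have hol: "ell_comodulus holomorphic_on upper" "ell_modulus holomorphic_on upper"
    using ell_comodulus_has_deriv ell_modulus_has_deriv by (auto simp: holomorphic_on_open open_halfspace_Im_gt)
  have h1: "(\<lambda>T. ell_comodulus (- 1 / T)) holomorphic_on upper"
  proof -
    have "(\<lambda>T. - 1 / T) holomorphic_on upper" by (intro holomorphic_intros) auto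
    moreover have "(\<lambda>T. - 1 / T) ` upper \<subseteq> upper" using Im_inversion(2) by blast
    ultimately show ?thesis using holomorphic_on_compose_gen[OF _ hol(1)] unfolding o_def by blast
  qed
  have "ell_comodulus (- 1 / T) - ell_modulus T = 0"
  proof (rule analytic_continuation[of "\<lambda>T. ell_comodulus (- 1 / T) - ell_modulus T" upper "(\<lambda>t. \<i> * of_real t) ` {0<..}" \<i>])
    show "(\<lambda>T. ell_comodulus (- 1 / T) - ell_modulus T) holomorphic_on upper" by (intro holomorphic_intros h1 hol)
    show "open upper" by (rule open_halfspace_Im_gt)
    show "connected upper" by (intro convex_connected convex_halfspace_Im_gt)
    show "\<i> islimpt (\<lambda>t. \<i> * of_real t) ` {0<..}"
    proof (unfold islimpt_approachable, intro allI impI)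
      fix e :: real assume "e > 0"
      then show "\<exists>x'\<in>(\<lambda>t. \<i> * of_real t) ` {0<..}. x' \<noteq> \<i> \<and> dist x' \<i> < e"
        by (intro bexI[of _ "\<i> * of_real (1 + e / 2)"])
           (auto simp: dist_norm algebra_simps norm_mult norm_divide complex_eq_iff intro!: imageI)
    qed
    fix z assume "z \<in> (\<lambda>t. \<i> * of_real t) ` {0<..}"
    then obtain t where t: "t > 0" "z = \<i> * of_real t" by auto
    have e: "- 1 / z = \<i> * of_real (1 / t)" using t by (simp add: field_simps)
    show "ell_comodulus (- 1 / z) - ell_modulus z = 0"
      unfolding e unfolding t(2) using axis_modulus_eq(2)[of "1 / t"] axis_modulus_eq(1)[of t] axis_comodulus_inverse[of t] t by simp
  qed (use T in auto)
  then show ?thesis by simp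
qed

text \<open>Differentiating \<open>ell_comodulus_inversion\<close> compares the two logarithmic derivatives, which are multiples
  of fourth powers of theta constants.\<close>

lemma theta2_inversion:
  assumes T: "Im T > 0"
  shows "theta2 (- 1 / T) ^ 4 = - (T\<^sup>2) * theta4 T ^ 4"
proof -
  have T': "Im (- 1 / T) > 0" by (rule Im_inversion(2)[OF T])
  have T0: "T \<noteq> 0" using T by auto
  have "((\<lambda>T. - 1 / T) has_field_derivative (1 / T\<^sup>2)) (at T)"
    using T0 by (auto intro!: derivative_eq_intros simp: power2_eq_square)
  from DERIV_chain2[OF ell_comodulus_has_deriv[OF T'] this]
  have "((\<lambda>T. ell_comodulus (- 1 / T)) has_field_derivative
      - (of_real pi * \<i> / 2 * theta2 (- 1 / T) ^ 4 * ell_comodulus (- 1 / T)) * (1 / T\<^sup>2)) (at T)" .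
  then have "(ell_modulus has_field_derivative
      - (of_real pi * \<i> / 2 * theta2 (- 1 / T) ^ 4 * ell_comodulus (- 1 / T)) * (1 / T\<^sup>2)) (at T)"
    by (rule has_field_derivative_transform_within_open[where S = upper])
       (use T ell_comodulus_inversion in \<open>auto simp: open_halfspace_Im_gt\<close>)
  from DERIV_unique[OF this ell_modulus_has_deriv[OF T]]
  have "- (of_real pi * \<i> / 2 * theta2 (- 1 / T) ^ 4 * ell_modulus T) * (1 / T\<^sup>2) = of_real pi * \<i> / 2 * theta4 T ^ 4 * ell_modulus T"
    unfolding ell_comodulus_inversion[OF T] .
  then have "(of_real pi * \<i> * ell_modulus T) * theta2 (- 1 / T) ^ 4 = (of_real pi * \<i> * ell_modulus T) * (- (T\<^sup>2) * theta4 T ^ 4)"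
    using T0 by (simp add: field_simps) (metis minus_equation_iff)
  moreover have "of_real pi * \<i> * ell_modulus T \<noteq> 0" using theta_nonzero[OF T] by (simp add: ell_modulus_def)
  ultimately show ?thesis by (simp only: mult_cancel_left) simp
qed

lemma theta4_inversion:
  assumes T: "Im T > 0"
  shows "theta4 (- 1 / T) ^ 4 = - (T\<^sup>2) * theta2 T ^ 4"
proof -
  have T': "Im (- 1 / T) > 0" by (rule Im_inversion(2)[OF T])
  have T0: "T \<noteq> 0" using T by auto
  have "- 1 / (- 1 / T) = T" using T0 by simp
  then show ?thesis using theta2_inversion[OF T'] T0 by (simp add: field_simps)
qed

lemma theta3_inversion:
  assumes T: "Im T > 0"
  shows "theta3 (- 1 / T) ^ 4 = - (T\<^sup>2) * theta3 T ^ 4"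
  unfolding jacobi_quartic[OF T, symmetric] jacobi_quartic[OF Im_inversion(2)[OF T], symmetric]
    theta2_inversion[OF T] theta4_inversion[OF T] by (simp add: algebra_simps)

section \<open>Modular invariants\<close>

text \<open>After an integer shift \<open>T\<close> lies over \<open>[- 1/2, 1/2]\<close>; as long as its imaginary part is below \<open>1 / 2\<close>,
  the inversion at least doubles it.\<close>

lemma modular_reduction:
  fixes f :: "complex \<Rightarrow> 'a"
  assumes shift: "\<And>T. Im T > 0 \<Longrightarrow> f (T + 1) = f T" and inv: "\<And>T. Im T > 0 \<Longrightarrow> f (- 1 / T) = f T"
    and T: "Im T > 0"
  obtains T' where "1 / 2 \<le> Im T'" "\<bar>Re T'\<bar> \<le> 1 / 2" "f T' = f T"
proof -
  have shift_nat: "f (T + of_nat m) = f T" if "Im T > 0" for T m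
  proof (induction m)
    case (Suc m)
    then show ?case using shift[of "T + of_nat m"] that by (simp add: add_ac)
  qed simp
  have shift_int: "f (T + of_int m) = f T" if "Im T > 0" for T m
  proof (cases "m \<ge> 0")
    case True
    then show ?thesis using shift_nat[OF that, of "nat m"] by simp
  next
    case False
    then show ?thesis using shift_nat[of "T + of_int m" "nat (- m)"] that by simp
  qed
  have "\<exists>T'. 1 / 2 \<le> Im T' \<and> \<bar>Re T'\<bar> \<le> 1 / 2 \<and> f T' = f T" if "(1 / 2) ^ Suc n \<le> Im T" for n T
    using that
  proof (induction n arbitrary: T)
    case 0
    then have I: "Im T > 0" by simp
    have "\<bar>Re T + of_int (- round (Re T))\<bar> \<le> 1 / 2"
      using of_int_round_abs_le[of "Re T"] by (simp add: abs_minus_commute)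
    then show ?case using 0 shift_int[OF I, of "- round (Re T)"]
      by (intro exI[of _ "T + of_int (- round (Re T))"]) simp
  next
    case (Suc n)
    have I: "Im T > 0" using Suc.prems by (rule less_le_trans[rotated]) simp
    \<comment> \<open>Below \<open>1 / 2\<close> both coordinates are small, so \<open>cmod S\<close> is at most
      \<open>sqrt (1 / 2)\<close>.\<close>
    define S where "S = T + of_int (- round (Re T))"
    have S: "Im S = Im T" "\<bar>Re S\<bar> \<le> 1 / 2" "f S = f T"
      using of_int_round_abs_le[of "Re T"] shift_int[OF I, of "- round (Re T)"]
      by (auto simp: S_def abs_minus_commute)
    show ?case
    proof (cases "1 / 2 \<le> Im T")
      case True
      then show ?thesis using S by (intro exI[of _ S]) auto
    next
      case False
      have "(cmod S)\<^sup>2 = (Re S)\<^sup>2 + (Im S)\<^sup>2" by (rule cmod_power2)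
      also have "\<dots> \<le> (1 / 2)\<^sup>2 + (1 / 2)\<^sup>2"
        by (intro add_mono abs_le_square_iff[THEN iffD1]) (use S False I in auto)
      finally have c: "(cmod S)\<^sup>2 \<le> 1 / 2" by (simp add: power2_eq_square)
      have IS: "Im S > 0" using I S by simp
      have "0 < (cmod S)\<^sup>2" using IS by auto
      then have "2 * Im S \<le> Im S / (cmod S)\<^sup>2" using c IS by (simp add: field_simps)
      then have "2 * Im T \<le> Im (- 1 / S)" unfolding Im_inversion(1)[OF IS] S(1) by simp
      then have "(1 / 2) ^ Suc n \<le> Im (- 1 / S)" using Suc.prems by simp
      from Suc.IH[OF this] show ?thesis using inv[OF IS] S(3) by simp
    qed
  qed
  moreover obtain n where "(1 / 2) ^ n < Im T" using real_arch_pow_inv[OF T, of "1/2"] by auto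
  then have "(1 / 2) ^ Suc n \<le> Im T" using power_decreasing[of n "Suc n" "1/2 :: real"] by linarith
  ultimately show thesis using that by blast
qed

text \<open>The fourth powers of the theta constants are forms of weight 2 that the modular group permutes up to
  sign, and the imaginary part compensates the weight.\<close>

definition theta_height :: "complex \<Rightarrow> real" where
  "theta_height T = Im T * Max {cmod (theta2 T ^ 4), cmod (theta3 T ^ 4), cmod (theta4 T ^ 4)}"

lemma theta_height_invariant:
  assumes T: "Im T > 0"
  shows "theta_height (T + 1) = theta_height T" "theta_height (- 1 / T) = theta_height T"
proof -
  have "theta2 (T + 1) ^ 4 = - (theta2 T ^ 4)"
    using arg_cong[OF theta2_shift_sq[of T], of "\<lambda>x. x\<^sup>2"] by (simp add: power_mult_distrib power_mult[symmetric])
  then show "theta_height (T + 1) = theta_height T"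
    unfolding theta_height_def theta3_shift theta4_shift by (simp add: insert_commute norm_power max.commute max.left_commute)
  have "0 < (cmod T)\<^sup>2" using T by auto
  then show "theta_height (- 1 / T) = theta_height T"
    unfolding theta_height_def theta2_inversion[OF T] theta3_inversion[OF T] theta4_inversion[OF T] Im_inversion(1)[OF T]
  proof -
    have "max (c * x) (max (c * y) (c * z)) = c * max z (max y x)" if "0 \<le> c" for c x y z :: real
      using that by (simp add: max_mult_distrib_left max.commute max.left_commute)
    then show "Im T / (cmod T)\<^sup>2 * Max {cmod (- (T\<^sup>2) * theta4 T ^ 4), cmod (- (T\<^sup>2) * theta3 T ^ 4), cmod (- (T\<^sup>2) * theta2 T ^ 4)} =
        Im T * Max {cmod (theta2 T ^ 4), cmod (theta3 T ^ 4), cmod (theta4 T ^ 4)}"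
      using \<open>0 < (cmod T)\<^sup>2\<close> by (simp add: norm_mult norm_power)
  qed
qed

text \<open>By reduction it suffices to consider imaginary parts of at least \<open>1 / 2\<close>, where the terms after the
  leading \<open>1\<close> are too small to cancel it in the series of the third theta constant.\<close>

lemma theta_height_lower_bound:
  obtains q where "q > 0" "\<And>T. Im T > 0 \<Longrightarrow> q \<le> theta_height T"
proof -
  have low: "(1 / 2) * (3 / 13) ^ 4 \<le> theta_height T" if T: "1 / 2 \<le> Im T" for T
  proof -
    let ?p = "nome T"
    \<comment> \<open>Any bound above \<open>3\<close> keeps \<open>2 * cmod p / (1 - cmod p)\<close> below
      \<open>1\<close>; three terms of the exponential series suffice.\<close>
    have "18 / 5 \<le> exp (pi / 2)"
    proof -
      have "(3 / 2 :: real) \<le> pi / 2" using pi_gt3 by simp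
      then have "1 + 3 / 2 + (3 / 2)\<^sup>2 / 2 \<le> 1 + pi / 2 + (pi / 2)\<^sup>2 / 2"
        by (intro add_mono divide_right_mono power_mono) auto
      also have "\<dots> \<le> exp (pi / 2)" by (rule exp_lower_Taylor_quadratic) simp
      finally show ?thesis by (simp add: power2_eq_square)
    qed
    moreover have "exp (pi / 2) \<le> exp (pi * Im T)" using T by simp
    ultimately have "18 / 5 \<le> exp (pi * Im T)" by linarith
    then have p: "cmod ?p \<le> 5 / 18" by (simp add: cmod_nome exp_minus field_simps)
    then have p1: "cmod ?p < 1" by simp
    have sm: "summable (\<lambda>n. cmod ?p ^ (n + 1))" using p1 summable_geometric[of "cmod ?p"] by (simp add: summable_mult)
    have le: "norm (?p ^ ((n + 1)\<^sup>2)) \<le> cmod ?p ^ (n + 1)" for n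
      unfolding norm_power using p1 by (intro power_decreasing) (auto simp: power2_eq_square)
    have "cmod (\<Sum>n. ?p ^ ((n+1)\<^sup>2)) \<le> (\<Sum>n. cmod ?p ^ (n + 1))"
      by (rule norm_suminf_le[OF le sm])
    also have "\<dots> = cmod ?p / (1 - cmod ?p)"
    proof -
      have "(\<Sum>n. cmod ?p ^ (n + 1)) = cmod ?p * (\<Sum>n. cmod ?p ^ n)"
        using suminf_mult[of "\<lambda>n. cmod ?p ^ n" "cmod ?p"] p1 by (simp add: summable_geometric)
      then show ?thesis using suminf_geometric[of "cmod ?p"] p1 by simp
    qed
    also have "\<dots> \<le> (5 / 18) / (1 - 5 / 18)" using p by (intro frac_le) auto
    finally have s: "cmod (\<Sum>n. ?p ^ ((n+1)\<^sup>2)) \<le> 5 / 13" by simp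
    have "theta3 T = 1 + 2 * (\<Sum>n. ?p ^ ((n+1)\<^sup>2))" unfolding theta3_eq by (rule nome_phi_eq[OF p1])
    then have "1 - 2 * cmod (\<Sum>n. ?p ^ ((n+1)\<^sup>2)) \<le> cmod (theta3 T)"
      using norm_triangle_ineq2[of 1 "- (2 * (\<Sum>n. ?p ^ ((n+1)\<^sup>2)))"] by (simp add: norm_mult)
    then have "3 / 13 \<le> cmod (theta3 T)" using s by linarith
    then have "(3 / 13) ^ 4 \<le> cmod (theta3 T ^ 4)" unfolding norm_power by (intro power_mono) auto
    also have "\<dots> \<le> Max {cmod (theta2 T ^ 4), cmod (theta3 T ^ 4), cmod (theta4 T ^ 4)}" by (rule Max_ge) auto
    finally show ?thesis unfolding theta_height_def using T by (intro mult_mono) auto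
  qed
  show thesis
  proof (rule that[of "(1 / 2) * (3 / 13) ^ 4"])
    fix T assume "Im T > 0"
    then obtain T' where "1 / 2 \<le> Im T'" "\<bar>Re T'\<bar> \<le> 1 / 2" "theta_height T' = theta_height T"
      using modular_reduction[of theta_height] theta_height_invariant by blast
    then show "(1 / 2) * (3 / 13) ^ 4 \<le> theta_height T" using low by metis
  qed simp
qed

text \<open>One minus the modular function \<open>\<lambda>\<close>.\<close>

definition comodulus_sq :: "complex \<Rightarrow> complex" where "comodulus_sq T = (ell_comodulus T)\<^sup>2"

lemma comodulus_sq_shift: "Im T > 0 \<Longrightarrow> comodulus_sq (T + 1) = 1 / comodulus_sq T"
  by (simp add: comodulus_sq_def ell_comodulus_def theta3_shift theta4_shift power_divide)

lemma comodulus_sq_inversion: "Im T > 0 \<Longrightarrow> comodulus_sq (- 1 / T) = 1 - comodulus_sq T"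
  unfolding comodulus_sq_def ell_comodulus_inversion using ell_modulus_comodulus[of T] by (simp add: algebra_simps)

lemma comodulus_sq_not_0_1:
  assumes "Im T > 0"
  shows "comodulus_sq T \<noteq> 0" "comodulus_sq T \<noteq> 1"
proof -
  show "comodulus_sq T \<noteq> 0" using theta_nonzero[OF assms] by (simp add: comodulus_sq_def ell_comodulus_def)
  have "(ell_modulus T)\<^sup>2 \<noteq> 0" using theta_nonzero[OF assms] by (simp add: ell_modulus_def)
  then show "comodulus_sq T \<noteq> 1" using ell_modulus_comodulus[OF assms] by (auto simp: comodulus_sq_def)
qed

text \<open>The six roots are the orbit of \<open>w\<close> under the group generated by \<open>w \<mapsto> 1 / w\<close> and \<open>w \<mapsto> 1 - w\<close>; the
  identity expresses that \<open>(k\<^sup>2 - k + 1) ^ 3 / (k\<^sup>2 (1 - k)\<^sup>2)\<close> separates these orbits.\<close>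

lemma sixfold_product:
  fixes k w :: complex
  shows "(k\<^sup>2 - k + 1) ^ 3 * (w\<^sup>2 * (1 - w)\<^sup>2) - (w\<^sup>2 - w + 1) ^ 3 * (k\<^sup>2 * (1 - k)\<^sup>2) =
     - ((k - w) * (w * k - 1) * (k - 1 + w) * ((1 - w) * k - 1) * (w * k - w + 1) * ((w - 1) * k - w))"
  by algebra

text \<open>If \<open>w\<close> is omitted then so is its whole orbit, because the modular group acts on the values through
  \<open>w \<mapsto> 1 / w\<close> and \<open>w \<mapsto> 1 - w\<close>.\<close>

lemma comodulus_sq_orbit:
  assumes "\<And>T. Im T > 0 \<Longrightarrow> comodulus_sq T \<noteq> w" "w \<noteq> 0" "w \<noteq> 1" "Im T > 0"
  shows "(comodulus_sq T - w) * (w * comodulus_sq T - 1) * (comodulus_sq T - 1 + w) * ((1 - w) * comodulus_sq T - 1) * (w * comodulus_sq T - w + 1) * ((w - 1) * comodulus_sq T - w) \<noteq> 0"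
proof -
  define k where "k = comodulus_sq T"
  have k: "k \<noteq> 0" "k \<noteq> 1" using comodulus_sq_not_0_1[OF assms(4)] by (auto simp: k_def)
  have sh: "Im (S + 1) > 0" if "Im S > 0" for S using that by simp
  note iv = Im_inversion(2)
  have T: "Im T > 0" by fact
  have v1: "k \<noteq> w" using assms(1)[OF T] by (simp add: k_def)
  have v2: "1 / k \<noteq> w" using assms(1)[OF sh[OF T]] unfolding comodulus_sq_shift[OF T] k_def .
  have v3: "1 - k \<noteq> w" using assms(1)[OF iv[OF T]] unfolding comodulus_sq_inversion[OF T] k_def .
  have v4: "1 - 1 / k \<noteq> w"
    using assms(1)[OF iv[OF sh[OF T]]] unfolding comodulus_sq_inversion[OF sh[OF T]] comodulus_sq_shift[OF T] k_def .
  have v5: "1 / (1 - k) \<noteq> w"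
    using assms(1)[OF sh[OF iv[OF T]]] unfolding comodulus_sq_shift[OF iv[OF T]] comodulus_sq_inversion[OF T] k_def .
  have v6: "1 - 1 / (1 - k) \<noteq> w"
    using assms(1)[OF iv[OF sh[OF iv[OF T]]]]
    unfolding comodulus_sq_inversion[OF sh[OF iv[OF T]]] comodulus_sq_shift[OF iv[OF T]] comodulus_sq_inversion[OF T] k_def .
  have "1 - k \<noteq> 0" using k by simp
  have "k - w \<noteq> 0" "w * k - 1 \<noteq> 0" "k - 1 + w \<noteq> 0"
    using v1 v2 v3 k by (auto simp: field_simps)
  moreover have "(1 - w) * k - 1 \<noteq> 0" using v4 k by (auto simp: field_simps)
  moreover have "w * k - w + 1 \<noteq> 0"
  proof
    assume "w * k - w + 1 = 0"
    then have "w * (1 - k) = 1" by (simp add: algebra_simps)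
    then show False using v5 \<open>1 - k \<noteq> 0\<close> by (simp add: field_simps)
  qed
  moreover have "(w - 1) * k - w \<noteq> 0"
  proof
    assume "(w - 1) * k - w = 0"
    then have "w * (1 - k) = (1 - k) - 1" by (simp add: algebra_simps)
    then show False using v6 \<open>1 - k \<noteq> 0\<close> by (simp add: field_simps)
  qed
  ultimately show ?thesis unfolding k_def by simp
qed

text \<open>If \<open>w\<close> were omitted, the invariant of \<open>sixfold_product\<close> would omit a value, and \<open>g\<close>, the reciprocal of
  its difference to that value, would be holomorphic, invariant under the modular group and zero at the
  cusp only. Then its modulus has a maximum on the half-plane, so \<open>g\<close> is constant; but it is not zero
  and tends to zero at the cusp.\<close>

lemma comodulus_sq_surj:
  assumes w: "w \<noteq> 0" "w \<noteq> 1"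
  obtains T where "Im T > 0" "comodulus_sq T = w"
proof (rule ccontr)
  assume "\<not> thesis"
  then have ne: "\<And>T. Im T > 0 \<Longrightarrow> comodulus_sq T \<noteq> w" using that by blast
  \<comment> \<open>The reciprocal of the invariant minus its value at \<open>w\<close>, cleared of denominators.\<close>
  define h where "h = (\<lambda>k. k\<^sup>2 * (1 - k)\<^sup>2 / ((k\<^sup>2 - k + 1) ^ 3 * (w\<^sup>2 * (1 - w)\<^sup>2) - (w\<^sup>2 - w + 1) ^ 3 * (k\<^sup>2 * (1 - k)\<^sup>2)))"
  define g where "g = (\<lambda>T. h (comodulus_sq T))"
  have den: "((comodulus_sq T)\<^sup>2 - comodulus_sq T + 1) ^ 3 * (w\<^sup>2 * (1 - w)\<^sup>2) - (w\<^sup>2 - w + 1) ^ 3 * ((comodulus_sq T)\<^sup>2 * (1 - comodulus_sq T)\<^sup>2) \<noteq> 0"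
    if "Im T > 0" for T
    unfolding sixfold_product neg_equal_0_iff_equal by (rule comodulus_sq_orbit[OF ne w that])
  have comodulus_sq_hol: "comodulus_sq holomorphic_on upper"
  proof -
    have "ell_comodulus holomorphic_on upper"
      using ell_comodulus_has_deriv by (auto simp: holomorphic_on_open open_halfspace_Im_gt)
    then show ?thesis unfolding comodulus_sq_def[abs_def] by (intro holomorphic_intros)
  qed
  have g_hol: "g holomorphic_on upper"
    unfolding g_def h_def using den by (intro holomorphic_intros comodulus_sq_hol) auto
  have inv1: "g (T + 1) = g T" and inv2: "g (- 1 / T) = g T" if T: "Im T > 0" for T
  proof -
    have k: "comodulus_sq T \<noteq> 0" using comodulus_sq_not_0_1[OF T] by simp
    have "h (1 / k) = h k" if "k \<noteq> 0" for k
    proof -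
      have n: "(1 / k)\<^sup>2 * (1 - 1 / k)\<^sup>2 = (k\<^sup>2 * (1 - k)\<^sup>2) / k ^ 6"
        using that by (simp add: divide_simps) algebra
      have d: "((1 / k)\<^sup>2 - 1 / k + 1) ^ 3 = (k\<^sup>2 - k + 1) ^ 3 / k ^ 6"
      proof -
        have "(1 / k)\<^sup>2 - 1 / k + 1 = (k\<^sup>2 - k + 1) / k\<^sup>2" using that by (simp add: divide_simps) algebra
        then show ?thesis by (simp add: power_divide power_mult[symmetric])
      qed
      have e: "(k\<^sup>2 - k + 1) ^ 3 / k ^ 6 * (w\<^sup>2 * (1 - w)\<^sup>2) - (w\<^sup>2 - w + 1) ^ 3 * ((k\<^sup>2 * (1 - k)\<^sup>2) / k ^ 6) =
        ((k\<^sup>2 - k + 1) ^ 3 * (w\<^sup>2 * (1 - w)\<^sup>2) - (w\<^sup>2 - w + 1) ^ 3 * (k\<^sup>2 * (1 - k)\<^sup>2)) / k ^ 6"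
        by (simp add: diff_divide_distrib)
      show ?thesis unfolding h_def n d e using that by simp
    qed
    then show "g (T + 1) = g T" unfolding g_def comodulus_sq_shift[OF T] using k by simp
    have "h (1 - k) = h k" for k
    proof -
      have "(1 - k)\<^sup>2 * (1 - (1 - k))\<^sup>2 = k\<^sup>2 * (1 - k)\<^sup>2" "(1 - k)\<^sup>2 - (1 - k) + 1 = k\<^sup>2 - k + 1" by algebra+
      then show ?thesis unfolding h_def by (simp only:)
    qed
    then show "g (- 1 / T) = g T" unfolding g_def comodulus_sq_inversion[OF T] by simp
  qed
  have g_nz: "g T \<noteq> 0" if "Im T > 0" for T
    using comodulus_sq_not_0_1[OF that] den[OF that] by (simp add: g_def h_def)
  \<comment> \<open>The function \<open>g\<close> in terms of the nome; it extends continuously to the cusp \<open>p =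
    0\<close> with value \<open>0\<close>.\<close>
  define G' where "G' = (\<lambda>p. h ((nome_phi (- p) / nome_phi p) ^ 4))"
  have gG: "g T = G' (nome T)" for T
    by (simp add: g_def G'_def comodulus_sq_def ell_comodulus_def theta3_eq theta4_eq power_divide power_mult[symmetric])
  have G'_cont: "isCont G' 0"
  proof -
    have "isCont (\<lambda>p. nome_phi (- p)) 0" by (rule isCont_o2[of _ uminus]) (use nome_phi_isCont[of 0] in auto)
    then have c: "isCont (\<lambda>p. (nome_phi (- p) / nome_phi p) ^ 4) 0"
      using nome_phi_isCont[of 0] by (intro continuous_intros) auto
    moreover have "isCont h 1" unfolding h_def using w by (intro continuous_intros) auto
    ultimately show ?thesis unfolding G'_def using isCont_o2[OF c, of h] by simp
  qed
  have G'0: "G' 0 = 0" by (simp add: G'_def h_def)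
  have "cmod (g \<i>) > 0" using g_nz[of \<i>] by simp
  then obtain \<rho> where "\<rho> > 0" "\<forall>p. dist p 0 < \<rho> \<longrightarrow> dist (G' p) (G' 0) < cmod (g \<i>)"
    using G'_cont unfolding continuous_at_eps_delta by blast
  then have \<rho>: "\<rho> > 0" "\<And>p. cmod p < \<rho> \<Longrightarrow> cmod (G' p) < cmod (g \<i>)"
    by (simp_all add: G'0)
  obtain N where N: "exp (- pi * N) < \<rho>" "N \<ge> 1"
  proof -
    have "((\<lambda>t. exp (- pi * t)) \<longlongrightarrow> 0) at_top" by real_asymp
    then have "\<forall>\<^sub>F t in at_top. exp (- pi * t) < \<rho>" using \<rho>(1) by (rule order_tendstoD)
    then have "\<forall>\<^sub>F t in at_top. exp (- pi * t) < \<rho> \<and> t \<ge> (1::real)"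
      using eventually_ge_at_top eventually_conj by blast
    then show thesis using that eventually_happens[of _ at_top] by force
  qed
  have far: "cmod (g T) < cmod (g \<i>)" if "Im T \<ge> N" for T
  proof -
    have "cmod (nome T) \<le> exp (- pi * N)" using that by (simp add: cmod_nome)
    then show ?thesis unfolding gG[of T] using \<rho>(2) N(1) by simp
  qed
  define K where "K = cbox (Complex (- 1 / 2) (1 / 2)) (Complex (1 / 2) N)"
  have K: "T \<in> K \<longleftrightarrow> \<bar>Re T\<bar> \<le> 1 / 2 \<and> 1 / 2 \<le> Im T \<and> Im T \<le> N" for T
    by (auto simp: K_def in_cbox_complex_iff)
  have "continuous_on K (\<lambda>T. cmod (g T))"
    by (intro continuous_on_norm continuous_on_subset[OF holomorphic_on_imp_continuous_on[OF g_hol]]) (auto simp: K)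
  moreover have "\<i> \<in> K" using N by (simp add: K)
  moreover have "compact K" unfolding K_def by (rule compact_cbox)
  ultimately obtain M where M: "M \<in> K" "\<And>T. T \<in> K \<Longrightarrow> cmod (g T) \<le> cmod (g M)"
    using continuous_attains_sup[of K "\<lambda>T. cmod (g T)"] by blast
  have max: "cmod (g T) \<le> cmod (g M)" if T: "T \<in> upper" for T
  proof -
    have "Im T > 0" using T by simp
    then obtain T' where T': "1 / 2 \<le> Im T'" "\<bar>Re T'\<bar> \<le> 1 / 2" "g T' = g T"
      using modular_reduction[of g] inv1 inv2 by blast
    show ?thesis
    proof (cases "Im T' \<le> N")
      case True
      then show ?thesis using M(2)[of T'] T' by (simp add: K)
    next
      case False
      then show ?thesis using far[of T'] M(2)[OF \<open>\<i> \<in> K\<close>] T' by simp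
    qed
  qed
  have "g constant_on upper"
  proof (rule maximum_modulus_principle[OF g_hol, of upper M])
    show "open upper" by (rule open_halfspace_Im_gt)
    show "connected upper" by (intro convex_connected convex_halfspace_Im_gt)
    show "M \<in> upper" using M(1) by (simp add: K)
  qed (use max open_halfspace_Im_gt in auto)
  then obtain c where c: "\<And>T. Im T > 0 \<Longrightarrow> g T = c" by (auto simp: constant_on_def)
  have "g (\<i> * of_real N) = c" "g \<i> = c" using c[of "\<i> * of_real N"] c[of \<i>] N by auto
  moreover have "cmod (g (\<i> * of_real N)) < cmod (g \<i>)" by (rule far) simp
  ultimately show False by simp
qed

lemma ell_modulus_shift2:
  shows "ell_modulus (T + 2) = - ell_modulus T"
proof -
  have e: "T + 2 = (T + 1) + 1" by simp
  show ?thesis unfolding e ell_modulus_def theta2_shift_sq theta3_shift theta4_shift by simp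
qed

text \<open>The square root of a value of \<open>comodulus_sq\<close> is fixed up to sign, and conjugating \<open>T \<mapsto> T + 2\<close> by
  the inversion changes the sign of the comodulus.\<close>

lemma ell_comodulus_surj:
  assumes v: "v \<noteq> 0" "v \<noteq> 1" "v \<noteq> - 1"
  obtains T where "Im T > 0" "ell_comodulus T = v"
proof -
  have "v\<^sup>2 \<noteq> 0" "v\<^sup>2 \<noteq> 1" using v by (auto simp: power2_eq_1_iff)
  then obtain T where T: "Im T > 0" "(ell_comodulus T)\<^sup>2 = v\<^sup>2" using comodulus_sq_surj unfolding comodulus_sq_def by metis
  show thesis
  proof (cases "ell_comodulus T = v")
    case True
    then show ?thesis using T that by blast
  next
    case False
    then have r: "ell_comodulus T = - v" using T(2) by (auto simp: power2_eq_iff)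
    define S where "S = - 1 / T"
    have S: "Im S > 0" using Im_inversion(2)[OF T(1)] by (simp add: S_def)
    then have S2: "Im (S + 2) > 0" by simp
    have "T \<noteq> 0" using T(1) by auto
    then have "- 1 / S = T" by (simp add: S_def)
    then have "ell_modulus S = ell_comodulus T" using ell_comodulus_inversion[OF S] by simp
    then have "ell_comodulus (- 1 / (S + 2)) = v" unfolding ell_comodulus_inversion[OF S2] ell_modulus_shift2 using r by simp
    then show ?thesis using that Im_inversion(2)[OF S2] by blast
  qed
qed

section \<open>Uniqueness and completeness\<close>

text \<open>On a small disc the mean value inequality bounds the maximum of the sum of the \<open>cmod (f i)\<close> by half of
  itself.\<close>

lemma linear_system_vanishes:
  fixes f :: "nat \<Rightarrow> complex \<Rightarrow> complex"
  assumes D: "open D" "a \<in> D"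
    and m: "\<And>i j. i < n \<Longrightarrow> j < n \<Longrightarrow> continuous_on D (m i j)"
    and f: "\<And>i \<tau>. i < n \<Longrightarrow> \<tau> \<in> D \<Longrightarrow> (f i has_field_derivative (\<Sum>j<n. m i j \<tau> * f j \<tau>)) (at \<tau>)"
    and 0: "\<And>i. i < n \<Longrightarrow> f i a = 0"
  obtains r where "r > 0" "ball a r \<subseteq> D" "\<And>i \<tau>. i < n \<Longrightarrow> \<tau> \<in> ball a r \<Longrightarrow> f i \<tau> = 0"
proof -
  obtain R where R: "R > 0" "cball a R \<subseteq> D" using D open_contains_cball by blast
  have "\<exists>B. \<forall>\<tau>\<in>cball a R. norm (m i j \<tau>) \<le> B" if "i < n" "j < n" for i j
  proof -
    have "compact (m i j ` cball a R)"
      by (intro compact_continuous_image continuous_on_subset[OF m[OF that] R(2)] compact_cball)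
    then show ?thesis by (meson bounded_iff compact_imp_bounded image_eqI)
  qed
  then obtain B where B: "\<And>i j \<tau>. i < n \<Longrightarrow> j < n \<Longrightarrow> \<tau> \<in> cball a R \<Longrightarrow> norm (m i j \<tau>) \<le> B i j"
    by metis
  define C where "C = 1 + (\<Sum>i<n. \<Sum>j<n. \<bar>B i j\<bar>)"
  have C: "norm (m i j \<tau>) \<le> C" if "i < n" "j < n" "\<tau> \<in> cball a R" for i j \<tau>
  proof -
    have "norm (m i j \<tau>) \<le> \<bar>B i j\<bar>" using B[OF that] by simp
    also have "\<dots> \<le> (\<Sum>j<n. \<bar>B i j\<bar>)" using that by (intro member_le_sum) auto
    also have "\<dots> \<le> (\<Sum>i<n. \<Sum>j<n. \<bar>B i j\<bar>)" using that by (intro member_le_sum) (auto intro: sum_nonneg)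
    finally show ?thesis by (simp add: C_def)
  qed
  have C1: "C \<ge> 1" unfolding C_def by (simp add: sum_nonneg)
  define r where "r = min R (1 / (2 * C * (real n + 1)))"
  have r: "r > 0" "r \<le> R" "real n * (C * r) \<le> 1 / 2"
  proof -
    show "r > 0" "r \<le> R" using R C1 by (auto simp: r_def)
    have "C * r \<le> C * (1 / (2 * C * (real n + 1)))"
      using C1 by (intro mult_left_mono) (auto simp: r_def)
    also have "\<dots> = 1 / (2 * (real n + 1))" using C1 by simp
    finally have "real n * (C * r) \<le> real n * (1 / (2 * (real n + 1)))" by (intro mult_left_mono) auto
    also have "\<dots> \<le> 1 / 2" by (simp add: field_simps)
    finally show "real n * (C * r) \<le> 1 / 2" .
  qed
  define S where "S = (\<lambda>\<tau>. \<Sum>j<n. norm (f j \<tau>))"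
  have sub: "cball a r \<subseteq> D" "cball a r \<subseteq> cball a R" using r R by auto
  have fc: "continuous_on D (f j)" if "j < n" for j
    using f[OF that] DERIV_isCont continuous_at_imp_continuous_on by blast
  have "continuous_on (cball a r) S"
    unfolding S_def by (intro continuous_on_sum continuous_on_norm continuous_on_subset[OF fc sub(1)]) auto
  then obtain M where M: "M \<in> cball a r" "\<And>\<tau>. \<tau> \<in> cball a r \<Longrightarrow> S \<tau> \<le> S M"
    using continuous_attains_sup[of "cball a r" S] r by (metis centre_in_cball compact_cball empty_iff less_imp_le)
  have S0: "0 \<le> S \<tau>" for \<tau> unfolding S_def by (intro sum_nonneg) auto
  have b: "norm (f i M) \<le> C * S M * r" if i: "i < n" for i
  proof -
    have "norm (f i M - f i a) \<le> (C * S M) * norm (M - a)"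
    proof (rule field_differentiable_bound[of "cball a r"])
      fix \<tau> assume t: "\<tau> \<in> cball a r"
      show "(f i has_field_derivative (\<Sum>j<n. m i j \<tau> * f j \<tau>)) (at \<tau> within cball a r)"
        by (rule has_field_derivative_at_within[OF f[OF i]]) (use t sub in blast)
      have "norm (\<Sum>j<n. m i j \<tau> * f j \<tau>) \<le> (\<Sum>j<n. C * norm (f j \<tau>))"
        by (rule sum_norm_le) (use C i t sub in \<open>auto simp: norm_mult intro!: mult_right_mono\<close>)
      also have "\<dots> = C * S \<tau>" by (simp add: S_def sum_distrib_left)
      also have "\<dots> \<le> C * S M" using M(2)[OF t] C1 by (intro mult_left_mono) auto
      finally show "norm (\<Sum>j<n. m i j \<tau> * f j \<tau>) \<le> C * S M" .
    qed (use M r in auto)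
    also have "\<dots> \<le> (C * S M) * r"
      using M(1) S0[of M] C1 by (intro mult_left_mono) (auto simp: dist_norm norm_minus_commute)
    finally show ?thesis using 0[OF i] by simp
  qed
  have "S M \<le> (\<Sum>i<n. C * S M * r)" unfolding S_def[of] by (rule sum_mono) (use b in \<open>auto simp: S_def\<close>)
  also have "\<dots> = (real n * (C * r)) * S M" by simp
  also have "\<dots> \<le> (1 / 2) * S M" using r(3) S0 by (intro mult_right_mono) auto
  finally have "S M = 0" using S0[of M] by simp
  have z: "f i \<tau> = 0" if "i < n" "\<tau> \<in> ball a r" for i \<tau>
  proof -
    have "norm (f i \<tau>) \<le> S \<tau>" unfolding S_def using that by (intro member_le_sum) auto
    moreover have "S \<tau> \<le> 0" using M(2)[of \<tau>] that \<open>S M = 0\<close> by auto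
    ultimately show ?thesis by (metis norm_le_zero_iff order_trans)
  qed
  show thesis by (rule that[OF r(1) _ z]) (use sub in auto)
qed

lemma solves_S_continuous:
  assumes "solves_S D x y z u"
  shows "continuous_on D x" "continuous_on D y" "continuous_on D z" "continuous_on D u"
  using assms unfolding solves_S_def
  by (auto intro!: continuous_at_imp_continuous_on DERIV_isCont)

lemma solves_S_subset: "solves_S D x y z u \<Longrightarrow> E \<subseteq> D \<Longrightarrow> solves_S E x y z u"
  by (auto simp: solves_S_def)

text \<open>The difference of two solutions satisfies a linear system whose coefficients are polynomials in both.\<close>

lemma solves_S_unique:
  assumes D: "open D" "a \<in> D" and s: "solves_S D x y z u" "solves_S D x' y' z' u'"
    and eq: "x a = x' a" "y a = y' a" "z a = z' a" "u a = u' a"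
  obtains r where "r > 0" "ball a r \<subseteq> D" "\<And>\<tau>. \<tau> \<in> ball a r \<Longrightarrow> x \<tau> = x' \<tau> \<and> y \<tau> = y' \<tau> \<and> z \<tau> = z' \<tau> \<and> u \<tau> = u' \<tau>"
proof -
  define f where "f = (\<lambda>i::nat. \<lambda>\<tau>. [x \<tau> - x' \<tau>, y \<tau> - y' \<tau>, z \<tau> - z' \<tau>, u \<tau> - u' \<tau>] ! i)"
  \<comment> \<open>Divided differences of the right-hand sides of (S).\<close>
  define m where "m = (\<lambda>i::nat. \<lambda>j::nat. \<lambda>\<tau>. [
     [u \<tau> + (y \<tau>)\<^sup>2 + (z \<tau>)\<^sup>2, x' \<tau> * (y \<tau> + y' \<tau>), x' \<tau> * (z \<tau> + z' \<tau>), x' \<tau>],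
     [0, u \<tau> + (y \<tau>)\<^sup>2 - 2 * (z \<tau>)\<^sup>2 + y' \<tau> * (y \<tau> + y' \<tau>), - 2 * y' \<tau> * (z \<tau> + z' \<tau>), y' \<tau>],
     [0, - 2 * z' \<tau> * (y \<tau> + y' \<tau>), u \<tau> - 2 * (y \<tau>)\<^sup>2 + (z \<tau>)\<^sup>2 + z' \<tau> * (z \<tau> + z' \<tau>), z' \<tau>],
     [0, ((z \<tau>)\<^sup>2 - (y \<tau>)\<^sup>2 - (y' \<tau>)\<^sup>2) * (y \<tau> + y' \<tau>), ((y' \<tau>)\<^sup>2 - (z \<tau>)\<^sup>2 - (z' \<tau>)\<^sup>2) * (z \<tau> + z' \<tau>), u \<tau> + u' \<tau>]] ! i ! j)"
  have c4: "i = 0 \<or> i = 1 \<or> i = 2 \<or> i = 3" if "i < 4" for i :: nat using that by auto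
  note cont = solves_S_continuous[OF s(1)] solves_S_continuous[OF s(2)]
  have mc: "continuous_on D (m i j)" if "i < 4" "j < 4" for i j
    using c4[OF that(1)] c4[OF that(2)]
    by (elim disjE) (simp_all add: m_def numeral_2_eq_2 numeral_3_eq_3, (intro continuous_intros cont)+)
  have sum4: "(\<Sum>j<4. g j) = g 0 + g 1 + g 2 + g 3" for g :: "nat \<Rightarrow> complex"
    by (simp add: eval_nat_numeral add.assoc)
  have fe: "f 0 = (\<lambda>\<tau>. x \<tau> - x' \<tau>)" "f 1 = (\<lambda>\<tau>. y \<tau> - y' \<tau>)" "f 2 = (\<lambda>\<tau>. z \<tau> - z' \<tau>)" "f 3 = (\<lambda>\<tau>. u \<tau> - u' \<tau>)"
    by (simp_all add: f_def numeral_2_eq_2 numeral_3_eq_3)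
  have fd: "(f i has_field_derivative (\<Sum>j<4. m i j \<tau> * f j \<tau>)) (at \<tau>)" if i: "i < 4" and t: "\<tau> \<in> D" for i \<tau>
  proof -
    note d = bspec[OF s(1)[unfolded solves_S_def] t] bspec[OF s(2)[unfolded solves_S_def] t]
    have "(f 0 has_field_derivative (\<Sum>j<4. m 0 j \<tau> * f j \<tau>)) (at \<tau>)"
      unfolding sum4 fe
      by (rule DERIV_cong[OF DERIV_diff[OF d(1)[THEN conjunct1] d(2)[THEN conjunct1]]])
         (simp add: m_def numeral_2_eq_2 numeral_3_eq_3, algebra)
    moreover have "(f 1 has_field_derivative (\<Sum>j<4. m 1 j \<tau> * f j \<tau>)) (at \<tau>)"
      unfolding sum4 fe
      by (rule DERIV_cong[OF DERIV_diff[OF d(1)[THEN conjunct2, THEN conjunct1] d(2)[THEN conjunct2, THEN conjunct1]]])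
         (simp add: m_def numeral_2_eq_2 numeral_3_eq_3, algebra)
    moreover have "(f 2 has_field_derivative (\<Sum>j<4. m 2 j \<tau> * f j \<tau>)) (at \<tau>)"
      unfolding sum4 fe
      by (rule DERIV_cong[OF DERIV_diff[OF d(1)[THEN conjunct2, THEN conjunct2, THEN conjunct1] d(2)[THEN conjunct2, THEN conjunct2, THEN conjunct1]]])
         (simp add: m_def numeral_2_eq_2 numeral_3_eq_3, algebra)
    moreover have "(f 3 has_field_derivative (\<Sum>j<4. m 3 j \<tau> * f j \<tau>)) (at \<tau>)"
      unfolding sum4 fe
      by (rule DERIV_cong[OF DERIV_diff[OF d(1)[THEN conjunct2, THEN conjunct2, THEN conjunct2] d(2)[THEN conjunct2, THEN conjunct2, THEN conjunct2]]])
         (simp add: m_def numeral_2_eq_2 numeral_3_eq_3, algebra)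
    ultimately show ?thesis using c4[OF i] by auto
  qed
  have f0: "f i a = 0" if "i < 4" for i
    using c4[OF that] eq by (auto simp: f_def numeral_2_eq_2 numeral_3_eq_3)
  obtain r where r: "r > 0" "ball a r \<subseteq> D" "\<And>i \<tau>. i < 4 \<Longrightarrow> \<tau> \<in> ball a r \<Longrightarrow> f i \<tau> = 0"
    using linear_system_vanishes[of D a 4 m f, OF D mc fd f0] by blast
  show thesis
  proof (rule that[OF r(1,2)])
    fix \<tau> assume "\<tau> \<in> ball a r"
    from r(3)[OF _ this, of 0] r(3)[OF _ this, of 1] r(3)[OF _ this, of 2] r(3)[OF _ this, of 3]
    show "x \<tau> = x' \<tau> \<and> y \<tau> = y' \<tau> \<and> z \<tau> = z' \<tau> \<and> u \<tau> = u' \<tau>"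
      by (simp add: f_def numeral_2_eq_2 numeral_3_eq_3)
  qed
qed

lemma gen_dom_open: "open (gen_dom \<alpha> \<beta> \<gamma> \<delta>)"
proof -
  have o: "open {\<tau>. \<gamma> * \<tau> + \<delta> \<noteq> 0}"
    by (intro open_Collect_neq continuous_intros)
  have "continuous_on {\<tau>. \<gamma> * \<tau> + \<delta> \<noteq> 0} (\<lambda>\<tau>. Im (frac_lin \<alpha> \<beta> \<gamma> \<delta> \<tau>))"
    unfolding frac_lin_def by (intro continuous_intros) auto
  from continuous_open_preimage[OF this o, of "{0<..}"]
  have "open ({\<tau>. \<gamma> * \<tau> + \<delta> \<noteq> 0} \<inter> (\<lambda>\<tau>. Im (frac_lin \<alpha> \<beta> \<gamma> \<delta> \<tau>)) -` {0<..})" by simp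
  also have "\<dots> = gen_dom \<alpha> \<beta> \<gamma> \<delta>" by (auto simp: gen_dom_def)
  finally show ?thesis .
qed

text \<open>The Hermitian form whose positivity describes \<open>gen_dom\<close>. Unlike the imaginary part of \<open>frac_lin\<close> it is
  continuous everywhere, also at the pole.\<close>

definition dom_form :: "complex \<Rightarrow> complex \<Rightarrow> complex \<Rightarrow> complex \<Rightarrow> complex \<Rightarrow> real" where
  "dom_form \<alpha> \<beta> \<gamma> \<delta> \<tau> = Im ((\<alpha> * \<tau> + \<beta>) * cnj (\<gamma> * \<tau> + \<delta>))"

lemma dom_form_eq:
  assumes "\<gamma> * \<tau> + \<delta> \<noteq> 0"
  shows "dom_form \<alpha> \<beta> \<gamma> \<delta> \<tau> = Im (frac_lin \<alpha> \<beta> \<gamma> \<delta> \<tau>) * (cmod (\<gamma> * \<tau> + \<delta>))\<^sup>2"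
proof -
  define w where "w = \<gamma> * \<tau> + \<delta>"
  have "(\<alpha> * \<tau> + \<beta>) * cnj w = frac_lin \<alpha> \<beta> \<gamma> \<delta> \<tau> * (w * cnj w)"
    using assms by (simp add: frac_lin_def w_def)
  also have "w * cnj w = of_real ((cmod w)\<^sup>2)" by (rule complex_norm_square[symmetric])
  finally show ?thesis unfolding dom_form_def w_def[symmetric] by simp
qed

lemma gen_dom_iff_dom_form: "\<tau> \<in> gen_dom \<alpha> \<beta> \<gamma> \<delta> \<longleftrightarrow> dom_form \<alpha> \<beta> \<gamma> \<delta> \<tau> > 0"
proof (cases "\<gamma> * \<tau> + \<delta> = 0")
  case True
  then show ?thesis by (simp add: gen_dom_def dom_form_def)
next
  case False
  then show ?thesis by (simp add: gen_dom_def dom_form_eq zero_less_mult_iff)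
qed

text \<open>Expressed through \<open>y\<close> and \<open>z\<close>, the lower bound for \<open>theta_height\<close> survives in the limit at the boundary
  of the domain.\<close>

lemma dom_form_lower_bound:
  assumes q: "\<And>T. Im T > 0 \<Longrightarrow> q \<le> theta_height T" and t: "\<tau> \<in> gen_dom \<alpha> \<beta> \<gamma> \<delta>"
  shows "q \<le> dom_form \<alpha> \<beta> \<gamma> \<delta> \<tau> * (6 / pi * ((cmod (gen_y \<alpha> \<beta> \<gamma> \<delta> \<tau>))\<^sup>2 + (cmod (gen_z \<alpha> \<beta> \<gamma> \<delta> \<tau>))\<^sup>2))"
proof -
  define T w where "T = frac_lin \<alpha> \<beta> \<gamma> \<delta> \<tau>" and "w = \<gamma> * \<tau> + \<delta>"
  have T: "Im T > 0" and w: "w \<noteq> 0" using t by (auto simp: gen_dom_def T_def w_def)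
  have sq: "(cmod (csqrt (of_real pi * \<i> / 6)))\<^sup>2 = pi / 6"
    unfolding norm_power[symmetric] csqrt_const_sq by (simp add: norm_mult norm_divide)
  have y: "(cmod (gen_y \<alpha> \<beta> \<gamma> \<delta> \<tau>))\<^sup>2 = pi / 6 * cmod (theta3 T ^ 4) / (cmod w)\<^sup>2"
    unfolding gen_y_def T_def[symmetric] w_def[symmetric] norm_mult power_mult_distrib sq
    by (simp add: norm_divide norm_power power_divide power_mult[symmetric])
  have z: "(cmod (gen_z \<alpha> \<beta> \<gamma> \<delta> \<tau>))\<^sup>2 = pi / 6 * cmod (theta4 T ^ 4) / (cmod w)\<^sup>2"
    unfolding gen_z_def T_def[symmetric] w_def[symmetric] norm_mult power_mult_distrib sq
    by (simp add: norm_divide norm_power power_divide power_mult[symmetric])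
  have "theta2 T ^ 4 = theta3 T ^ 4 - theta4 T ^ 4" using jacobi_quartic[OF T] by (simp add: algebra_simps)
  then have "cmod (theta2 T ^ 4) \<le> cmod (theta3 T ^ 4) + cmod (theta4 T ^ 4)"
    using norm_triangle_ineq4[of "theta3 T ^ 4" "theta4 T ^ 4"] by simp
  then have "Max {cmod (theta2 T ^ 4), cmod (theta3 T ^ 4), cmod (theta4 T ^ 4)} \<le> cmod (theta3 T ^ 4) + cmod (theta4 T ^ 4)"
    by simp
  then have "theta_height T \<le> Im T * (cmod (theta3 T ^ 4) + cmod (theta4 T ^ 4))"
    unfolding theta_height_def using T by (intro mult_left_mono) auto
  also have "\<dots> = dom_form \<alpha> \<beta> \<gamma> \<delta> \<tau> * (6 / pi * ((cmod (gen_y \<alpha> \<beta> \<gamma> \<delta> \<tau>))\<^sup>2 + (cmod (gen_z \<alpha> \<beta> \<gamma> \<delta> \<tau>))\<^sup>2))"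
    unfolding y z dom_form_eq[OF w[unfolded w_def]] unfolding T_def[symmetric] w_def[symmetric] using w by (simp add: field_simps)
  finally show ?thesis using q[OF T] by linarith
qed

text \<open>The set where a solution agrees with the fitted one is open by uniqueness. It is also closed in \<open>D\<close>:
  by \<open>dom_form_lower_bound\<close> it lies in the relatively closed set \<open>B\<close>, which avoids the boundary of \<open>gen_dom\<close>.\<close>

theorem general_solution_complete:
  assumes D: "open D" "connected D" and s: "solves_S D x y z u" and t0: "\<tau>0 \<in> D"
    and nz: "x \<tau>0 \<noteq> 0" "y \<tau>0 \<noteq> 0" "z \<tau>0 \<noteq> 0" "(y \<tau>0)\<^sup>2 \<noteq> (z \<tau>0)\<^sup>2"
  shows "\<exists>\<alpha> \<beta> \<gamma> \<delta> \<epsilon>. \<alpha> * \<delta> - \<beta> * \<gamma> = 1 \<and> \<epsilon> \<noteq> 0 \<and> D \<subseteq> gen_dom \<alpha> \<beta> \<gamma> \<delta> \<and>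
           (\<forall>\<tau>\<in>D. x \<tau> = gen_x \<alpha> \<beta> \<gamma> \<delta> \<epsilon> \<tau> \<and> y \<tau> = gen_y \<alpha> \<beta> \<gamma> \<delta> \<tau> \<and>
                  z \<tau> = gen_z \<alpha> \<beta> \<gamma> \<delta> \<tau> \<and> u \<tau> = gen_u \<alpha> \<beta> \<gamma> \<delta> \<tau>)"
proof -
  define c where "c = csqrt (of_real pi * \<i> / 6)"
  have c: "c \<noteq> 0" by (simp add: c_def)
  have v: "z \<tau>0 / y \<tau>0 \<noteq> 0" "z \<tau>0 / y \<tau>0 \<noteq> 1" "z \<tau>0 / y \<tau>0 \<noteq> - 1"
    using nz by (auto simp: divide_eq_eq)
  obtain T where T: "Im T > 0" "ell_comodulus T = z \<tau>0 / y \<tau>0" by (rule ell_comodulus_surj[OF v])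
  note th = theta_nonzero[OF T(1)]
  \<comment> \<open>\<open>W\<close> is to be \<open>\<gamma> \<tau>0 + \<delta>\<close>. It is read off from
    \<open>y\<close>, then \<open>\<gamma>\<close> from \<open>u\<close>, and \<open>\<alpha>\<close>,
    \<open>\<beta>\<close> from \<open>T\<close> and the determinant.\<close>
  define W where "W = c * (theta3 T)\<^sup>2 / y \<tau>0"
  have W: "W \<noteq> 0" using c th nz by (simp add: W_def)
  define \<gamma> where "\<gamma> = (2 * \<i> / of_real pi * (eta T / W\<^sup>2) - u \<tau>0) * W"
  define \<delta> where "\<delta> = W - \<gamma> * \<tau>0"
  define \<alpha> where "\<alpha> = 1 / W + T * \<gamma>"
  define \<beta> where "\<beta> = T * W - \<alpha> * \<tau>0"
  define \<epsilon> where "\<epsilon> = x \<tau>0 * W / (theta2 T)\<^sup>2"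
  have wt: "\<gamma> * \<tau>0 + \<delta> = W" by (simp add: \<delta>_def)
  have at: "\<alpha> * \<tau>0 + \<beta> = T * W" by (simp add: \<beta>_def)
  have fl: "frac_lin \<alpha> \<beta> \<gamma> \<delta> \<tau>0 = T" unfolding frac_lin_def wt at using W by simp
  have det: "\<alpha> * \<delta> - \<beta> * \<gamma> = 1"
  proof -
    have "\<alpha> * \<delta> - \<beta> * \<gamma> = \<alpha> * W - T * W * \<gamma>" by (simp add: \<delta>_def \<beta>_def algebra_simps)
    also have "\<dots> = 1" unfolding \<alpha>_def using W by (simp add: algebra_simps)
    finally show ?thesis .
  qed
  have e0: "\<epsilon> \<noteq> 0" using W nz th by (simp add: \<epsilon>_def)
  let ?g = "gen_dom \<alpha> \<beta> \<gamma> \<delta>"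
  let ?x = "gen_x \<alpha> \<beta> \<gamma> \<delta> \<epsilon>" and ?y = "gen_y \<alpha> \<beta> \<gamma> \<delta>" and ?z = "gen_z \<alpha> \<beta> \<gamma> \<delta>" and ?u = "gen_u \<alpha> \<beta> \<gamma> \<delta>"
  have gs: "solves_S ?g ?x ?y ?z ?u" by (rule general_solution_solves_S[OF det])
  have t0g: "\<tau>0 \<in> ?g" unfolding gen_dom_def using wt fl T W by simp
  have m0: "x \<tau>0 = ?x \<tau>0" "y \<tau>0 = ?y \<tau>0" "z \<tau>0 = ?z \<tau>0" "u \<tau>0 = ?u \<tau>0"
  proof -
    show "x \<tau>0 = ?x \<tau>0" unfolding gen_x_def fl wt \<epsilon>_def using W th by simp
    show y0: "y \<tau>0 = ?y \<tau>0" unfolding gen_y_def fl wt c_def[symmetric] W_def using c th nz by simp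
    have "?z \<tau>0 = ?y \<tau>0 * ell_comodulus T" unfolding gen_z_def gen_y_def fl wt ell_comodulus_def using th by simp
    then show "z \<tau>0 = ?z \<tau>0" unfolding y0[symmetric] T(2) using nz by simp
    have "\<gamma> / W = 2 * \<i> / of_real pi * (eta T / W\<^sup>2) - u \<tau>0" using W by (simp add: \<gamma>_def)
    then show "u \<tau>0 = ?u \<tau>0" unfolding gen_u_def fl wt by simp
  qed
  define E where "E = D \<inter> ?g"
  define M where "M = {\<tau>\<in>E. x \<tau> = ?x \<tau> \<and> y \<tau> = ?y \<tau> \<and> z \<tau> = ?z \<tau> \<and> u \<tau> = ?u \<tau>}"
  have Eo: "open E" unfolding E_def by (intro open_Int D gen_dom_open)
  have sE: "solves_S E x y z u" "solves_S E ?x ?y ?z ?u"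
    using solves_S_subset[OF s] solves_S_subset[OF gs] by (auto simp: E_def)
  have "open M"
    unfolding open_contains_ball
  proof
    fix \<tau> assume t: "\<tau> \<in> M"
    then have tE: "\<tau> \<in> E" and eq: "x \<tau> = ?x \<tau>" "y \<tau> = ?y \<tau>" "z \<tau> = ?z \<tau>" "u \<tau> = ?u \<tau>" by (auto simp: M_def)
    obtain r where r: "r > 0" "ball \<tau> r \<subseteq> E" "\<And>\<sigma>. \<sigma> \<in> ball \<tau> r \<Longrightarrow> x \<sigma> = ?x \<sigma> \<and> y \<sigma> = ?y \<sigma> \<and> z \<sigma> = ?z \<sigma> \<and> u \<sigma> = ?u \<sigma>"
      using solves_S_unique[OF Eo tE sE eq] by metis
    then have "ball \<tau> r \<subseteq> M" unfolding M_def by blast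
    with r(1) show "\<exists>e>0. ball \<tau> e \<subseteq> M" by blast
  qed
  then have op: "openin (top_of_set D) M" by (intro open_subset) (auto simp: M_def E_def)
  obtain q where q: "q > 0" "\<And>T. Im T > 0 \<Longrightarrow> q \<le> theta_height T" using theta_height_lower_bound by blast
  define h where "h = (\<lambda>\<tau>. dom_form \<alpha> \<beta> \<gamma> \<delta> \<tau> * (6 / pi * ((cmod (y \<tau>))\<^sup>2 + (cmod (z \<tau>))\<^sup>2)))"
  \<comment> \<open>Here the value of \<open>dom_form\<close> is positive, so that no point of the boundary of
    \<open>gen_dom\<close> belongs to it.\<close>
  define B where "B = {\<tau>\<in>D. q \<le> h \<tau>}"
  have hc: "continuous_on D h"
    unfolding h_def dom_form_def by (intro continuous_intros solves_S_continuous[OF s])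
  have Bcl: "closedin (top_of_set D) B"
  proof -
    have "closedin (top_of_set D) (D \<inter> h -` {q..})" by (rule continuous_closedin_preimage[OF hc closed_atLeast])
    moreover have "D \<inter> h -` {q..} = B" by (auto simp: B_def)
    ultimately show ?thesis by simp
  qed
  have BE: "B \<subseteq> E"
  proof
    fix \<tau> assume t: "\<tau> \<in> B"
    then have "0 < h \<tau>" using q by (auto simp: B_def)
    moreover have "0 \<le> 6 / pi * ((cmod (y \<tau>))\<^sup>2 + (cmod (z \<tau>))\<^sup>2)" by simp
    ultimately have "0 < dom_form \<alpha> \<beta> \<gamma> \<delta> \<tau>" unfolding h_def by (simp only: zero_less_mult_iff) linarith
    then show "\<tau> \<in> E" using t by (simp add: E_def B_def gen_dom_iff_dom_form)
  qed
  have MB: "M \<subseteq> B"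
  proof
    fix \<tau> assume t: "\<tau> \<in> M"
    then have g: "\<tau> \<in> ?g" "\<tau> \<in> D" "y \<tau> = ?y \<tau>" "z \<tau> = ?z \<tau>" by (auto simp: M_def E_def)
    show "\<tau> \<in> B" using dom_form_lower_bound[OF q(2) g(1)] g(2) by (simp add: B_def h_def g(3,4))
  qed
  have "closedin (top_of_set E) M"
  proof -
    note cE = solves_S_continuous[OF sE(1)] solves_S_continuous[OF sE(2)]
    have "closedin (top_of_set E) ((E \<inter> (\<lambda>\<tau>. x \<tau> - ?x \<tau>) -` {0}) \<inter> (E \<inter> (\<lambda>\<tau>. y \<tau> - ?y \<tau>) -` {0}) \<inter>
       (E \<inter> (\<lambda>\<tau>. z \<tau> - ?z \<tau>) -` {0}) \<inter> (E \<inter> (\<lambda>\<tau>. u \<tau> - ?u \<tau>) -` {0}))"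
      by (intro closedin_Int continuous_closedin_preimage continuous_intros cE closed_singleton)
    moreover have "(E \<inter> (\<lambda>\<tau>. x \<tau> - ?x \<tau>) -` {0}) \<inter> (E \<inter> (\<lambda>\<tau>. y \<tau> - ?y \<tau>) -` {0}) \<inter>
       (E \<inter> (\<lambda>\<tau>. z \<tau> - ?z \<tau>) -` {0}) \<inter> (E \<inter> (\<lambda>\<tau>. u \<tau> - ?u \<tau>) -` {0}) = M"
      by (auto simp: M_def)
    ultimately show ?thesis by simp
  qed
  then have "closedin (top_of_set B) M" by (rule closedin_subset_trans[OF _ MB BE])
  then have cl: "closedin (top_of_set D) M" by (rule closedin_trans[OF _ Bcl])
  have "\<tau>0 \<in> M" using m0 t0 t0g by (simp add: M_def E_def)
  then have "M = D" using D(2) op cl unfolding connected_clopen by blast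
  then have "\<forall>\<tau>\<in>D. \<tau> \<in> ?g \<and> x \<tau> = ?x \<tau> \<and> y \<tau> = ?y \<tau> \<and> z \<tau> = ?z \<tau> \<and> u \<tau> = ?u \<tau>"
    unfolding M_def E_def by blast
  then show ?thesis using det e0 by blast
qed

section \<open>Equivalence with Jacobi's system\<close>

lemma zero_deriv_constant:
  fixes f :: "complex \<Rightarrow> complex"
  assumes "open D" "connected D" "\<And>\<tau>. \<tau> \<in> D \<Longrightarrow> (f has_field_derivative 0) (at \<tau>)"
  obtains c where "\<And>\<tau>. \<tau> \<in> D \<Longrightarrow> f \<tau> = c"
proof -
  have "continuous_on D f" using assms(3) DERIV_isCont continuous_at_imp_continuous_on by blast
  from DERIV_zero_connected_constant[OF assms(2,1) finite.emptyI this] assms(3) show thesis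
    using that by auto
qed

lemma solves_S_dest:
  assumes "solves_S D x y z u" "\<tau> \<in> D"
  shows "(x has_field_derivative (u \<tau> + (y \<tau>)\<^sup>2 + (z \<tau>)\<^sup>2) * x \<tau>) (at \<tau>)"
    "(y has_field_derivative (u \<tau> + (y \<tau>)\<^sup>2 - 2 * (z \<tau>)\<^sup>2) * y \<tau>) (at \<tau>)"
    "(z has_field_derivative (u \<tau> - 2 * (y \<tau>)\<^sup>2 + (z \<tau>)\<^sup>2) * z \<tau>) (at \<tau>)"
    "(u has_field_derivative (u \<tau>)\<^sup>2 - y \<tau> ^ 4 + (y \<tau>)\<^sup>2 * (z \<tau>)\<^sup>2 - z \<tau> ^ 4) (at \<tau>)"
  using assms by (auto simp: solves_S_def)

lemma solves_J_dest:
  assumes "solves_J D A B a b" "\<tau> \<in> D"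
  shows "(A has_field_derivative 2 * (A \<tau>)\<^sup>2 * B \<tau>) (at \<tau>)"
    "(B has_field_derivative b \<tau> * A \<tau> ^ 3) (at \<tau>)"
    "(a has_field_derivative - 16 * b \<tau> * (A \<tau>)\<^sup>2) (at \<tau>)"
    "(b has_field_derivative a \<tau> * b \<tau> * (A \<tau>)\<^sup>2) (at \<tau>)"
  using assms by (auto simp: solves_J_def)

lemma S_integral_constant:
  assumes D: "open D" "connected D" and s: "solves_S D x y z u" and x: "\<And>\<tau>. \<tau> \<in> D \<Longrightarrow> x \<tau> \<noteq> 0"
  obtains k where "\<And>\<tau>. \<tau> \<in> D \<Longrightarrow> ((y \<tau>)\<^sup>2 - (z \<tau>)\<^sup>2) / (x \<tau>)\<^sup>2 = k"
proof (rule zero_deriv_constant[OF D, of "\<lambda>\<tau>. ((y \<tau>)\<^sup>2 - (z \<tau>)\<^sup>2) / (x \<tau>)\<^sup>2"])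
  fix \<tau> assume t: "\<tau> \<in> D"
  note d = solves_S_dest[OF s t]
  show "((\<lambda>\<tau>. ((y \<tau>)\<^sup>2 - (z \<tau>)\<^sup>2) / (x \<tau>)\<^sup>2) has_field_derivative 0) (at \<tau>)"
    by (rule DERIV_cong[OF DERIV_divide[OF DERIV_diff[OF DERIV_power[OF d(2), of 2] DERIV_power[OF d(3), of 2]] DERIV_power[OF d(1), of 2]]])
       (use x[OF t] in \<open>auto simp: algebra_simps power2_eq_square\<close>)
qed (use that in blast)

text \<open>A continuous function with finitely many values on a connected set is constant.\<close>

lemma continuous_sqrt_constant:
  fixes I :: "complex \<Rightarrow> complex"
  assumes D: "connected D" and c: "continuous_on D I" and sq: "\<And>\<tau>. \<tau> \<in> D \<Longrightarrow> (I \<tau>)\<^sup>2 = k"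
  shows "I constant_on D"
proof (rule continuous_finite_range_constant[OF D c])
  have "I \<tau> = csqrt k \<or> I \<tau> = - csqrt k" if "\<tau> \<in> D" for \<tau>
    using sq[OF that] power2_csqrt[of k] by (metis power2_eq_iff)
  then have "I ` D \<subseteq> {csqrt k, - csqrt k}" by auto
  then show "finite (I ` D)" by (rule finite_subset) simp
qed

text \<open>The transformation in terms of \<open>I\<close>, \<open>y\<close> and \<open>z\<^sup>2 / y\<^sup>2\<close>: the relation for \<open>\<pi> I\<^sup>2\<close> eliminates \<open>x\<close> from
  \<open>a\<close> and \<open>b\<close>.\<close>

lemma point_transf_relations:
  assumes p: "point_transf D x y z u I A B a b" and t: "\<tau> \<in> D"
  shows "x \<tau> \<noteq> 0" "y \<tau> \<noteq> 0" "I \<tau> \<noteq> 0"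
    and "of_real pi * (I \<tau>)\<^sup>2 * (x \<tau>)\<^sup>2 = (y \<tau>)\<^sup>2 - (z \<tau>)\<^sup>2"
    and "A \<tau> = (1 - \<i>) / (2 * I \<tau>) * y \<tau>"
    and "B \<tau> = (1 + \<i>) / 2 * I \<tau> * (u \<tau> + (y \<tau>)\<^sup>2 - 2 * (z \<tau>)\<^sup>2) / y \<tau>"
    and "a \<tau> = - 12 * \<i> * (I \<tau>)\<^sup>2 * (1 - 2 * ((z \<tau>)\<^sup>2 / (y \<tau>)\<^sup>2))"
    and "b \<tau> = - 18 * I \<tau> ^ 4 * ((z \<tau>)\<^sup>2 * ((y \<tau>)\<^sup>2 - (z \<tau>)\<^sup>2) / y \<tau> ^ 4)"
proof -
  have q: "x \<tau> \<noteq> 0" "y \<tau> \<noteq> 0" "I \<tau> \<noteq> 0"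
        "of_real pi * (I \<tau>)\<^sup>2 = ((y \<tau>)\<^sup>2 - (z \<tau>)\<^sup>2) / (x \<tau>)\<^sup>2"
        "A \<tau> = (1 - \<i>) / (2 * I \<tau>) * y \<tau>"
        "B \<tau> = (1 + \<i>) / 2 * (I \<tau> / y \<tau>) * (u \<tau> + (y \<tau>)\<^sup>2 - 2 * (z \<tau>)\<^sup>2)"
        "a \<tau> = 12 / (of_real pi * \<i>) * (((y \<tau>)\<^sup>2 - (z \<tau>)\<^sup>2) / (x \<tau>)\<^sup>2) * (((y \<tau>)\<^sup>2 - 2 * (z \<tau>)\<^sup>2) / (y \<tau>)\<^sup>2)"
        "b \<tau> = - (18 / (of_real pi)\<^sup>2) * ((z \<tau>)\<^sup>2 / (x \<tau> ^ 4 * y \<tau> ^ 4)) * ((y \<tau>)\<^sup>2 - (z \<tau>)\<^sup>2) ^ 3"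
    using p t unfolding point_transf_def by auto
  show "x \<tau> \<noteq> 0" "y \<tau> \<noteq> 0" "I \<tau> \<noteq> 0" "A \<tau> = (1 - \<i>) / (2 * I \<tau>) * y \<tau>" by fact+
  show e: "of_real pi * (I \<tau>)\<^sup>2 * (x \<tau>)\<^sup>2 = (y \<tau>)\<^sup>2 - (z \<tau>)\<^sup>2" unfolding q(4) using q(1) by simp
  show "B \<tau> = (1 + \<i>) / 2 * I \<tau> * (u \<tau> + (y \<tau>)\<^sup>2 - 2 * (z \<tau>)\<^sup>2) / y \<tau>" unfolding q(6) by simp
  show "a \<tau> = - 12 * \<i> * (I \<tau>)\<^sup>2 * (1 - 2 * ((z \<tau>)\<^sup>2 / (y \<tau>)\<^sup>2))"
    unfolding q(7) q(4)[symmetric] using q(2) by (simp add: diff_divide_distrib)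
  have "((y \<tau>)\<^sup>2 - (z \<tau>)\<^sup>2) ^ 3 = (of_real pi * (I \<tau>)\<^sup>2 * (x \<tau>)\<^sup>2)\<^sup>2 * ((y \<tau>)\<^sup>2 - (z \<tau>)\<^sup>2)"
    unfolding e by (simp add: power2_eq_square power3_eq_cube)
  then show "b \<tau> = - 18 * I \<tau> ^ 4 * ((z \<tau>)\<^sup>2 * ((y \<tau>)\<^sup>2 - (z \<tau>)\<^sup>2) / y \<tau> ^ 4)"
    unfolding q(8) using q(1,2) by (simp add: power_mult_distrib power_mult[symmetric])
qed

lemma point_transf_discriminant:
  assumes p: "point_transf D x y z u I A B a b" and t: "\<tau> \<in> D"
  shows "(a \<tau>)\<^sup>2 + 32 * b \<tau> = - 144 * I \<tau> ^ 4"
proof -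
  note r = point_transf_relations[OF p t]
  define Y Z where "Y = (y \<tau>)\<^sup>2" and "Z = (z \<tau>)\<^sup>2"
  have Y: "Y \<noteq> 0" using r(2) by (simp add: Y_def)
  have y4: "y \<tau> ^ 4 = Y\<^sup>2" by (simp add: Y_def)
  have i: "\<i>\<^sup>2 = - 1" by simp
  have "(a \<tau>)\<^sup>2 = 144 * \<i>\<^sup>2 * I \<tau> ^ 4 * (1 - 2 * (Z / Y))\<^sup>2"
    unfolding r(7) Y_def[symmetric] Z_def[symmetric] by algebra
  moreover have "32 * b \<tau> = - 576 * I \<tau> ^ 4 * (Z / Y * (1 - Z / Y))"
    unfolding r(8) Y_def[symmetric] Z_def[symmetric] y4 using Y by (simp add: field_simps power2_eq_square)
  ultimately show ?thesis unfolding i by algebra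
qed

text \<open>For \<open>A = K y\<close> and \<open>c\<close> the value of \<open>I\<close> this turns the right-hand sides of the last two equations
  of (J) into functions of \<open>y\<close> and \<open>z\<close>.\<close>

lemma discriminant_scaling:
  fixes c K Y Q :: complex
  assumes "2 * K\<^sup>2 * c\<^sup>2 = - \<i>" "Y \<noteq> 0"
  shows "- 16 * (- 18 * c ^ 4 * (Q / Y ^ 4)) * (K * Y)\<^sup>2 = - 144 * \<i> * c\<^sup>2 * (Q / Y\<^sup>2)"
    and "- 12 * \<i> * c\<^sup>2 * Q * (K * Y)\<^sup>2 = - 6 * Q * Y\<^sup>2"
proof -
  have "- 16 * (- 18 * c ^ 4 * (Q / Y ^ 4)) * (K * Y)\<^sup>2 = 144 * c\<^sup>2 * (2 * K\<^sup>2 * c\<^sup>2) * (Q / Y\<^sup>2)"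
    using assms(2) by (simp add: power_mult_distrib power4_eq_xxxx power2_eq_square)
  then show "- 16 * (- 18 * c ^ 4 * (Q / Y ^ 4)) * (K * Y)\<^sup>2 = - 144 * \<i> * c\<^sup>2 * (Q / Y\<^sup>2)"
    unfolding assms(1) by simp
  have "- 12 * \<i> * c\<^sup>2 * Q * (K * Y)\<^sup>2 = - 6 * \<i> * (2 * K\<^sup>2 * c\<^sup>2) * (Q * Y\<^sup>2)"
    by (simp add: power_mult_distrib)
  then show "- 12 * \<i> * c\<^sup>2 * Q * (K * Y)\<^sup>2 = - 6 * Q * Y\<^sup>2"
    unfolding assms(1) by simp
qed

lemma S_imp_J:
  assumes D: "open D" and s: "solves_S D x y z u"
    and p: "point_transf D x y z u I A B a b" and I: "\<And>\<tau>. \<tau> \<in> D \<Longrightarrow> I \<tau> = c"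
  shows "solves_J D A B a b"
  unfolding solves_J_def
proof (intro ballI conjI)
  fix \<tau> assume t: "\<tau> \<in> D"
  note d = solves_S_dest[OF s t]
  note r = point_transf_relations[OF p]
  have c: "c \<noteq> 0" using r(3)[OF t] I[OF t] by simp
  define K L where "K = (1 - \<i>) / (2 * c)" and "L = (1 + \<i>) / 2 * c"
  have KL: "2 * K * L = 1" using c by (simp add: K_def L_def field_simps)
  have K2: "2 * K\<^sup>2 * c\<^sup>2 = - \<i>" using c by (simp add: K_def power_divide field_simps) (simp add: power2_eq_square algebra_simps)
  define X Y Z U where "X = x \<tau>" and "Y = y \<tau>" and "Z = z \<tau>" and "U = u \<tau>"
  have Y: "Y \<noteq> 0" using r(2)[OF t] by (simp add: Y_def)
  note d' = d[folded X_def Y_def Z_def U_def]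
  have A: "A \<sigma> = K * y \<sigma>" and B: "B \<sigma> = L * ((u \<sigma> + (y \<sigma>)\<^sup>2 - 2 * (z \<sigma>)\<^sup>2) / y \<sigma>)"
    and a: "a \<sigma> = - 12 * \<i> * c\<^sup>2 * (1 - 2 * ((z \<sigma>)\<^sup>2 / (y \<sigma>)\<^sup>2))"
    and b: "b \<sigma> = - 18 * c ^ 4 * ((z \<sigma>)\<^sup>2 * ((y \<sigma>)\<^sup>2 - (z \<sigma>)\<^sup>2) / y \<sigma> ^ 4)" if "\<sigma> \<in> D" for \<sigma>
    using r(5-8)[OF that] I[OF that] by (simp_all add: K_def L_def)
  note v = A[OF t, folded Y_def] B[OF t, folded Y_def Z_def U_def] a[OF t, folded Y_def Z_def] b[OF t, folded Y_def Z_def]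
  have tr: "(f has_field_derivative E) (at \<tau>)" if "(g has_field_derivative E) (at \<tau>)" "\<And>\<sigma>. \<sigma> \<in> D \<Longrightarrow> f \<sigma> = g \<sigma>" for f g E
    by (rule has_field_derivative_transform_within_open[OF that(1) D t]) (simp add: that(2))
  have y2: "(y \<tau>)\<^sup>2 \<noteq> 0" "y \<tau> ^ 4 \<noteq> 0" "y \<tau> \<noteq> 0" using Y by (simp_all add: Y_def)
  have "(A has_field_derivative K * ((U + Y\<^sup>2 - 2 * Z\<^sup>2) * Y)) (at \<tau>)"
    by (rule tr[OF DERIV_cmult[OF d'(2)] A])
  also have "K * ((U + Y\<^sup>2 - 2 * Z\<^sup>2) * Y) = 2 * (A \<tau>)\<^sup>2 * B \<tau>"
    unfolding v using Y KL by (simp add: field_simps) algebra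
  finally show "(A has_field_derivative 2 * (A \<tau>)\<^sup>2 * B \<tau>) (at \<tau>)" .
  have "(B has_field_derivative L * (9 * Z\<^sup>2 * (Y\<^sup>2 - Z\<^sup>2) / Y)) (at \<tau>)"
    by (rule tr[OF DERIV_cmult[OF DERIV_cong[OF DERIV_divide[OF DERIV_diff[OF DERIV_add[OF d'(4) DERIV_power[OF d'(2), of 2]] DERIV_cmult[OF DERIV_power[OF d'(3), of 2], of 2]] d'(2) y2(3)]]] B])
       (fold Y_def Z_def U_def, use Y in \<open>simp add: divide_simps\<close>, algebra)
  also have "L * (9 * Z\<^sup>2 * (Y\<^sup>2 - Z\<^sup>2) / Y) = b \<tau> * A \<tau> ^ 3"
  proof -
    have "9 * L = - 18 * c ^ 4 * K ^ 3"
    proof -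
      have i: "\<i>\<^sup>2 = - 1" by simp
      have "4 * K ^ 4 * c ^ 4 = (2 * K\<^sup>2 * c\<^sup>2)\<^sup>2" by algebra
      also have "\<dots> = - 1" unfolding K2 by simp
      finally show ?thesis using KL by algebra
    qed
    then show ?thesis unfolding v using Y by (simp add: divide_simps power3_eq_cube power4_eq_xxxx)
  qed
  finally show "(B has_field_derivative b \<tau> * A \<tau> ^ 3) (at \<tau>)" .
  have "(a has_field_derivative - 144 * \<i> * c\<^sup>2 * (Z\<^sup>2 * (Y\<^sup>2 - Z\<^sup>2) / Y\<^sup>2)) (at \<tau>)"
    by (rule tr[OF DERIV_cong[OF DERIV_cmult[OF DERIV_diff[OF DERIV_const DERIV_cmult[OF DERIV_divide[OF DERIV_power[OF d'(3), of 2] DERIV_power[OF d'(2), of 2] y2(1)], of 2]]]] a])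
       (fold Y_def Z_def U_def, use Y in \<open>simp add: divide_simps\<close>, algebra)
  also have "- 144 * \<i> * c\<^sup>2 * (Z\<^sup>2 * (Y\<^sup>2 - Z\<^sup>2) / Y\<^sup>2) = - 16 * b \<tau> * (A \<tau>)\<^sup>2"
    unfolding v by (rule discriminant_scaling(1)[OF K2 Y, symmetric])
  finally show "(a has_field_derivative - 16 * b \<tau> * (A \<tau>)\<^sup>2) (at \<tau>)" .
  have "(b has_field_derivative - 18 * c ^ 4 * (- 6 * Z\<^sup>2 * (Y\<^sup>2 - Z\<^sup>2) * (Y\<^sup>2 - 2 * Z\<^sup>2) / Y ^ 4)) (at \<tau>)"
    by (rule tr[OF DERIV_cong[OF DERIV_cmult[OF DERIV_divide[OF DERIV_mult[OF DERIV_power[OF d'(3), of 2] DERIV_diff[OF DERIV_power[OF d'(2), of 2] DERIV_power[OF d'(3), of 2]]] DERIV_power[OF d'(2), of 4] y2(2)]]] b])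
       (fold Y_def Z_def U_def, use Y in \<open>simp add: divide_simps\<close>, algebra)
  also have "- 18 * c ^ 4 * (- 6 * Z\<^sup>2 * (Y\<^sup>2 - Z\<^sup>2) * (Y\<^sup>2 - 2 * Z\<^sup>2) / Y ^ 4) = a \<tau> * b \<tau> * (A \<tau>)\<^sup>2"
  proof -
    have "a \<tau> * (A \<tau>)\<^sup>2 = - 6 * (Y\<^sup>2 - 2 * Z\<^sup>2)"
      unfolding v discriminant_scaling(2)[OF K2 Y] using Y by (simp add: algebra_simps)
    then have e: "a \<tau> * b \<tau> * (A \<tau>)\<^sup>2 = b \<tau> * (- 6 * (Y\<^sup>2 - 2 * Z\<^sup>2))" by algebra
    show ?thesis unfolding e unfolding v(4) by (simp add: field_simps)
  qed
  finally show "(b has_field_derivative a \<tau> * b \<tau> * (A \<tau>)\<^sup>2) (at \<tau>)" .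
qed

lemma holomorphic_mult_zero:
  assumes D: "open D" "connected D" and h: "f holomorphic_on D" "g holomorphic_on D"
    and z: "\<And>\<tau>. \<tau> \<in> D \<Longrightarrow> f \<tau> * g \<tau> = 0"
  shows "(\<forall>\<tau>\<in>D. f \<tau> = 0) \<or> (\<forall>\<tau>\<in>D. g \<tau> = 0)"
proof (rule disjCI)
  assume "\<not> (\<forall>\<tau>\<in>D. g \<tau> = 0)"
  then obtain t where t: "t \<in> D" "g t \<noteq> 0" by blast
  define V where "V = D \<inter> g -` (- {0})"
  have "open V" unfolding V_def
    by (rule continuous_open_preimage[OF holomorphic_on_imp_continuous_on[OF h(2)] D(1)]) auto
  have "f \<tau> = 0" if "\<tau> \<in> V" for \<tau> using that z by (auto simp: V_def)
  then have "f \<tau> = 0" if "\<tau> \<in> D" for \<tau>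
    using analytic_continuation_open[OF \<open>open V\<close> D(1) _ D(2) _ h(1) holomorphic_on_const[of 0], OF _ _ _ that] t
    by (force simp: V_def)
  then show "\<forall>\<tau>\<in>D. f \<tau> = 0" by blast
qed

lemma discriminant_constant:
  assumes D: "open D" "connected D" and J: "solves_J D A B a b"
  obtains k where "\<And>\<tau>. \<tau> \<in> D \<Longrightarrow> (a \<tau>)\<^sup>2 + 32 * b \<tau> = k"
proof (rule zero_deriv_constant[OF D, of "\<lambda>\<tau>. (a \<tau>)\<^sup>2 + 32 * b \<tau>"])
  fix \<tau> assume t: "\<tau> \<in> D"
  note d = solves_J_dest[OF J t]
  show "((\<lambda>\<tau>. (a \<tau>)\<^sup>2 + 32 * b \<tau>) has_field_derivative 0) (at \<tau>)"
    by (rule DERIV_cong[OF DERIV_add[OF DERIV_power[OF d(3), of 2] DERIV_cmult[OF d(4), of 32]]]) simp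
qed (use that in blast)

text \<open>The equation for \<open>y\<close> is that for \<open>A\<close>, and the equation for \<open>u\<close> follows from that for \<open>B\<close>. The function \<open>a\<close>
  determines only \<open>z\<^sup>2\<close>, so that \<open>z\<close> times the defect of its equation vanishes; as both factors are
  holomorphic, one of them is zero, and either way the equation holds.\<close>

lemma J_imp_S:
  assumes D: "open D" "connected D" and hol: "x holomorphic_on D" "y holomorphic_on D" "z holomorphic_on D" "u holomorphic_on D"
    and J: "solves_J D A B a b"
    and p: "point_transf D x y z u I A B a b"
  shows "solves_S D x y z u"
proof -
  note r = point_transf_relations[OF p]
  have Ic: "continuous_on D I" using p by (simp add: point_transf_def)
  obtain k where k: "\<And>\<tau>. \<tau> \<in> D \<Longrightarrow> (a \<tau>)\<^sup>2 + 32 * b \<tau> = k" using discriminant_constant[OF D J] by blast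
  have "I \<tau> ^ 4 = - k / 144" if "\<tau> \<in> D" for \<tau>
    unfolding k[OF that, symmetric] point_transf_discriminant[OF p that] by simp
  then have "((I \<tau>)\<^sup>2)\<^sup>2 = - k / 144" if "\<tau> \<in> D" for \<tau>
    using that by (simp add: power_mult[symmetric])
  then have "(\<lambda>\<tau>. (I \<tau>)\<^sup>2) constant_on D"
    by (intro continuous_sqrt_constant[OF D(2)] continuous_intros Ic) auto
  then obtain k' where "\<And>\<tau>. \<tau> \<in> D \<Longrightarrow> (I \<tau>)\<^sup>2 = k'" by (auto simp: constant_on_def)
  then have "I constant_on D" by (rule continuous_sqrt_constant[OF D(2) Ic])
  then obtain c where I: "\<And>\<tau>. \<tau> \<in> D \<Longrightarrow> I \<tau> = c" by (auto simp: constant_on_def)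
  define v where "v = (\<lambda>\<tau>. u \<tau> - 2 * (y \<tau>)\<^sup>2 + (z \<tau>)\<^sup>2)"
  have tr: "(f has_field_derivative E) (at \<tau>)" if "(g has_field_derivative E) (at \<tau>)" "\<And>\<sigma>. \<sigma> \<in> D \<Longrightarrow> f \<sigma> = g \<sigma>" "\<tau> \<in> D" for f g E \<tau>
    by (rule has_field_derivative_transform_within_open[OF that(1) D(1) that(3)]) (simp add: that(2))
  have main: "(y has_field_derivative (u \<tau> + (y \<tau>)\<^sup>2 - 2 * (z \<tau>)\<^sup>2) * y \<tau>) (at \<tau>)
     \<and> ((\<lambda>\<tau>. (z \<tau>)\<^sup>2) has_field_derivative 2 * (z \<tau>)\<^sup>2 * v \<tau>) (at \<tau>)
     \<and> (x has_field_derivative (u \<tau> + (y \<tau>)\<^sup>2 + (z \<tau>)\<^sup>2) * x \<tau>) (at \<tau>)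
     \<and> (u has_field_derivative (u \<tau>)\<^sup>2 - y \<tau> ^ 4 + (y \<tau>)\<^sup>2 * (z \<tau>)\<^sup>2 - z \<tau> ^ 4) (at \<tau>)" if t: "\<tau> \<in> D" for \<tau>
  proof -
    note d = solves_J_dest[OF J t]
    have c: "c \<noteq> 0" using r(3)[OF t] I[OF t] by simp
    define K L where "K = (1 - \<i>) / (2 * c)" and "L = (1 + \<i>) / 2 * c"
    have KL: "2 * K * L = 1" using c by (simp add: K_def L_def field_simps)
    then have KL0: "K \<noteq> 0" "L \<noteq> 0" by auto
    have K2: "2 * K\<^sup>2 * c\<^sup>2 = - \<i>" using c by (simp add: K_def power_divide field_simps) (simp add: power2_eq_square algebra_simps)
    define X Y Z U where "X = x \<tau>" and "Y = y \<tau>" and "Z = z \<tau>" and "U = u \<tau>"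
    have X: "X \<noteq> 0" and Y: "Y \<noteq> 0" using r(1,2)[OF t] by (simp_all add: X_def Y_def)
    have A: "A \<sigma> = K * y \<sigma>" and B: "B \<sigma> = L * (u \<sigma> + (y \<sigma>)\<^sup>2 - 2 * (z \<sigma>)\<^sup>2) / y \<sigma>"
      and a: "a \<sigma> = - 12 * \<i> * c\<^sup>2 * (1 - 2 * ((z \<sigma>)\<^sup>2 / (y \<sigma>)\<^sup>2))"
      and b: "b \<sigma> = - 18 * c ^ 4 * ((z \<sigma>)\<^sup>2 * ((y \<sigma>)\<^sup>2 - (z \<sigma>)\<^sup>2) / y \<sigma> ^ 4)"
      and x: "of_real pi * c\<^sup>2 * (x \<sigma>)\<^sup>2 = (y \<sigma>)\<^sup>2 - (z \<sigma>)\<^sup>2" and y0: "y \<sigma> \<noteq> 0" if "\<sigma> \<in> D" for \<sigma>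
      using r(2,4-8)[OF that] I[OF that] by (simp_all add: K_def L_def)
    note vv = A[OF t, folded Y_def] B[OF t, folded Y_def Z_def U_def] a[OF t, folded Y_def Z_def] b[OF t, folded Y_def Z_def]
    define W where "W = U + Y\<^sup>2 - 2 * Z\<^sup>2"
    define V where "V = U - 2 * Y\<^sup>2 + Z\<^sup>2"
    have dy: "(y has_field_derivative W * Y) (at \<tau>)"
    proof -
      have "(y has_field_derivative (1 / K) * (2 * (A \<tau>)\<^sup>2 * B \<tau>)) (at \<tau>)"
        by (rule tr[OF DERIV_cmult[OF d(1)] _ t]) (use A KL0 in simp)
      also have "(1 / K) * (2 * (A \<tau>)\<^sup>2 * B \<tau>) = W * Y"
        unfolding vv W_def[symmetric] using Y KL KL0 by (simp add: divide_simps) algebra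
      finally show ?thesis .
    qed
    define s where "s = (\<lambda>\<sigma>. (1 + a \<sigma> / (12 * \<i> * c\<^sup>2)) / 2)"
    have s: "s \<sigma> = (z \<sigma>)\<^sup>2 / (y \<sigma>)\<^sup>2" if "\<sigma> \<in> D" for \<sigma>
      unfolding s_def a[OF that] using c by (simp add: field_simps)
    have ds: "(s has_field_derivative - 6 * Z\<^sup>2 * (Y\<^sup>2 - Z\<^sup>2) / Y\<^sup>2) (at \<tau>)"
    proof -
      have e: "- 16 * b \<tau> * (A \<tau>)\<^sup>2 = - 144 * \<i> * c\<^sup>2 * (Z\<^sup>2 * (Y\<^sup>2 - Z\<^sup>2) / Y\<^sup>2)"
        unfolding vv by (rule discriminant_scaling(1)[OF K2 Y])
      show ?thesis unfolding s_def
        by (rule DERIV_cong[OF DERIV_cdivide[OF DERIV_add[OF DERIV_const DERIV_cdivide[OF d(3)]]]])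
           (unfold e, use c Y in \<open>simp add: divide_simps\<close>)
    qed
    have dz2: "((\<lambda>\<tau>. (z \<tau>)\<^sup>2) has_field_derivative 2 * Z\<^sup>2 * V) (at \<tau>)"
    proof (rule tr[OF _ _ t])
      show "(z \<sigma>)\<^sup>2 = s \<sigma> * (y \<sigma>)\<^sup>2" if "\<sigma> \<in> D" for \<sigma> using s[OF that] y0[OF that] by simp
      show "((\<lambda>\<sigma>. s \<sigma> * (y \<sigma>)\<^sup>2) has_field_derivative 2 * Z\<^sup>2 * V) (at \<tau>)"
        by (rule DERIV_cong[OF DERIV_mult[OF ds DERIV_power[OF dy, of 2]]])
           (unfold s[OF t] W_def V_def, fold Y_def Z_def U_def, use Y in \<open>simp add: divide_simps\<close>, algebra)
    qed
    have dx: "(x has_field_derivative (U + Y\<^sup>2 + Z\<^sup>2) * X) (at \<tau>)"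
    proof -
      have hx: "(x has_field_derivative deriv x \<tau>) (at \<tau>)" by (rule holomorphic_derivI[OF hol(1) D(1) t])
      have "((\<lambda>\<sigma>. of_real pi * c\<^sup>2 * (x \<sigma>)\<^sup>2) has_field_derivative 2 * Y * (W * Y) - 2 * Z\<^sup>2 * V) (at \<tau>)"
        by (rule tr[OF DERIV_cong[OF DERIV_diff[OF DERIV_power[OF dy, of 2] dz2]] x t]) (simp add: Y_def)
      moreover have "((\<lambda>\<sigma>. of_real pi * c\<^sup>2 * (x \<sigma>)\<^sup>2) has_field_derivative of_real pi * c\<^sup>2 * (2 * X * deriv x \<tau>)) (at \<tau>)"
        by (rule DERIV_cong[OF DERIV_cmult[OF DERIV_power[OF hx, of 2]]]) (simp add: X_def)
      ultimately have "of_real pi * c\<^sup>2 * (2 * X * deriv x \<tau>) = 2 * Y * (W * Y) - 2 * Z\<^sup>2 * V"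
        using DERIV_unique by blast
      also have "\<dots> = 2 * (Y\<^sup>2 - Z\<^sup>2) * (U + Y\<^sup>2 + Z\<^sup>2)" unfolding W_def V_def by algebra
      also have "\<dots> = of_real pi * c\<^sup>2 * (2 * X * ((U + Y\<^sup>2 + Z\<^sup>2) * X))"
        unfolding x[OF t, folded X_def Y_def Z_def, symmetric] by algebra
      finally have "deriv x \<tau> = (U + Y\<^sup>2 + Z\<^sup>2) * X" using c X by simp
      then show ?thesis using hx by simp
    qed
    have du: "(u has_field_derivative U\<^sup>2 - Y ^ 4 + Y\<^sup>2 * Z\<^sup>2 - Z ^ 4) (at \<tau>)"
    proof (rule tr[OF _ _ t])
      show "u \<sigma> = (1 / L) * (B \<sigma> * y \<sigma>) - (y \<sigma>)\<^sup>2 + 2 * (z \<sigma>)\<^sup>2" if "\<sigma> \<in> D" for \<sigma>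
        unfolding B[OF that] using y0[OF that] KL0 by simp
      have e: "(1 / L) * (b \<tau> * A \<tau> ^ 3 * Y) = 9 * Z\<^sup>2 * (Y\<^sup>2 - Z\<^sup>2)"
      proof -
        have "9 * L = - 18 * c ^ 4 * K ^ 3"
        proof -
          have "4 * K ^ 4 * c ^ 4 = (2 * K\<^sup>2 * c\<^sup>2)\<^sup>2" by algebra
          also have "\<dots> = - 1" unfolding K2 by simp
          finally show ?thesis using KL by algebra
        qed
        then have "L = - 2 * c ^ 4 * K ^ 3" by simp
        then show ?thesis unfolding vv using Y KL0 by (simp add: divide_simps power3_eq_cube power4_eq_xxxx)
      qed
      have e2: "(1 / L) * (B \<tau> * (W * Y)) = W\<^sup>2" unfolding vv W_def[symmetric] using Y KL0 by (simp add: power2_eq_square)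
      have "((\<lambda>\<sigma>. (1 / L) * (B \<sigma> * y \<sigma>) - (y \<sigma>)\<^sup>2 + 2 * (z \<sigma>)\<^sup>2) has_field_derivative
         (1 / L) * (b \<tau> * A \<tau> ^ 3 * Y) + (1 / L) * (B \<tau> * (W * Y)) - 2 * Y * (W * Y) + 2 * (2 * Z\<^sup>2 * V)) (at \<tau>)"
        by (rule DERIV_cong[OF DERIV_add[OF DERIV_diff[OF DERIV_cmult[OF DERIV_mult[OF d(2) dy]] DERIV_power[OF dy, of 2]] DERIV_cmult[OF dz2]]])
           (fold Y_def, simp add: distrib_left mult_ac)
      then show "((\<lambda>\<sigma>. (1 / L) * (B \<sigma> * y \<sigma>) - (y \<sigma>)\<^sup>2 + 2 * (z \<sigma>)\<^sup>2) has_field_derivative U\<^sup>2 - Y ^ 4 + Y\<^sup>2 * Z\<^sup>2 - Z ^ 4) (at \<tau>)"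
        unfolding e e2 unfolding W_def V_def by (rule DERIV_cong) algebra
    qed
    show ?thesis using dy dz2 dx du unfolding W_def V_def X_def Y_def Z_def U_def v_def by blast
  qed
  have dz: "(z has_field_derivative deriv z \<tau>) (at \<tau>)" if "\<tau> \<in> D" for \<tau>
    by (rule holomorphic_derivI[OF hol(3) D(1) that])
  have zz: "z \<tau> * (deriv z \<tau> - z \<tau> * v \<tau>) = 0" if t: "\<tau> \<in> D" for \<tau>
  proof -
    have "((\<lambda>\<tau>. (z \<tau>)\<^sup>2) has_field_derivative 2 * z \<tau> * deriv z \<tau>) (at \<tau>)"
      by (rule DERIV_cong[OF DERIV_power[OF dz[OF t], of 2]]) simp
    then have "2 * z \<tau> * deriv z \<tau> = 2 * (z \<tau>)\<^sup>2 * v \<tau>" using main[OF t] DERIV_unique by blast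
    then show ?thesis by (simp add: algebra_simps power2_eq_square)
  qed
  have "(\<lambda>\<tau>. deriv z \<tau> - z \<tau> * v \<tau>) holomorphic_on D"
    unfolding v_def by (intro holomorphic_intros holomorphic_deriv hol D)
  from holomorphic_mult_zero[OF D hol(3) this zz]
  have zd: "deriv z \<tau> = v \<tau> * z \<tau>" if t: "\<tau> \<in> D" for \<tau>
  proof
    assume z0: "\<forall>\<tau>\<in>D. z \<tau> = 0"
    then have "(z has_field_derivative 0) (at \<tau>)" by (intro tr[OF DERIV_const _ t]) simp
    then show ?thesis using z0 t dz[OF t] DERIV_unique by fastforce
  next
    assume "\<forall>\<tau>\<in>D. deriv z \<tau> - z \<tau> * v \<tau> = 0"
    then show ?thesis using t by (simp add: mult.commute)
  qed
  show ?thesis unfolding solves_S_def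
    using main dz zd unfolding v_def by metis
qed

lemma solves_S_holomorphic:
  assumes "open D" "solves_S D x y z u"
  shows "x holomorphic_on D" "y holomorphic_on D" "z holomorphic_on D" "u holomorphic_on D"
  using solves_S_dest[OF assms(2)] unfolding holomorphic_on_open[OF assms(1)] by blast+

lemma S_imp_I_constant:
  assumes D: "open D" "connected D" and s: "solves_S D x y z u"
    and p: "point_transf D x y z u I A B a b"
  shows "I constant_on D"
proof -
  note r = point_transf_relations[OF p]
  obtain k where k: "\<And>\<tau>. \<tau> \<in> D \<Longrightarrow> ((y \<tau>)\<^sup>2 - (z \<tau>)\<^sup>2) / (x \<tau>)\<^sup>2 = k"
    using S_integral_constant[OF D s] r(1) by blast
  have "(I \<tau>)\<^sup>2 = k / of_real pi" if "\<tau> \<in> D" for \<tau>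
    using k[OF that] r(1)[OF that] unfolding r(4)[OF that, symmetric] by (simp add: field_simps)
  moreover have "continuous_on D I" using p by (simp add: point_transf_def)
  ultimately show ?thesis using continuous_sqrt_constant[OF D(2)] by blast
qed

lemma S_iff_J:
  assumes D: "open D" "connected D" and hol: "x holomorphic_on D" "y holomorphic_on D" "z holomorphic_on D" "u holomorphic_on D"
    and p: "point_transf D x y z u I A B a b"
  shows "solves_S D x y z u \<longleftrightarrow> solves_J D A B a b"
proof
  assume s: "solves_S D x y z u"
  then obtain c where "\<And>\<tau>. \<tau> \<in> D \<Longrightarrow> I \<tau> = c" using S_imp_I_constant[OF D s p] by (auto simp: constant_on_def)
  then show "solves_J D A B a b" by (rule S_imp_J[OF D(1) s p])
next
  assume "solves_J D A B a b"
  then show "solves_S D x y z u" using J_imp_S[OF D hol _ p] by blast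
qed

text \<open>The zero set is open by uniqueness and closed by continuity.\<close>

lemma linear_ode_zero_free:
  fixes f g :: "complex \<Rightarrow> complex"
  assumes D: "open D" "connected D" and g: "continuous_on D g"
    and f: "\<And>\<tau>. \<tau> \<in> D \<Longrightarrow> (f has_field_derivative g \<tau> * f \<tau>) (at \<tau>)"
  shows "(\<forall>\<tau>\<in>D. f \<tau> = 0) \<or> (\<forall>\<tau>\<in>D. f \<tau> \<noteq> 0)"
proof -
  define N where "N = D \<inter> f -` {0}"
  have cf: "continuous_on D f" using f DERIV_isCont continuous_at_imp_continuous_on by blast
  have "open N" unfolding open_contains_ball
  proof
    fix a assume a: "a \<in> N"
    then have aD: "a \<in> D" "f a = 0" by (auto simp: N_def)
    obtain r where r: "r > 0" "ball a r \<subseteq> D" "\<And>i \<tau>. i < (1::nat) \<Longrightarrow> \<tau> \<in> ball a r \<Longrightarrow> f \<tau> = 0"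
      using linear_system_vanishes[of D a 1 "\<lambda>_ _. g" "\<lambda>_. f", OF D(1) aD(1)] g f aD(2) by auto
    then have "ball a r \<subseteq> N" by (auto simp: N_def)
    with r(1) show "\<exists>e>0. ball a e \<subseteq> N" by blast
  qed
  then have "openin (top_of_set D) N" by (intro open_subset) (auto simp: N_def)
  moreover have "closedin (top_of_set D) N"
    unfolding N_def by (rule continuous_closedin_preimage[OF cf closed_singleton])
  ultimately have "N = {} \<or> N = D" using D(2) unfolding connected_clopen by blast
  then show ?thesis by (auto simp: N_def)
qed

text \<open>Put \<open>s = z\<^sup>2 / y\<^sup>2\<close>. The relation for \<open>a\<close> gives \<open>s\<close> once \<open>J2 = I\<^sup>2\<close> is chosen among the two square roots of
  \<open>- k / 144\<close>, and then \<open>s (1 - s) = 8 b / k\<close>. Holomorphic square roots of \<open>s\<close> and \<open>1 - s\<close> are needed, and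
  \<open>1 - s\<close> must not vanish because \<open>x\<close> must not. If \<open>b\<close> has no zeros this is automatic. If \<open>b\<close> is identically
  zero, \<open>s\<close> is constantly \<open>0\<close> or \<open>1\<close>, and the sign of \<open>J2\<close> is chosen to make it \<open>0\<close>.\<close>

lemma J_solution_lifts:
  assumes D: "open D" "simply_connected D" and J: "solves_J D A B a b"
    and nz: "\<And>\<tau>. \<tau> \<in> D \<Longrightarrow> A \<tau> \<noteq> 0" "\<And>\<tau>. \<tau> \<in> D \<Longrightarrow> (a \<tau>)\<^sup>2 + 32 * b \<tau> \<noteq> 0"
  obtains x y z u I where "solves_S D x y z u" "point_transf D x y z u I A B a b"
proof (cases "D = {}")
  case True
  then show ?thesis using that by (simp add: solves_S_def point_transf_def)
next
  case False
  have conn: "connected D" using D(2) by (rule simply_connected_imp_connected)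
  have sqrt: "\<exists>g. g holomorphic_on D \<and> (\<forall>\<tau>\<in>D. f \<tau> = (g \<tau>)\<^sup>2)" if "f holomorphic_on D" "\<And>\<tau>. \<tau> \<in> D \<Longrightarrow> f \<tau> \<noteq> 0" for f
    using D(2) that unfolding simply_connected_eq_holomorphic_sqrt[OF D(1)] by blast
  note d = solves_J_dest[OF J]
  have hol: "A holomorphic_on D" "B holomorphic_on D" "a holomorphic_on D" "b holomorphic_on D"
    using d unfolding holomorphic_on_open[OF D(1)] by blast+
  obtain k where k: "\<And>\<tau>. \<tau> \<in> D \<Longrightarrow> (a \<tau>)\<^sup>2 + 32 * b \<tau> = k" using discriminant_constant[OF D(1) conn J] by blast
  have k0: "k \<noteq> 0" using k nz(2) False by force
  have bz: "(\<forall>\<tau>\<in>D. b \<tau> = 0) \<or> (\<forall>\<tau>\<in>D. b \<tau> \<noteq> 0)"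
  proof (rule linear_ode_zero_free[OF D(1) conn, of "\<lambda>\<tau>. a \<tau> * (A \<tau>)\<^sup>2"])
    show "continuous_on D (\<lambda>\<tau>. a \<tau> * (A \<tau>)\<^sup>2)"
      by (intro continuous_intros holomorphic_on_imp_continuous_on hol)
    show "(b has_field_derivative a \<tau> * (A \<tau>)\<^sup>2 * b \<tau>) (at \<tau>)" if "\<tau> \<in> D" for \<tau>
      using d(4)[OF that] by (simp add: mult_ac)
  qed
  have "\<exists>J2 f. J2\<^sup>2 = - k / 144 \<and> f holomorphic_on D \<and> (\<forall>\<tau>\<in>D. (1 + a \<tau> / (12 * \<i> * J2)) / 2 = (f \<tau>)\<^sup>2 \<and> (f \<tau>)\<^sup>2 \<noteq> 1)"
    using bz
  proof
    assume b0: "\<forall>\<tau>\<in>D. b \<tau> = 0"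
    have "((a has_field_derivative 0) (at \<tau>))" if "\<tau> \<in> D" for \<tau> using d(3)[OF that] b0 that by simp
    then obtain a0 where a0: "\<And>\<tau>. \<tau> \<in> D \<Longrightarrow> a \<tau> = a0" using zero_deriv_constant[OF D(1) conn] by blast
    have ka: "k = a0\<^sup>2" using k b0 a0 False by force
    then have "a0 \<noteq> 0" using k0 by auto
    then show ?thesis using a0 ka
      by (intro exI[of _ "- (a0 / (12 * \<i>))"] exI[of _ "\<lambda>_. 0"]) (auto simp: power_divide power_mult_distrib)
  next
    assume b1: "\<forall>\<tau>\<in>D. b \<tau> \<noteq> 0"
    define J2 where "J2 = csqrt (- k / 144)"
    have J2: "J2\<^sup>2 = - k / 144" by (simp add: J2_def)
    then have J0: "J2 \<noteq> 0" using k0 by auto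
    define s where "s = (\<lambda>\<tau>. (1 + a \<tau> / (12 * \<i> * J2)) / 2)"
    have sb: "s \<tau> * (1 - s \<tau>) = 8 * b \<tau> / k" if "\<tau> \<in> D" for \<tau>
    proof -
      have "4 * ((1 + w) / 2 * (1 - (1 + w) / 2)) = 1 - w\<^sup>2" for w :: complex
        by (simp add: field_simps power2_eq_square)
      then have "4 * (s \<tau> * (1 - s \<tau>)) = 1 - (a \<tau> / (12 * \<i> * J2))\<^sup>2" unfolding s_def .
      also have "(a \<tau> / (12 * \<i> * J2))\<^sup>2 = (a \<tau>)\<^sup>2 / k"
        unfolding power_divide power_mult_distrib J2 by simp
      also have "1 - (a \<tau>)\<^sup>2 / k = 4 * (8 * b \<tau> / k)" using k[OF that] k0 by (simp add: field_simps)
      finally show ?thesis by (simp only: mult_cancel_left) simp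
    qed
    have "s holomorphic_on D" unfolding s_def by (intro holomorphic_intros hol) (use J0 in auto)
    moreover have s01: "s \<tau> \<noteq> 0 \<and> s \<tau> \<noteq> 1" if "\<tau> \<in> D" for \<tau> using sb[OF that] b1 that k0 by auto
    ultimately obtain f where "f holomorphic_on D" "\<forall>\<tau>\<in>D. s \<tau> = (f \<tau>)\<^sup>2" using sqrt[of s] by blast
    then show ?thesis using J2 s01 by (intro exI[of _ J2] exI[of _ f]) (auto simp: s_def)
  qed
  then obtain J2 f where J2: "J2\<^sup>2 = - k / 144" and fh: "f holomorphic_on D"
    and f: "\<And>\<tau>. \<tau> \<in> D \<Longrightarrow> (1 + a \<tau> / (12 * \<i> * J2)) / 2 = (f \<tau>)\<^sup>2" "\<And>\<tau>. \<tau> \<in> D \<Longrightarrow> (f \<tau>)\<^sup>2 \<noteq> 1" by blast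
  have J0: "J2 \<noteq> 0" using J2 k0 by auto
  define c where "c = csqrt J2"
  have c: "c\<^sup>2 = J2" "c \<noteq> 0" using J0 by (auto simp: c_def)
  have "(\<lambda>\<tau>. 1 - (f \<tau>)\<^sup>2) holomorphic_on D" by (intro holomorphic_intros fh)
  then obtain g where gh: "g holomorphic_on D" and g: "\<And>\<tau>. \<tau> \<in> D \<Longrightarrow> 1 - (f \<tau>)\<^sup>2 = (g \<tau>)\<^sup>2"
    using sqrt[of "\<lambda>\<tau>. 1 - (f \<tau>)\<^sup>2"] f(2) by auto
  have g0: "g \<tau> \<noteq> 0" if "\<tau> \<in> D" for \<tau> using g[OF that] f(2)[OF that] by auto
  define sp where "sp = csqrt (of_real pi)"
  have sp: "sp\<^sup>2 = of_real pi" by (simp only: sp_def power2_csqrt)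
  then have sp0: "sp \<noteq> 0" by auto
  define y where "y = (\<lambda>\<tau>. (1 + \<i>) * c * A \<tau>)"
  define x where "x = (\<lambda>\<tau>. y \<tau> * g \<tau> / (sp * c))"
  define z where "z = (\<lambda>\<tau>. y \<tau> * f \<tau>)"
  define L where "L = (1 + \<i>) / 2 * c"
  have i1: "1 + \<i> \<noteq> 0" by (simp add: complex_eq_iff)
  have L: "L \<noteq> 0" using c(2) i1 by (simp add: L_def)
  define u where "u = (\<lambda>\<tau>. B \<tau> * y \<tau> / L - (y \<tau>)\<^sup>2 + 2 * (z \<tau>)\<^sup>2)"
  have hy: "y holomorphic_on D" unfolding y_def by (intro holomorphic_intros hol)
  have hx: "x holomorphic_on D" unfolding x_def by (intro holomorphic_intros hy gh) (use sp0 c in auto)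
  have hz: "z holomorphic_on D" unfolding z_def by (intro holomorphic_intros hy fh)
  have hu: "u holomorphic_on D" unfolding u_def by (intro holomorphic_intros hy hz hol) (use L in auto)
  have y0: "y \<tau> \<noteq> 0" if "\<tau> \<in> D" for \<tau> using nz(1)[OF that] c(2) i1 by (simp add: y_def)
  have p: "point_transf D x y z u (\<lambda>_. c) A B a b"
    unfolding point_transf_def
  proof (intro conjI ballI)
    show "continuous_on D (\<lambda>_. c)" by (rule continuous_on_const)
    fix \<tau> assume t: "\<tau> \<in> D"
    note y0 = y0[OF t] and g0 = g0[OF t] and f = f[OF t] and g = g[OF t]
    show x0: "x \<tau> \<noteq> 0" using y0 g0 sp0 c by (simp add: x_def)
    show "y \<tau> \<noteq> 0" "c \<noteq> 0" using y0 c by auto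
    have yz: "(y \<tau>)\<^sup>2 - (z \<tau>)\<^sup>2 = (y \<tau>)\<^sup>2 * (g \<tau>)\<^sup>2" unfolding z_def g[symmetric] by (simp add: power_mult_distrib algebra_simps)
    show P: "of_real pi * c\<^sup>2 = ((y \<tau>)\<^sup>2 - (z \<tau>)\<^sup>2) / (x \<tau>)\<^sup>2"
      unfolding yz x_def using y0 g0 sp sp0 c(2) by (simp add: power_divide power_mult_distrib)
    show "A \<tau> = (1 - \<i>) / (2 * c) * y \<tau>"
    proof -
      have "(1 - \<i>) / (2 * c) * y \<tau> = ((1 - \<i>) * (1 + \<i>)) / 2 * A \<tau>" using c(2) by (simp add: y_def)
      also have "(1 - \<i>) * (1 + \<i>) = 2" by (simp add: algebra_simps)
      finally show ?thesis by simp
    qed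
    show "B \<tau> = (1 + \<i>) / 2 * (c / y \<tau>) * (u \<tau> + (y \<tau>)\<^sup>2 - 2 * (z \<tau>)\<^sup>2)"
    proof -
      have "(1 + \<i>) / 2 * (c / y \<tau>) * (u \<tau> + (y \<tau>)\<^sup>2 - 2 * (z \<tau>)\<^sup>2) = L * (B \<tau> * y \<tau> / L) / y \<tau>"
        by (simp add: u_def L_def)
      then show ?thesis using L y0 by simp
    qed
    show "a \<tau> = 12 / (of_real pi * \<i>) * (((y \<tau>)\<^sup>2 - (z \<tau>)\<^sup>2) / (x \<tau>)\<^sup>2) * (((y \<tau>)\<^sup>2 - 2 * (z \<tau>)\<^sup>2) / (y \<tau>)\<^sup>2)"
    proof -
      have "((y \<tau>)\<^sup>2 - 2 * (z \<tau>)\<^sup>2) / (y \<tau>)\<^sup>2 = 1 - 2 * (f \<tau>)\<^sup>2"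
        unfolding z_def using y0 by (simp add: power_mult_distrib diff_divide_distrib)
      also have "\<dots> = - (a \<tau> / (12 * \<i> * J2))"
      proof -
        have "1 - 2 * ((1 + w) / 2) = - w" for w :: complex by (simp add: field_simps)
        then show ?thesis unfolding f(1)[symmetric] .
      qed
      finally show ?thesis unfolding P[symmetric] c(1) using J0 by simp
    qed
    show "b \<tau> = - (18 / (of_real pi)\<^sup>2) * ((z \<tau>)\<^sup>2 / (x \<tau> ^ 4 * y \<tau> ^ 4)) * ((y \<tau>)\<^sup>2 - (z \<tau>)\<^sup>2) ^ 3"
    proof -
      have e1: "((y \<tau>)\<^sup>2 - (z \<tau>)\<^sup>2) ^ 3 = (of_real pi * c\<^sup>2 * (x \<tau>)\<^sup>2)\<^sup>2 * ((y \<tau>)\<^sup>2 * (g \<tau>)\<^sup>2)"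
        unfolding P yz using x0 by (simp add: power2_eq_square power3_eq_cube)
      have "- (18 / (of_real pi)\<^sup>2) * ((z \<tau>)\<^sup>2 / (x \<tau> ^ 4 * y \<tau> ^ 4)) * ((y \<tau>)\<^sup>2 - (z \<tau>)\<^sup>2) ^ 3 = - 18 * J2\<^sup>2 * ((f \<tau>)\<^sup>2 * (g \<tau>)\<^sup>2)"
        unfolding e1 unfolding z_def c(1) using x0 y0 by (simp add: power_mult_distrib power_mult[symmetric] field_simps power2_eq_square power4_eq_xxxx)
      also have "(f \<tau>)\<^sup>2 * (g \<tau>)\<^sup>2 = (1 - (a \<tau> / (12 * \<i> * J2))\<^sup>2) / 4"
      proof -
        have "(1 + w) / 2 * (1 - (1 + w) / 2) = (1 - w\<^sup>2) / 4" for w :: complex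
          by (simp add: field_simps power2_eq_square)
        then show ?thesis unfolding g[symmetric] f(1)[symmetric] .
      qed
      also have "(a \<tau> / (12 * \<i> * J2))\<^sup>2 = (a \<tau>)\<^sup>2 / k"
        unfolding power_divide power_mult_distrib J2 by simp
      also have "- 18 * J2\<^sup>2 * ((1 - (a \<tau>)\<^sup>2 / k) / 4) = (k - (a \<tau>)\<^sup>2) / 32"
        unfolding J2 using k0 by (simp add: field_simps)
      also have "\<dots> = b \<tau>" unfolding k[OF t, symmetric] by simp
      finally show ?thesis ..
    qed
  qed
  have "solves_S D x y z u" using S_iff_J[OF D(1) conn hx hy hz hu p] J by blast
  then show ?thesis using p by (rule that)
qed

section \<open>The elementary solution\<close>

lemma elementary_solution_solves_S:
  assumes s: "s \<in> {1, - 1}"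
  shows "solves_S {\<tau>. \<gamma> * \<tau> + \<delta> \<noteq> 0} (\<lambda>\<tau>. 0) (\<lambda>\<tau>. s / (\<gamma> * \<tau> + \<delta>)) (\<lambda>\<tau>. 1 / (\<gamma> * \<tau> + \<delta>))
          (\<lambda>\<tau>. - (\<gamma>\<^sup>2 * \<tau> + \<gamma> * \<delta> - 1) / (\<gamma> * \<tau> + \<delta>)\<^sup>2)"
  unfolding solves_S_def
proof (intro ballI conjI)
  fix \<tau> assume "\<tau> \<in> {\<tau>. \<gamma> * \<tau> + \<delta> \<noteq> 0}"
  then have w0: "\<gamma> * \<tau> + \<delta> \<noteq> 0" by simp
  define w where "w = \<gamma> * \<tau> + \<delta>"
  have w: "w \<noteq> 0" using w0 by (simp add: w_def)
  have s2: "s\<^sup>2 = 1" "s ^ 4 = 1" using s by auto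
  have wd: "((\<lambda>\<tau>. \<gamma> * \<tau> + \<delta>) has_field_derivative \<gamma>) (at \<tau>)" by (auto intro!: derivative_eq_intros)
  have u: "- (\<gamma>\<^sup>2 * \<tau> + \<gamma> * \<delta> - 1) = 1 - \<gamma> * w" by (simp add: w_def algebra_simps power2_eq_square)
  show "((\<lambda>\<tau>. 0) has_field_derivative (- (\<gamma>\<^sup>2 * \<tau> + \<gamma> * \<delta> - 1) / (\<gamma> * \<tau> + \<delta>)\<^sup>2 + (s / (\<gamma> * \<tau> + \<delta>))\<^sup>2 + (1 / (\<gamma> * \<tau> + \<delta>))\<^sup>2) * 0) (at \<tau>)" by simp
  show "((\<lambda>\<tau>. s / (\<gamma> * \<tau> + \<delta>)) has_field_derivative
     (- (\<gamma>\<^sup>2 * \<tau> + \<gamma> * \<delta> - 1) / (\<gamma> * \<tau> + \<delta>)\<^sup>2 + (s / (\<gamma> * \<tau> + \<delta>))\<^sup>2 - 2 * (1 / (\<gamma> * \<tau> + \<delta>))\<^sup>2) * (s / (\<gamma> * \<tau> + \<delta>))) (at \<tau>)"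
    by (rule DERIV_cong[OF DERIV_divide[OF DERIV_const wd w0]])
       (unfold u w_def[symmetric] power_divide s2, use w in \<open>simp add: field_simps power2_eq_square\<close>)
  show "((\<lambda>\<tau>. 1 / (\<gamma> * \<tau> + \<delta>)) has_field_derivative
     (- (\<gamma>\<^sup>2 * \<tau> + \<gamma> * \<delta> - 1) / (\<gamma> * \<tau> + \<delta>)\<^sup>2 - 2 * (s / (\<gamma> * \<tau> + \<delta>))\<^sup>2 + (1 / (\<gamma> * \<tau> + \<delta>))\<^sup>2) * (1 / (\<gamma> * \<tau> + \<delta>))) (at \<tau>)"
    by (rule DERIV_cong[OF DERIV_divide[OF DERIV_const wd w0]])
       (unfold u w_def[symmetric] power_divide s2, use w in \<open>simp add: field_simps power2_eq_square\<close>)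
  have w2: "(\<gamma> * \<tau> + \<delta>)\<^sup>2 \<noteq> 0" using w0 by simp
  have nd: "((\<lambda>\<tau>. - (\<gamma>\<^sup>2 * \<tau> + \<gamma> * \<delta> - 1)) has_field_derivative - \<gamma>\<^sup>2) (at \<tau>)" by (auto intro!: derivative_eq_intros)
  show "((\<lambda>\<tau>. - (\<gamma>\<^sup>2 * \<tau> + \<gamma> * \<delta> - 1) / (\<gamma> * \<tau> + \<delta>)\<^sup>2) has_field_derivative
     (- (\<gamma>\<^sup>2 * \<tau> + \<gamma> * \<delta> - 1) / (\<gamma> * \<tau> + \<delta>)\<^sup>2)\<^sup>2 - (s / (\<gamma> * \<tau> + \<delta>)) ^ 4 +
       (s / (\<gamma> * \<tau> + \<delta>))\<^sup>2 * (1 / (\<gamma> * \<tau> + \<delta>))\<^sup>2 - (1 / (\<gamma> * \<tau> + \<delta>)) ^ 4) (at \<tau>)"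
    by (rule DERIV_cong[OF DERIV_divide[OF nd DERIV_power[OF wd, of 2] w2]])
       (unfold u w_def[symmetric] power_divide s2, use w in \<open>simp add: divide_simps power2_eq_square power4_eq_xxxx\<close>, use w in \<open>simp add: algebra_simps\<close>)
qed

text \<open>With \<open>v = u - z\<^sup>2\<close> the equations reduce to \<open>z' = v z\<close>, \<open>y' = v y\<close> and \<open>v' = v\<^sup>2\<close>, so that
  \<open>v / z\<close> and \<open>y / z\<close> are constant.\<close>

lemma elementary_solution_complete:
  assumes D: "open D" "connected D" and s: "solves_S D x y z u"
    and e: "\<And>\<tau>. \<tau> \<in> D \<Longrightarrow> (y \<tau>)\<^sup>2 = (z \<tau>)\<^sup>2 \<and> z \<tau> \<noteq> 0"
  shows "\<exists>\<gamma> \<delta> s. s \<in> {1, -1} \<and> (\<forall>\<tau>\<in>D. \<gamma> * \<tau> + \<delta> \<noteq> 0 \<and>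
           y \<tau> = s / (\<gamma> * \<tau> + \<delta>) \<and> z \<tau> = 1 / (\<gamma> * \<tau> + \<delta>) \<and>
           u \<tau> = - (\<gamma>\<^sup>2 * \<tau> + \<gamma> * \<delta> - 1) / (\<gamma> * \<tau> + \<delta>)\<^sup>2)"
proof -
  note d = solves_S_dest[OF s]
  have z4: "y \<tau> ^ 4 = z \<tau> ^ 4" if "\<tau> \<in> D" for \<tau>
  proof -
    have "y \<tau> ^ 4 = ((y \<tau>)\<^sup>2)\<^sup>2" by simp
    also have "\<dots> = ((z \<tau>)\<^sup>2)\<^sup>2" using e[OF that] by simp
    finally show ?thesis by simp
  qed
  have zd: "(z has_field_derivative (u \<tau> - (z \<tau>)\<^sup>2) * z \<tau>) (at \<tau>)" if "\<tau> \<in> D" for \<tau>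
    using d(3)[OF that] e[OF that] by simp
  have yd: "(y has_field_derivative (u \<tau> - (z \<tau>)\<^sup>2) * y \<tau>) (at \<tau>)" if "\<tau> \<in> D" for \<tau>
    using d(2)[OF that] e[OF that] by simp
  have ud: "(u has_field_derivative (u \<tau>)\<^sup>2 - z \<tau> ^ 4) (at \<tau>)" if "\<tau> \<in> D" for \<tau>
  proof (rule DERIV_cong[OF d(4)[OF that]])
    have "(y \<tau>)\<^sup>2 * (z \<tau>)\<^sup>2 = z \<tau> ^ 4" using e[OF that] by (simp add: power4_eq_xxxx power2_eq_square)
    then show "(u \<tau>)\<^sup>2 - y \<tau> ^ 4 + (y \<tau>)\<^sup>2 * (z \<tau>)\<^sup>2 - z \<tau> ^ 4 = (u \<tau>)\<^sup>2 - z \<tau> ^ 4"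
      unfolding z4[OF that] by simp
  qed
  obtain \<gamma> where \<gamma>: "\<And>\<tau>. \<tau> \<in> D \<Longrightarrow> - (u \<tau> - (z \<tau>)\<^sup>2) / z \<tau> = \<gamma>"
  proof (rule zero_deriv_constant[OF D, of "\<lambda>\<tau>. - (u \<tau> - (z \<tau>)\<^sup>2) / z \<tau>"])
    fix \<tau> assume t: "\<tau> \<in> D"
    have z: "z \<tau> \<noteq> 0" using e[OF t] by simp
    show "((\<lambda>\<tau>. - (u \<tau> - (z \<tau>)\<^sup>2) / z \<tau>) has_field_derivative 0) (at \<tau>)"
      by (rule DERIV_cong[OF DERIV_divide[OF DERIV_minus[OF DERIV_diff[OF ud[OF t] DERIV_power[OF zd[OF t], of 2]]] zd[OF t] z]])
         (use z in \<open>simp add: field_simps power2_eq_square power4_eq_xxxx\<close>)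
  qed blast
  obtain \<delta> where \<delta>: "\<And>\<tau>. \<tau> \<in> D \<Longrightarrow> 1 / z \<tau> - \<gamma> * \<tau> = \<delta>"
  proof (rule zero_deriv_constant[OF D, of "\<lambda>\<tau>. 1 / z \<tau> - \<gamma> * \<tau>"])
    fix \<tau> assume t: "\<tau> \<in> D"
    have z: "z \<tau> \<noteq> 0" using e[OF t] by simp
    show "((\<lambda>\<tau>. 1 / z \<tau> - \<gamma> * \<tau>) has_field_derivative 0) (at \<tau>)"
      by (rule DERIV_cong[OF DERIV_diff[OF DERIV_divide[OF DERIV_const zd[OF t] z] DERIV_cmult[OF DERIV_ident]]])
         (unfold \<gamma>[OF t, symmetric], use z in \<open>simp add: field_simps power2_eq_square\<close>)
  qed blast
  obtain s where s: "\<And>\<tau>. \<tau> \<in> D \<Longrightarrow> y \<tau> / z \<tau> = s"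
  proof (rule zero_deriv_constant[OF D, of "\<lambda>\<tau>. y \<tau> / z \<tau>"])
    fix \<tau> assume t: "\<tau> \<in> D"
    have z: "z \<tau> \<noteq> 0" using e[OF t] by simp
    show "((\<lambda>\<tau>. y \<tau> / z \<tau>) has_field_derivative 0) (at \<tau>)"
      by (rule DERIV_cong[OF DERIV_divide[OF yd[OF t] zd[OF t] z]]) (simp add: mult_ac)
  qed blast
  \<comment> \<open>For empty \<open>D\<close> the constant \<open>s\<close> is arbitrary.\<close>
  define s' where "s' = (if D = {} then 1 else s)"
  have s': "s' \<in> {1, - 1}"
  proof (cases "D = {}")
    case False
    then obtain \<tau> where t: "\<tau> \<in> D" by blast
    have "s\<^sup>2 = 1" using e[OF t] unfolding s[OF t, symmetric] by (simp add: power_divide)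
    then show ?thesis using False by (simp add: s'_def power2_eq_1_iff)
  qed (simp add: s'_def)
  have "\<gamma> * \<tau> + \<delta> \<noteq> 0 \<and> y \<tau> = s' / (\<gamma> * \<tau> + \<delta>) \<and> z \<tau> = 1 / (\<gamma> * \<tau> + \<delta>) \<and>
           u \<tau> = - (\<gamma>\<^sup>2 * \<tau> + \<gamma> * \<delta> - 1) / (\<gamma> * \<tau> + \<delta>)\<^sup>2" if t: "\<tau> \<in> D" for \<tau>
  proof -
    have z: "z \<tau> \<noteq> 0" using e[OF t] by simp
    have w: "\<gamma> * \<tau> + \<delta> = 1 / z \<tau>" unfolding \<delta>[OF t, symmetric] by simp
    have "- (\<gamma>\<^sup>2 * \<tau> + \<gamma> * \<delta> - 1) = 1 - \<gamma> * (\<gamma> * \<tau> + \<delta>)" by (simp add: algebra_simps power2_eq_square)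
    then have n: "- (\<gamma>\<^sup>2 * \<tau> + \<gamma> * \<delta> - 1) = 1 - \<gamma> * (1 / z \<tau>)" unfolding w .
    have "u \<tau> = (z \<tau>)\<^sup>2 - \<gamma> * z \<tau>" using z unfolding \<gamma>[OF t, symmetric] by (simp add: field_simps)
    moreover have "(1 - \<gamma> * (1 / z \<tau>)) / (1 / z \<tau>)\<^sup>2 = (z \<tau>)\<^sup>2 - \<gamma> * z \<tau>"
      using z by (simp add: power2_eq_square field_simps)
    ultimately have "u \<tau> = (1 - \<gamma> * (1 / z \<tau>)) / (1 / z \<tau>)\<^sup>2" by simp
    moreover have "s' = y \<tau> / z \<tau>" using t s[OF t] by (auto simp: s'_def)
    ultimately show ?thesis unfolding n w using z by simp
  qed
  then show ?thesis using s' by blast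
qed

section \<open>Jacobi's system and both families of solutions\<close>

theorem theorem5:
  shows
   "((\<forall>D x y z u. open D \<and> connected D \<and> solves_S D x y z u \<and> (\<forall>\<tau>\<in>D. x \<tau> \<noteq> 0) \<longrightarrow>
        (\<exists>c::complex. \<forall>\<tau>\<in>D. of_real pi * c\<^sup>2 = ((y \<tau>)\<^sup>2 - (z \<tau>)\<^sup>2) / (x \<tau>)\<^sup>2)) \<and>
     (\<forall>D x y z u I A B a b. open D \<and> connected D \<and>
        x holomorphic_on D \<and> y holomorphic_on D \<and> z holomorphic_on D \<and> u holomorphic_on D \<and>
        point_transf D x y z u I A B a b \<longrightarrow>
          (solves_S D x y z u \<longrightarrow> I constant_on D) \<and>
          (solves_S D x y z u \<longleftrightarrow> solves_J D A B a b)) \<and>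
     (\<forall>D A B a b. open D \<and> simply_connected D \<longrightarrow>
        ((\<exists>x y z u I. solves_S D x y z u \<and> point_transf D x y z u I A B a b) \<longleftrightarrow>
         solves_J D A B a b \<and> (\<forall>\<tau>\<in>D. A \<tau> \<noteq> 0 \<and> (a \<tau>)\<^sup>2 + 32 * b \<tau> \<noteq> 0))))
    \<and>
    ((\<forall>\<alpha> \<beta> \<gamma> \<delta> \<epsilon>. \<alpha> * \<delta> - \<beta> * \<gamma> = 1 \<and> \<epsilon> \<noteq> 0 \<longrightarrow>
        solves_S (gen_dom \<alpha> \<beta> \<gamma> \<delta>)
          (gen_x \<alpha> \<beta> \<gamma> \<delta> \<epsilon>) (gen_y \<alpha> \<beta> \<gamma> \<delta>) (gen_z \<alpha> \<beta> \<gamma> \<delta>) (gen_u \<alpha> \<beta> \<gamma> \<delta>)) \<and>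
     (\<forall>D x y z u \<tau>0. open D \<and> connected D \<and> solves_S D x y z u \<and> \<tau>0 \<in> D \<and>
        x \<tau>0 \<noteq> 0 \<and> y \<tau>0 \<noteq> 0 \<and> z \<tau>0 \<noteq> 0 \<and> (y \<tau>0)\<^sup>2 \<noteq> (z \<tau>0)\<^sup>2 \<longrightarrow>
        (\<exists>\<alpha> \<beta> \<gamma> \<delta> \<epsilon>. \<alpha> * \<delta> - \<beta> * \<gamma> = 1 \<and> \<epsilon> \<noteq> 0 \<and> D \<subseteq> gen_dom \<alpha> \<beta> \<gamma> \<delta> \<and>
           (\<forall>\<tau>\<in>D. x \<tau> = gen_x \<alpha> \<beta> \<gamma> \<delta> \<epsilon> \<tau> \<and> y \<tau> = gen_y \<alpha> \<beta> \<gamma> \<delta> \<tau> \<and>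
                  z \<tau> = gen_z \<alpha> \<beta> \<gamma> \<delta> \<tau> \<and> u \<tau> = gen_u \<alpha> \<beta> \<gamma> \<delta> \<tau>))))
    \<and>
    ((\<forall>\<gamma> \<delta> s. s \<in> {1, -1} \<longrightarrow>
        solves_S {\<tau>. \<gamma> * \<tau> + \<delta> \<noteq> 0} (\<lambda>\<tau>. 0) (\<lambda>\<tau>. s / (\<gamma> * \<tau> + \<delta>)) (\<lambda>\<tau>. 1 / (\<gamma> * \<tau> + \<delta>))
          (\<lambda>\<tau>. - (\<gamma>\<^sup>2 * \<tau> + \<gamma> * \<delta> - 1) / (\<gamma> * \<tau> + \<delta>)\<^sup>2)) \<and>
     (\<forall>D x y z u. open D \<and> connected D \<and> solves_S D x y z u \<and>
        (\<forall>\<tau>\<in>D. x \<tau> = 0 \<and> (y \<tau>)\<^sup>2 = (z \<tau>)\<^sup>2 \<and> z \<tau> \<noteq> 0) \<longrightarrow>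
        (\<exists>\<gamma> \<delta> s. s \<in> {1, -1} \<and> (\<forall>\<tau>\<in>D. \<gamma> * \<tau> + \<delta> \<noteq> 0 \<and>
           y \<tau> = s / (\<gamma> * \<tau> + \<delta>) \<and> z \<tau> = 1 / (\<gamma> * \<tau> + \<delta>) \<and>
           u \<tau> = - (\<gamma>\<^sup>2 * \<tau> + \<gamma> * \<delta> - 1) / (\<gamma> * \<tau> + \<delta>)\<^sup>2))))"
proof (intro conjI allI impI; (elim conjE)?)
  fix D :: "complex set" and x y z u
  assume D: "open D" "connected D" and s: "solves_S D x y z u" and x: "\<forall>\<tau>\<in>D. x \<tau> \<noteq> 0"
  obtain k where "\<And>\<tau>. \<tau> \<in> D \<Longrightarrow> ((y \<tau>)\<^sup>2 - (z \<tau>)\<^sup>2) / (x \<tau>)\<^sup>2 = k"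
    using S_integral_constant[OF D s] x by blast
  then show "\<exists>c::complex. \<forall>\<tau>\<in>D. of_real pi * c\<^sup>2 = ((y \<tau>)\<^sup>2 - (z \<tau>)\<^sup>2) / (x \<tau>)\<^sup>2"
    by (intro exI[of _ "csqrt (k / of_real pi)"]) simp
next
  fix D :: "complex set" and x y z u I A B a b
  assume "open D" "connected D" "solves_S D x y z u" "point_transf D x y z u I A B a b"
  then show "I constant_on D" by (rule S_imp_I_constant)
next
  fix D :: "complex set" and x y z u I A B a b
  assume "open D" "connected D" "x holomorphic_on D" "y holomorphic_on D" "z holomorphic_on D" "u holomorphic_on D"
    "point_transf D x y z u I A B a b"
  then show "solves_S D x y z u \<longleftrightarrow> solves_J D A B a b" by (rule S_iff_J)
next
  fix D :: "complex set" and A B a b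
  assume D: "open D" "simply_connected D"
  have conn: "connected D" using D(2) by (rule simply_connected_imp_connected)
  show "(\<exists>x y z u I. solves_S D x y z u \<and> point_transf D x y z u I A B a b) \<longleftrightarrow>
         solves_J D A B a b \<and> (\<forall>\<tau>\<in>D. A \<tau> \<noteq> 0 \<and> (a \<tau>)\<^sup>2 + 32 * b \<tau> \<noteq> 0)"
  proof
    assume "\<exists>x y z u I. solves_S D x y z u \<and> point_transf D x y z u I A B a b"
    then obtain x y z u I where s: "solves_S D x y z u" and p: "point_transf D x y z u I A B a b" by blast
    have "1 - \<i> \<noteq> 0" by (simp add: complex_eq_iff)
    then have "A \<tau> \<noteq> 0 \<and> (a \<tau>)\<^sup>2 + 32 * b \<tau> \<noteq> 0" if "\<tau> \<in> D" for \<tau>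
      unfolding point_transf_discriminant[OF p that] point_transf_relations(5)[OF p that]
      using point_transf_relations(2,3)[OF p that] by simp
    then show "solves_J D A B a b \<and> (\<forall>\<tau>\<in>D. A \<tau> \<noteq> 0 \<and> (a \<tau>)\<^sup>2 + 32 * b \<tau> \<noteq> 0)"
      using S_iff_J[OF D(1) conn solves_S_holomorphic[OF D(1) s] p] s by blast
  next
    assume "solves_J D A B a b \<and> (\<forall>\<tau>\<in>D. A \<tau> \<noteq> 0 \<and> (a \<tau>)\<^sup>2 + 32 * b \<tau> \<noteq> 0)"
    then show "\<exists>x y z u I. solves_S D x y z u \<and> point_transf D x y z u I A B a b"
      using J_solution_lifts[OF D] by metis
  qed
next
  fix \<alpha> \<beta> \<gamma> \<delta> \<epsilon> :: complex
  assume "\<alpha> * \<delta> - \<beta> * \<gamma> = 1"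
  then show "solves_S (gen_dom \<alpha> \<beta> \<gamma> \<delta>)
          (gen_x \<alpha> \<beta> \<gamma> \<delta> \<epsilon>) (gen_y \<alpha> \<beta> \<gamma> \<delta>) (gen_z \<alpha> \<beta> \<gamma> \<delta>) (gen_u \<alpha> \<beta> \<gamma> \<delta>)"
    by (rule general_solution_solves_S)
qed (blast intro: general_solution_complete elementary_solution_solves_S elementary_solution_complete)+

end
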